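(* There exists an adjunction between the category $\mathbf{Fbox}$ of functor box signatures and the category $\mathbf{Lax}$ of pairs of monoidal categories with a lax monoidal functor between them. The free side (left adjoint $\mathbf{Fbox}\to\mathbf{Lax}$) of this adjunction is given by the syntactic 2-category of a functor box signature: it sends a functor box signature $\mathcal{F}=(\mathcal{A},\mathcal{X},\mathcal{F}_\bullet,\mathcal{F}^\bullet)$ to the lax monoidal functor presented by its syntactic 2-category $\mathbb{S}_{\mathcal{A},\mathcal{X},\mathcal{F}}$.
   Context: All monoidal categories, (non-lax) monoidal functors and 2-categories are strict. Composition, written $⨾$, is in diagrammatic order. A functor box signature $\mathcal{F}=(\mathcal{A},\mathcal{X},\mathcal{F}_\bullet,\mathcal{F}^\bullet)$ consists of two sets $\mathcal{A}_{obj}$, $\mathcal{X}_{obj}$ and four types of edge sets, indexed by finite lists of objects: plain edges $\mathcal{A}(A_0,\dots,A_n;B_0,\dots,B_m)$ with $A_i,B_j\in\mathcal{A}_{obj}$; functor box edges $\mathcal{X}(X_0,\dots,X_n;Y_0,\dots,Y_m)$ with $X_i,Y_j\in\mathcal{X}_{obj}$; in-box edges $\mathcal{F}_\bullet(A_0,\dots,A_n;Y_0,\dots,Y_m)$ with $A_i\in\mathcal{A}_{obj}$, $Y_j\in\mathcal{X}_{obj}$; out-box edges $\mathcal{F}^\bullet(X_0,\dots,X_n;B_0,\dots,B_m)$ with $X_i\in\mathcal{X}_{obj}$, $B_j\in\mathcal{A}_{obj}$. A morphism $(\mathcal{A},\mathcal{X},\mathcal{F})\to(\mathcal{B},\mathcal{Y},\mathcal{G})$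 is a pair of functions $h_{obj}\colon\mathcal{A}_{obj}\to\mathcal{B}_{obj}$, $k_{obj}\colon\mathcal{X}_{obj}\to\mathcal{Y}_{obj}$ together with compatible functions between the four types of edge sets (sources and targets mapped elementwise). These form the category $\mathbf{Fbox}$. The syntactic 2-category $\mathbb{S}=\mathbb{S}_{\mathcal{A},\mathcal{X},\mathcal{F}}$ is the 2-category freely presented by: two 0-cells $\mathcal{A},\mathcal{X}$; a 1-cell $A\colon\mathcal{A}\to\mathcal{A}$ for each $A\in\mathcal{A}_{obj}$, a 1-cell $X\colon\mathcal{X}\to\mathcal{X}$ for each $X\in\mathcal{X}_{obj}$, and 1-cells $F^\uparrow\colon\mathcal{A}\to\mathcal{X}$, $F^\downarrow\colon\mathcal{X}\to\mathcal{A}$; 2-cells $n\colon\mathrm{id}\to F^\uparrow⨾F^\downarrow$ and $e\colon F^\downarrow⨾F^\uparrow\to\mathrm{id}$ satisfying the snake (triangle) equations of an adjunction $F^\uparrow\dashv F^\downarrow$; a 2-cell $A_0⨾\cdots⨾A_n\to B_0⨾\cdots⨾B_m$ for each plain edge; a 2-cell $X_0⨾\cdots⨾X_n\to Y_0⨾\cdots⨾Y_m$ for each functor box edge; a 2-cell $A_0⨾\cdots⨾A_n\to F^\uparrow⨾Y_0⨾\cdots⨾Y_m⨾F^\downarrow$ for each in-box edge; and a 2-cell $F^\uparrow⨾X_0⨾\cdots⨾X_n⨾F^\downarrow\to B_0⨾\cdots⨾B_m$ for each out-box edge. The lax monoidal functor presented by $\mathbb{S}$: the codomain monoidal category is $\mathbb{S}(\mathcal{A},\mathcal{A})$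 with tensor the composition of 1-cells; the domain monoidal category is the full monoidal subcategory of $\mathbb{S}(\mathcal{X},\mathcal{X})$ on the composites of the generating 1-cells $X\in\mathcal{X}_{obj}$; the functor is $F(W)=F^\uparrow⨾W⨾F^\downarrow$ (acting on 2-cells by whiskering), with $\varepsilon=n$ and with $\mu\colon F^\uparrow⨾W⨾F^\downarrow⨾F^\uparrow⨾V⨾F^\downarrow\to F^\uparrow⨾W⨾V⨾F^\downarrow$ given by whiskering $e$. The category $\mathbf{Lax}$: an object is a pair of monoidal categories $(\mathbb{A},\mathbb{X})$ with a lax monoidal functor $(F,\varepsilon,\mu)$, that is, a functor $F\colon\mathbb{X}\to\mathbb{A}$ with natural transformations $\varepsilon\colon I\to FI$ and $\mu\colon FX\otimes FY\to F(X\otimes Y)$ satisfying $(\mu\otimes\mathrm{id})⨾\mu=(\mathrm{id}\otimes\mu)⨾\mu$, $(\varepsilon\otimes\mathrm{id})⨾\mu=\mathrm{id}$ and $(\mathrm{id}\otimes\varepsilon)⨾\mu=\mathrm{id}$. A morphism from $(\mathbb{A},\mathbb{X},F,\varepsilon_F,\mu_F)$ to $(\mathbb{B},\mathbb{Y},G,\varepsilon_G,\mu_G)$ is a pair of (strict) monoidal functors $H\colon\mathbb{X}\to\mathbb{Y}$, $K\colon\mathbb{A}\to\mathbb{B}$ such that $F⨾K=H⨾G$, $K(\varepsilon_F)=\varepsilon_G$ and $K(\mu_F)=\mu_G$. *)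

theory Defs
  imports Main "HOL-Library.FuncSet"
begin

section \<open>Categories, functors, adjunctions\<close>

text \<open>Composition is written in diagrammatic order throughout.  The values of the
  operations outside the carriers, or on non-composable arguments, are irrelevant.\<close>

record ('o, 'm) cat =
  Obj :: "'o set"
  Arr :: "'m set"
  Dom :: "'m \<Rightarrow> 'o"
  Cod :: "'m \<Rightarrow> 'o"
  Idn :: "'o \<Rightarrow> 'm"
  Cmp :: "'m \<Rightarrow> 'm \<Rightarrow> 'm"  (infixl ";;\<index>" 65)

definition hom :: "('o, 'm, 'z) cat_scheme \<Rightarrow> 'o \<Rightarrow> 'o \<Rightarrow> 'm set" where
  "hom C a b = {f \<in> Arr C. Dom C f = a \<and> Cod C f = b}"

locale category =
  fixes C :: "('o, 'm, 'z) cat_scheme"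
  assumes dom_obj: "f \<in> Arr C \<Longrightarrow> Dom C f \<in> Obj C"
    and cod_obj: "f \<in> Arr C \<Longrightarrow> Cod C f \<in> Obj C"
    and id_hom: "a \<in> Obj C \<Longrightarrow> Idn C a \<in> hom C a a"
    and comp_hom: "f \<in> hom C a b \<Longrightarrow> g \<in> hom C b c \<Longrightarrow> f ;;\<^bsub>C\<^esub> g \<in> hom C a c"
    and id_left: "f \<in> hom C a b \<Longrightarrow> Idn C a ;;\<^bsub>C\<^esub> f = f"
    and id_right: "f \<in> hom C a b \<Longrightarrow> f ;;\<^bsub>C\<^esub> Idn C b = f"
    and comp_assoc: "f \<in> hom C a b \<Longrightarrow> g \<in> hom C b c \<Longrightarrow> h \<in> hom C c d \<Longrightarrow>
      (f ;;\<^bsub>C\<^esub> g) ;;\<^bsub>C\<^esub> h = f ;;\<^bsub>C\<^esub> (g ;;\<^bsub>C\<^esub> h)"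

record ('o, 'm, 'p, 'n) fct =
  FO :: "'o \<Rightarrow> 'p"
  FM :: "'m \<Rightarrow> 'n"

locale is_functor = C: category C + D: category D
  for C :: "('o, 'm, 'y) cat_scheme" and D :: "('p, 'n, 'z) cat_scheme"
    and F :: "('o, 'm, 'p, 'n) fct" +
  assumes map_obj: "a \<in> Obj C \<Longrightarrow> FO F a \<in> Obj D"
    and map_hom: "f \<in> hom C a b \<Longrightarrow> FM F f \<in> hom D (FO F a) (FO F b)"
    and map_id: "a \<in> Obj C \<Longrightarrow> FM F (Idn C a) = Idn D (FO F a)"
    and map_comp: "f \<in> hom C a b \<Longrightarrow> g \<in> hom C b c \<Longrightarrow>
      FM F (f ;;\<^bsub>C\<^esub> g) = FM F f ;;\<^bsub>D\<^esub> FM F g"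

text \<open>\<open>L\<close> is left adjoint to \<open>R\<close>, witnessed by bijections \<open>\<phi> c d : D(L c, d) \<rightarrow> C(c, R d)\<close>
  that are natural in both arguments.\<close>

locale adjunction = L: is_functor C D L + R: is_functor D C R
  for C :: "('o, 'm) cat" and D :: "('p, 'n) cat"
    and L :: "('o, 'm, 'p, 'n) fct" and R :: "('p, 'n, 'o, 'm) fct"
    and \<phi> :: "'o \<Rightarrow> 'p \<Rightarrow> 'n \<Rightarrow> 'm" +
  assumes bij: "c \<in> Obj C \<Longrightarrow> d \<in> Obj D \<Longrightarrow>
      bij_betw (\<phi> c d) (hom D (FO L c) d) (hom C c (FO R d))"
    and natural: "f \<in> hom C c' c \<Longrightarrow> g \<in> hom D (FO L c) d \<Longrightarrow> k \<in> hom D d d' \<Longrightarrow>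
      \<phi> c' d' (FM L f ;;\<^bsub>D\<^esub> g ;;\<^bsub>D\<^esub> k) = f ;;\<^bsub>C\<^esub> \<phi> c d g ;;\<^bsub>C\<^esub> FM R k"


section \<open>Strict monoidal categories and lax monoidal functors\<close>

record ('o, 'm) moncat = "('o, 'm) cat" +
  Unit :: 'o
  TenO :: "'o \<Rightarrow> 'o \<Rightarrow> 'o"
  TenA :: "'m \<Rightarrow> 'm \<Rightarrow> 'm"

locale monoidal_category = category M for M :: "('o, 'm) moncat" +
  assumes unit_obj: "Unit M \<in> Obj M"
    and ten_obj: "a \<in> Obj M \<Longrightarrow> b \<in> Obj M \<Longrightarrow> TenO M a b \<in> Obj M"
    and ten_obj_assoc: "a \<in> Obj M \<Longrightarrow> b \<in> Obj M \<Longrightarrow> c \<in> Obj M \<Longrightarrow>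
      TenO M (TenO M a b) c = TenO M a (TenO M b c)"
    and ten_obj_unit_left: "a \<in> Obj M \<Longrightarrow> TenO M (Unit M) a = a"
    and ten_obj_unit_right: "a \<in> Obj M \<Longrightarrow> TenO M a (Unit M) = a"
    and ten_hom: "f \<in> hom M a b \<Longrightarrow> g \<in> hom M c d \<Longrightarrow>
      TenA M f g \<in> hom M (TenO M a c) (TenO M b d)"
    and ten_id: "a \<in> Obj M \<Longrightarrow> b \<in> Obj M \<Longrightarrow>
      TenA M (Idn M a) (Idn M b) = Idn M (TenO M a b)"
    and ten_comp: "f \<in> hom M a b \<Longrightarrow> g \<in> hom M b c \<Longrightarrow> f' \<in> hom M a' b' \<Longrightarrow> g' \<in> hom M b' c' \<Longrightarrow>
      TenA M (f ;;\<^bsub>M\<^esub> g) (f' ;;\<^bsub>M\<^esub> g') = TenA M f f' ;;\<^bsub>M\<^esub> TenA M g g'"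
    and ten_assoc: "f \<in> Arr M \<Longrightarrow> g \<in> Arr M \<Longrightarrow> h \<in> Arr M \<Longrightarrow>
      TenA M (TenA M f g) h = TenA M f (TenA M g h)"
    and ten_unit_left: "f \<in> Arr M \<Longrightarrow> TenA M (Idn M (Unit M)) f = f"
    and ten_unit_right: "f \<in> Arr M \<Longrightarrow> TenA M f (Idn M (Unit M)) = f"

locale monoidal_functor = M: monoidal_category M + N: monoidal_category N + is_functor M N F
  for M :: "('o, 'm) moncat" and N :: "('p, 'n) moncat" and F :: "('o, 'm, 'p, 'n) fct" +
  assumes map_unit: "FO F (Unit M) = Unit N"
    and map_ten_obj: "a \<in> Obj M \<Longrightarrow> b \<in> Obj M \<Longrightarrow> FO F (TenO M a b) = TenO N (FO F a) (FO F b)"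
    and map_ten: "f \<in> Arr M \<Longrightarrow> g \<in> Arr M \<Longrightarrow> FM F (TenA M f g) = TenA N (FM F f) (FM F g)"

definition full_monoidal_subcategory :: "('o, 'm) moncat \<Rightarrow> 'o set \<Rightarrow> ('o, 'm) moncat" where
  "full_monoidal_subcategory M S =
    M \<lparr>Obj := S, Arr := {f \<in> Arr M. Dom M f \<in> S \<and> Cod M f \<in> S}\<rparr>"

record ('xo, 'xm, 'ao, 'am) lax =
  Source :: "('xo, 'xm) moncat"
  Target :: "('ao, 'am) moncat"
  Fun :: "('xo, 'xm, 'ao, 'am) fct"
  eps :: 'am
  mu :: "'xo \<Rightarrow> 'xo \<Rightarrow> 'am"

definition lax_monoidal :: "('xo, 'xm, 'ao, 'am) lax \<Rightarrow> bool" where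
  "lax_monoidal T \<longleftrightarrow>
    (let X = Source T; A = Target T; F = FO (Fun T); F' = FM (Fun T); \<mu> = mu T in
     monoidal_category X \<and> monoidal_category A \<and> is_functor X A (Fun T) \<and>
     eps T \<in> hom A (Unit A) (F (Unit X)) \<and>
     (\<forall>x \<in> Obj X. \<forall>y \<in> Obj X. \<mu> x y \<in> hom A (TenO A (F x) (F y)) (F (TenO X x y))) \<and>
     (\<forall>f \<in> Arr X. \<forall>g \<in> Arr X.
        TenA A (F' f) (F' g) ;;\<^bsub>A\<^esub> \<mu> (Cod X f) (Cod X g) =
        \<mu> (Dom X f) (Dom X g) ;;\<^bsub>A\<^esub> F' (TenA X f g)) \<and>
     (\<forall>x \<in> Obj X. \<forall>y \<in> Obj X. \<forall>z \<in> Obj X.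
        TenA A (\<mu> x y) (Idn A (F z)) ;;\<^bsub>A\<^esub> \<mu> (TenO X x y) z =
        TenA A (Idn A (F x)) (\<mu> y z) ;;\<^bsub>A\<^esub> \<mu> x (TenO X y z)) \<and>
     (\<forall>x \<in> Obj X.
        TenA A (eps T) (Idn A (F x)) ;;\<^bsub>A\<^esub> \<mu> (Unit X) x = Idn A (F x) \<and>
        TenA A (Idn A (F x)) (eps T) ;;\<^bsub>A\<^esub> \<mu> x (Unit X) = Idn A (F x)))"


section \<open>The category of lax monoidal functors\<close>

text \<open>The two ends of a morphism may live over different types; this is needed to compare a
  lax monoidal functor with a copy of it inside a fixed universe.\<close>

record ('xo, 'xm, 'ao, 'am, 'yo, 'ym, 'bo, 'bm) lax_mor =
  LDom :: "('xo, 'xm, 'ao, 'am) lax"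
  LCod :: "('yo, 'ym, 'bo, 'bm) lax"
  LH :: "('xo, 'xm, 'yo, 'ym) fct"
  LK :: "('ao, 'am, 'bo, 'bm) fct"

definition functor_extensional :: "('o, 'm, 'z) cat_scheme \<Rightarrow> ('o, 'm, 'p, 'n) fct \<Rightarrow> bool" where
  "functor_extensional C F \<longleftrightarrow> FO F \<in> extensional (Obj C) \<and> FM F \<in> extensional (Arr C)"

definition id_functor :: "('o, 'm, 'z) cat_scheme \<Rightarrow> ('o, 'm, 'o, 'm) fct" where
  "id_functor C = \<lparr>FO = restrict (\<lambda>a. a) (Obj C), FM = restrict (\<lambda>f. f) (Arr C)\<rparr>"

definition comp_functor ::
  "('o, 'm, 'z) cat_scheme \<Rightarrow> ('o, 'm, 'p, 'n) fct \<Rightarrow> ('p, 'n, 'q, 'k) fct \<Rightarrow> ('o, 'm, 'q, 'k) fct"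
  where "comp_functor C F G =
    \<lparr>FO = restrict (\<lambda>a. FO G (FO F a)) (Obj C), FM = restrict (\<lambda>f. FM G (FM F f)) (Arr C)\<rparr>"

text \<open>Functors are required to be extensional so that equal morphisms are equal as HOL values.\<close>

definition is_lax_mor :: "('xo, 'xm, 'ao, 'am, 'yo, 'ym, 'bo, 'bm) lax_mor \<Rightarrow> bool" where
  "is_lax_mor m \<longleftrightarrow>
    (let S = LDom m; T = LCod m; H = LH m; K = LK m in
     lax_monoidal S \<and> lax_monoidal T \<and>
     monoidal_functor (Source S) (Source T) H \<and> functor_extensional (Source S) H \<and>
     monoidal_functor (Target S) (Target T) K \<and> functor_extensional (Target S) K \<and>
     (\<forall>x \<in> Obj (Source S). FO K (FO (Fun S) x) = FO (Fun T) (FO H x)) \<and>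
     (\<forall>f \<in> Arr (Source S). FM K (FM (Fun S) f) = FM (Fun T) (FM H f)) \<and>
     FM K (eps S) = eps T \<and>
     (\<forall>x \<in> Obj (Source S). \<forall>y \<in> Obj (Source S). FM K (mu S x y) = mu T (FO H x) (FO H y)))"

definition lax_id ::
  "('xo, 'xm, 'ao, 'am) lax \<Rightarrow> ('xo, 'xm, 'ao, 'am, 'xo, 'xm, 'ao, 'am) lax_mor" where
  "lax_id T = \<lparr>LDom = T, LCod = T, LH = id_functor (Source T), LK = id_functor (Target T)\<rparr>"

definition lax_comp ::
  "('xo, 'xm, 'ao, 'am, 'yo, 'ym, 'bo, 'bm) lax_mor \<Rightarrow>
   ('yo, 'ym, 'bo, 'bm, 'zo, 'zm, 'co, 'cm) lax_mor \<Rightarrow>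
   ('xo, 'xm, 'ao, 'am, 'zo, 'zm, 'co, 'cm) lax_mor" where
  "lax_comp m m' = \<lparr>LDom = LDom m, LCod = LCod m',
    LH = comp_functor (Source (LDom m)) (LH m) (LH m'),
    LK = comp_functor (Target (LDom m)) (LK m) (LK m')\<rparr>"

definition is_lax_iso :: "('xo, 'xm, 'ao, 'am, 'yo, 'ym, 'bo, 'bm) lax_mor \<Rightarrow> bool" where
  "is_lax_iso m \<longleftrightarrow> is_lax_mor m \<and>
    (\<exists>m'. is_lax_mor m' \<and> LDom m' = LCod m \<and> LCod m' = LDom m \<and>
      lax_comp m m' = lax_id (LDom m) \<and> lax_comp m' m = lax_id (LCod m))"

text \<open>The type parameter \<open>'u\<close> serves as the universe from which all objects and arrows are drawn.
  For the free construction to stay inside it, \<open>'u\<close> has to be infinite.\<close>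

type_synonym 'u ulax = "('u, 'u, 'u, 'u) lax"
type_synonym 'u ulax_mor = "('u, 'u, 'u, 'u, 'u, 'u, 'u, 'u) lax_mor"

definition Lax :: "('u ulax, 'u ulax_mor) cat" where
  "Lax = \<lparr>Obj = {T. lax_monoidal T}, Arr = {m. is_lax_mor m}, Dom = LDom, Cod = LCod,
    Idn = lax_id, Cmp = lax_comp\<rparr>"


section \<open>The category of functor box signatures\<close>

text \<open>Edge sets with different indices need not be disjoint.  They are required to be empty
  at lists that are not lists of objects.  The empty list is an admissible index.\<close>

record 'u fsig =
  AObj :: "'u set"
  XObj :: "'u set"
  Plain :: "'u list \<Rightarrow> 'u list \<Rightarrow> 'u set"
  FBox :: "'u list \<Rightarrow> 'u list \<Rightarrow> 'u set"
  InBox :: "'u list \<Rightarrow> 'u list \<Rightarrow> 'u set"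
  OutBox :: "'u list \<Rightarrow> 'u list \<Rightarrow> 'u set"

definition is_fsig :: "'u fsig \<Rightarrow> bool" where
  "is_fsig S \<longleftrightarrow>
    (\<forall>us vs. Plain S us vs \<noteq> {} \<longrightarrow> us \<in> lists (AObj S) \<and> vs \<in> lists (AObj S)) \<and>
    (\<forall>us vs. FBox S us vs \<noteq> {} \<longrightarrow> us \<in> lists (XObj S) \<and> vs \<in> lists (XObj S)) \<and>
    (\<forall>us vs. InBox S us vs \<noteq> {} \<longrightarrow> us \<in> lists (AObj S) \<and> vs \<in> lists (XObj S)) \<and>
    (\<forall>us vs. OutBox S us vs \<noteq> {} \<longrightarrow> us \<in> lists (XObj S) \<and> vs \<in> lists (AObj S))"

record 'u fsig_mor =
  SDom :: "'u fsig"
  SCod :: "'u fsig"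
  hobj :: "'u \<Rightarrow> 'u"
  kobj :: "'u \<Rightarrow> 'u"
  hPlain :: "'u list \<Rightarrow> 'u list \<Rightarrow> 'u \<Rightarrow> 'u"
  hFBox :: "'u list \<Rightarrow> 'u list \<Rightarrow> 'u \<Rightarrow> 'u"
  hInBox :: "'u list \<Rightarrow> 'u list \<Rightarrow> 'u \<Rightarrow> 'u"
  hOutBox :: "'u list \<Rightarrow> 'u list \<Rightarrow> 'u \<Rightarrow> 'u"

definition is_fsig_mor :: "'u fsig_mor \<Rightarrow> bool" where
  "is_fsig_mor m \<longleftrightarrow>
    (let S = SDom m; T = SCod m; h = hobj m; k = kobj m in
     is_fsig S \<and> is_fsig T \<and>
     h \<in> AObj S \<rightarrow>\<^sub>E AObj T \<and>
     k \<in> XObj S \<rightarrow>\<^sub>E XObj T \<and>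
     (\<forall>us vs. hPlain m us vs \<in> Plain S us vs \<rightarrow>\<^sub>E Plain T (map h us) (map h vs)) \<and>
     (\<forall>us vs. hFBox m us vs \<in> FBox S us vs \<rightarrow>\<^sub>E FBox T (map k us) (map k vs)) \<and>
     (\<forall>us vs. hInBox m us vs \<in> InBox S us vs \<rightarrow>\<^sub>E InBox T (map h us) (map k vs)) \<and>
     (\<forall>us vs. hOutBox m us vs \<in> OutBox S us vs \<rightarrow>\<^sub>E OutBox T (map k us) (map h vs)))"

definition fsig_id :: "'u fsig \<Rightarrow> 'u fsig_mor" where
  "fsig_id S = \<lparr>SDom = S, SCod = S,
    hobj = restrict (\<lambda>a. a) (AObj S), kobj = restrict (\<lambda>x. x) (XObj S),
    hPlain = (\<lambda>us vs. restrict (\<lambda>e. e) (Plain S us vs)),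
    hFBox = (\<lambda>us vs. restrict (\<lambda>e. e) (FBox S us vs)),
    hInBox = (\<lambda>us vs. restrict (\<lambda>e. e) (InBox S us vs)),
    hOutBox = (\<lambda>us vs. restrict (\<lambda>e. e) (OutBox S us vs))\<rparr>"

definition fsig_comp :: "'u fsig_mor \<Rightarrow> 'u fsig_mor \<Rightarrow> 'u fsig_mor" where
  "fsig_comp m m' =
    (let S = SDom m; h = map (hobj m); k = map (kobj m) in
     \<lparr>SDom = S, SCod = SCod m',
      hobj = compose (AObj S) (hobj m') (hobj m),
      kobj = compose (XObj S) (kobj m') (kobj m),
      hPlain = (\<lambda>us vs. compose (Plain S us vs) (hPlain m' (h us) (h vs)) (hPlain m us vs)),
      hFBox = (\<lambda>us vs. compose (FBox S us vs) (hFBox m' (k us) (k vs)) (hFBox m us vs)),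
      hInBox = (\<lambda>us vs. compose (InBox S us vs) (hInBox m' (h us) (k vs)) (hInBox m us vs)),
      hOutBox = (\<lambda>us vs. compose (OutBox S us vs) (hOutBox m' (k us) (h vs)) (hOutBox m us vs))\<rparr>)"

definition Fbox :: "('u fsig, 'u fsig_mor) cat" where
  "Fbox = \<lparr>Obj = {S. is_fsig S}, Arr = {m. is_fsig_mor m}, Dom = SDom, Cod = SCod,
    Idn = fsig_id, Cmp = fsig_comp\<rparr>"


section \<open>Freely presented strict 2-categories\<close>

record ('z, 'o, 'm) two_cat =
  Cells0 :: "'z set"
  Cells1 :: "'o set"
  Cells2 :: "'m set"
  Dom1 :: "'o \<Rightarrow> 'z"
  Cod1 :: "'o \<Rightarrow> 'z"
  Id1 :: "'z \<Rightarrow> 'o"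
  Comp1 :: "'o \<Rightarrow> 'o \<Rightarrow> 'o"
  Dom2 :: "'m \<Rightarrow> 'o"
  Cod2 :: "'m \<Rightarrow> 'o"
  Id2 :: "'o \<Rightarrow> 'm"
  VComp :: "'m \<Rightarrow> 'm \<Rightarrow> 'm"
  HComp :: "'m \<Rightarrow> 'm \<Rightarrow> 'm"

text \<open>A 1-cell of the free 2-category is a path of generating 1-cells, recorded together with its
  two ends (so the empty paths at different 0-cells differ).  A 2-cell is a class of terms.\<close>

type_synonym ('z, 'g) path = "'z \<times> 'g list \<times> 'z"

datatype ('z, 'g, 'c) tm =
    IdT "('z, 'g) path"
  | GenT 'c
  | VT "('z, 'g, 'c) tm" "('z, 'g, 'c) tm"
  | HT "('z, 'g, 'c) tm" "('z, 'g, 'c) tm"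

record ('z, 'g, 'c) presentation =
  Gens0 :: "'z set"
  Gens1 :: "'g set"
  gdom1 :: "'g \<Rightarrow> 'z"
  gcod1 :: "'g \<Rightarrow> 'z"
  Gens2 :: "'c set"
  gdom2 :: "'c \<Rightarrow> ('z, 'g) path"
  gcod2 :: "'c \<Rightarrow> ('z, 'g) path"
  Rels :: "(('z, 'g, 'c) tm \<times> ('z, 'g, 'c) tm) set"

fun path_from :: "('z, 'g, 'c) presentation \<Rightarrow> 'z \<Rightarrow> 'g list \<Rightarrow> 'z \<Rightarrow> bool" where
  "path_from P c [] d \<longleftrightarrow> c \<in> Gens0 P \<and> c = d"
| "path_from P c (g # gs) d \<longleftrightarrow>
    c \<in> Gens0 P \<and> g \<in> Gens1 P \<and> gdom1 P g = c \<and> path_from P (gcod1 P g) gs d"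

definition is_path :: "('z, 'g, 'c) presentation \<Rightarrow> ('z, 'g) path \<Rightarrow> bool" where
  "is_path P p \<longleftrightarrow> (case p of (c, gs, d) \<Rightarrow> path_from P c gs d)"

definition path_dom :: "('z, 'g) path \<Rightarrow> 'z" where
  "path_dom p = fst p"

definition path_cod :: "('z, 'g) path \<Rightarrow> 'z" where
  "path_cod p = snd (snd p)"

definition path_comp :: "('z, 'g) path \<Rightarrow> ('z, 'g) path \<Rightarrow> ('z, 'g) path" where
  "path_comp p q = (fst p, fst (snd p) @ fst (snd q), snd (snd q))"

fun tdom :: "('z, 'g, 'c) presentation \<Rightarrow> ('z, 'g, 'c) tm \<Rightarrow> ('z, 'g) path" where
  "tdom P (IdT p) = p"
| "tdom P (GenT c) = gdom2 P c"
| "tdom P (VT s t) = tdom P s"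
| "tdom P (HT s t) = path_comp (tdom P s) (tdom P t)"

fun tcod :: "('z, 'g, 'c) presentation \<Rightarrow> ('z, 'g, 'c) tm \<Rightarrow> ('z, 'g) path" where
  "tcod P (IdT p) = p"
| "tcod P (GenT c) = gcod2 P c"
| "tcod P (VT s t) = tcod P t"
| "tcod P (HT s t) = path_comp (tcod P s) (tcod P t)"

fun wf_tm :: "('z, 'g, 'c) presentation \<Rightarrow> ('z, 'g, 'c) tm \<Rightarrow> bool" where
  "wf_tm P (IdT p) \<longleftrightarrow> is_path P p"
| "wf_tm P (GenT c) \<longleftrightarrow> c \<in> Gens2 P"
| "wf_tm P (VT s t) \<longleftrightarrow> wf_tm P s \<and> wf_tm P t \<and> tcod P s = tdom P t"
| "wf_tm P (HT s t) \<longleftrightarrow> wf_tm P s \<and> wf_tm P t \<and> path_cod (tdom P s) = path_dom (tdom P t)"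

text \<open>The congruence on well-formed terms generated by the laws of strict 2-categories and the
  relations of the presentation.\<close>

inductive tm_eq :: "('z, 'g, 'c) presentation \<Rightarrow> ('z, 'g, 'c) tm \<Rightarrow> ('z, 'g, 'c) tm \<Rightarrow> bool"
  for P :: "('z, 'g, 'c) presentation" where
  refl: "wf_tm P t \<Longrightarrow> tm_eq P t t"
| sym: "tm_eq P s t \<Longrightarrow> tm_eq P t s"
| trans: "tm_eq P s t \<Longrightarrow> tm_eq P t u \<Longrightarrow> tm_eq P s u"
| vcong: "tm_eq P s s' \<Longrightarrow> tm_eq P t t' \<Longrightarrow> wf_tm P (VT s t) \<Longrightarrow> tm_eq P (VT s t) (VT s' t')"
| hcong: "tm_eq P s s' \<Longrightarrow> tm_eq P t t' \<Longrightarrow> wf_tm P (HT s t) \<Longrightarrow> tm_eq P (HT s t) (HT s' t')"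
| vid_left: "wf_tm P t \<Longrightarrow> tm_eq P (VT (IdT (tdom P t)) t) t"
| vid_right: "wf_tm P t \<Longrightarrow> tm_eq P (VT t (IdT (tcod P t))) t"
| vassoc: "wf_tm P (VT (VT s t) u) \<Longrightarrow> tm_eq P (VT (VT s t) u) (VT s (VT t u))"
| hid_left: "wf_tm P t \<Longrightarrow> c = path_dom (tdom P t) \<Longrightarrow> tm_eq P (HT (IdT (c, [], c)) t) t"
| hid_right: "wf_tm P t \<Longrightarrow> d = path_cod (tdom P t) \<Longrightarrow> tm_eq P (HT t (IdT (d, [], d))) t"
| hassoc: "wf_tm P (HT (HT s t) u) \<Longrightarrow> tm_eq P (HT (HT s t) u) (HT s (HT t u))"
| hid_comp: "wf_tm P (HT (IdT p) (IdT q)) \<Longrightarrow> tm_eq P (HT (IdT p) (IdT q)) (IdT (path_comp p q))"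
| interchange: "wf_tm P (HT (VT s t) (VT s' t')) \<Longrightarrow>
    tm_eq P (HT (VT s t) (VT s' t')) (VT (HT s s') (HT t t'))"
| relation: "(s, t) \<in> Rels P \<Longrightarrow> tm_eq P s t"

definition tm_class :: "('z, 'g, 'c) presentation \<Rightarrow> ('z, 'g, 'c) tm \<Rightarrow> ('z, 'g, 'c) tm set" where
  "tm_class P t = {s. tm_eq P t s}"

definition rep :: "'a set \<Rightarrow> 'a" where
  "rep m = (SOME t. t \<in> m)"

definition free_two_cat ::
  "('z, 'g, 'c) presentation \<Rightarrow> ('z, ('z, 'g) path, ('z, 'g, 'c) tm set) two_cat" where
  "free_two_cat P = \<lparr>
    Cells0 = Gens0 P,
    Cells1 = {p. is_path P p},
    Cells2 = {tm_class P t | t. wf_tm P t},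
    Dom1 = path_dom,
    Cod1 = path_cod,
    Id1 = (\<lambda>c. (c, [], c)),
    Comp1 = path_comp,
    Dom2 = (\<lambda>m. tdom P (rep m)),
    Cod2 = (\<lambda>m. tcod P (rep m)),
    Id2 = (\<lambda>p. tm_class P (IdT p)),
    VComp = (\<lambda>m n. tm_class P (VT (rep m) (rep n))),
    HComp = (\<lambda>m n. tm_class P (HT (rep m) (rep n)))\<rparr>"


section \<open>The syntactic 2-category of a functor box signature\<close>

datatype cell0 = ZA | ZX

datatype 'u gen1 = GA 'u | GX 'u | Up | Down

text \<open>\<open>Eta\<close> and \<open>Counit\<close> are the 2-cells \<open>n\<close> and \<open>e\<close>.  The remaining generators carry the lists
  indexing the edge set they come from.\<close>

datatype 'u gen2 =
    Eta
  | Counit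
  | PlainG "'u list" "'u list" 'u
  | FBoxG "'u list" "'u list" 'u
  | InG "'u list" "'u list" 'u
  | OutG "'u list" "'u list" 'u

fun gen1_dom :: "'u gen1 \<Rightarrow> cell0" where
  "gen1_dom (GA a) = ZA"
| "gen1_dom (GX x) = ZX"
| "gen1_dom Up = ZA"
| "gen1_dom Down = ZX"

fun gen1_cod :: "'u gen1 \<Rightarrow> cell0" where
  "gen1_cod (GA a) = ZA"
| "gen1_cod (GX x) = ZX"
| "gen1_cod Up = ZX"
| "gen1_cod Down = ZA"

definition apath :: "'u list \<Rightarrow> (cell0, 'u gen1) path" where
  "apath us = (ZA, map GA us, ZA)"

definition xpath :: "'u list \<Rightarrow> (cell0, 'u gen1) path" where
  "xpath us = (ZX, map GX us, ZX)"

definition boxpath :: "'u list \<Rightarrow> (cell0, 'u gen1) path" where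
  "boxpath us = (ZA, [Up] @ map GX us @ [Down], ZA)"

fun gen2_dom :: "'u gen2 \<Rightarrow> (cell0, 'u gen1) path" where
  "gen2_dom Eta = (ZA, [], ZA)"
| "gen2_dom Counit = (ZX, [Down, Up], ZX)"
| "gen2_dom (PlainG us vs e) = apath us"
| "gen2_dom (FBoxG us vs e) = xpath us"
| "gen2_dom (InG us vs e) = apath us"
| "gen2_dom (OutG us vs e) = boxpath us"

fun gen2_cod :: "'u gen2 \<Rightarrow> (cell0, 'u gen1) path" where
  "gen2_cod Eta = (ZA, [Up, Down], ZA)"
| "gen2_cod Counit = (ZX, [], ZX)"
| "gen2_cod (PlainG us vs e) = apath vs"
| "gen2_cod (FBoxG us vs e) = xpath vs"
| "gen2_cod (InG us vs e) = boxpath vs"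
| "gen2_cod (OutG us vs e) = apath vs"

abbreviation up_path :: "(cell0, 'u gen1) path" where
  "up_path \<equiv> (ZA, [Up], ZX)"

abbreviation down_path :: "(cell0, 'u gen1) path" where
  "down_path \<equiv> (ZX, [Down], ZA)"

definition syntactic_presentation :: "'u fsig \<Rightarrow> (cell0, 'u gen1, 'u gen2) presentation" where
  "syntactic_presentation S = \<lparr>
    Gens0 = {ZA, ZX},
    Gens1 = GA ` AObj S \<union> GX ` XObj S \<union> {Up, Down},
    gdom1 = gen1_dom,
    gcod1 = gen1_cod,
    Gens2 = {Eta, Counit}
      \<union> {PlainG us vs e | us vs e. e \<in> Plain S us vs}
      \<union> {FBoxG us vs e | us vs e. e \<in> FBox S us vs}
      \<union> {InG us vs e | us vs e. e \<in> InBox S us vs}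
      \<union> {OutG us vs e | us vs e. e \<in> OutBox S us vs},
    gdom2 = gen2_dom,
    gcod2 = gen2_cod,
    Rels = {(VT (HT (GenT Eta) (IdT up_path)) (HT (IdT up_path) (GenT Counit)), IdT up_path),
            (VT (HT (IdT down_path) (GenT Eta)) (HT (GenT Counit) (IdT down_path)), IdT down_path)}\<rparr>"

type_synonym 'u syn1 = "(cell0, 'u gen1) path"
type_synonym 'u syn2 = "(cell0, 'u gen1, 'u gen2) tm set"

definition syntactic_two_cat :: "'u fsig \<Rightarrow> (cell0, 'u syn1, 'u syn2) two_cat" where
  "syntactic_two_cat S = free_two_cat (syntactic_presentation S)"


section \<open>The lax monoidal functor presented by the syntactic 2-category\<close>

definition endo_moncat :: "('z, 'o, 'm) two_cat \<Rightarrow> 'z \<Rightarrow> ('o, 'm) moncat" where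
  "endo_moncat C c =
    (let Os = {p \<in> Cells1 C. Dom1 C p = c \<and> Cod1 C p = c} in
     \<lparr>Obj = Os, Arr = {m \<in> Cells2 C. Dom2 C m \<in> Os \<and> Cod2 C m \<in> Os},
      Dom = Dom2 C, Cod = Cod2 C, Idn = Id2 C, Cmp = VComp C,
      Unit = Id1 C c, TenO = Comp1 C, TenA = HComp C\<rparr>)"

definition presented_lax ::
  "('z, 'o, 'm) two_cat \<Rightarrow> 'z \<Rightarrow> 'z \<Rightarrow> 'o \<Rightarrow> 'o \<Rightarrow> 'm \<Rightarrow> 'm \<Rightarrow> 'o set \<Rightarrow> ('o, 'm, 'o, 'm) lax" where
  "presented_lax C a x u d n e Ws = \<lparr>
    Source = full_monoidal_subcategory (endo_moncat C x) Ws,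
    Target = endo_moncat C a,
    Fun = \<lparr>FO = (\<lambda>W. Comp1 C (Comp1 C u W) d),
           FM = (\<lambda>\<alpha>. HComp C (HComp C (Id2 C u) \<alpha>) (Id2 C d))\<rparr>,
    eps = n,
    mu = (\<lambda>W V. HComp C (HComp C (Id2 C (Comp1 C u W)) e) (Id2 C (Comp1 C V d)))\<rparr>"

type_synonym 'u syn_lax = "('u syn1, 'u syn2, 'u syn1, 'u syn2) lax"

definition syntactic_lax :: "'u fsig \<Rightarrow> 'u syn_lax" where
  "syntactic_lax S =
    (let P = syntactic_presentation S in
     presented_lax (syntactic_two_cat S) ZA ZX up_path down_path
       (tm_class P (GenT Eta)) (tm_class P (GenT Counit)) {xpath us | us. us \<in> lists (XObj S)})"

text \<open>The action of the construction on signature morphisms: relabel the generators.\<close>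

fun gen1_map :: "'u fsig_mor \<Rightarrow> 'u gen1 \<Rightarrow> 'u gen1" where
  "gen1_map m (GA a) = GA (hobj m a)"
| "gen1_map m (GX x) = GX (kobj m x)"
| "gen1_map m Up = Up"
| "gen1_map m Down = Down"

fun gen2_map :: "'u fsig_mor \<Rightarrow> 'u gen2 \<Rightarrow> 'u gen2" where
  "gen2_map m Eta = Eta"
| "gen2_map m Counit = Counit"
| "gen2_map m (PlainG us vs e) = PlainG (map (hobj m) us) (map (hobj m) vs) (hPlain m us vs e)"
| "gen2_map m (FBoxG us vs e) = FBoxG (map (kobj m) us) (map (kobj m) vs) (hFBox m us vs e)"
| "gen2_map m (InG us vs e) = InG (map (hobj m) us) (map (kobj m) vs) (hInBox m us vs e)"
| "gen2_map m (OutG us vs e) = OutG (map (kobj m) us) (map (hobj m) vs) (hOutBox m us vs e)"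

definition syn1_map :: "'u fsig_mor \<Rightarrow> 'u syn1 \<Rightarrow> 'u syn1" where
  "syn1_map m p = (fst p, map (gen1_map m) (fst (snd p)), snd (snd p))"

definition syn2_map :: "'u fsig_mor \<Rightarrow> 'u syn2 \<Rightarrow> 'u syn2" where
  "syn2_map m \<alpha> =
    tm_class (syntactic_presentation (SCod m))
      (map_tm (\<lambda>c. c) (gen1_map m) (gen2_map m) (rep \<alpha>))"

definition syn_functor ::
  "'u fsig_mor \<Rightarrow> ('u syn1, 'u syn2) moncat \<Rightarrow> ('u syn1, 'u syn2, 'u syn1, 'u syn2) fct" where
  "syn_functor m M =
    \<lparr>FO = restrict (syn1_map m) (Obj M), FM = restrict (syn2_map m) (Arr M)\<rparr>"

definition syntactic_lax_mor ::
  "'u fsig_mor \<Rightarrow> ('u syn1, 'u syn2, 'u syn1, 'u syn2, 'u syn1, 'u syn2, 'u syn1, 'u syn2) lax_mor"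
  where "syntactic_lax_mor m =
    (let S = syntactic_lax (SDom m); T = syntactic_lax (SCod m) in
     \<lparr>LDom = S, LCod = T, LH = syn_functor m (Source S), LK = syn_functor m (Target S)\<rparr>)"

text \<open>The syntactic construction takes values over the types of paths and of sets of terms, so it
  can only agree with a functor into the universe \<open>'u\<close> up to natural isomorphism.\<close>

definition naturally_iso_syntactic :: "('u fsig, 'u fsig_mor, 'u ulax, 'u ulax_mor) fct \<Rightarrow> bool" where
  "naturally_iso_syntactic L \<longleftrightarrow>
    (\<exists>\<theta> :: 'u fsig \<Rightarrow> ('u, 'u, 'u, 'u, 'u syn1, 'u syn2, 'u syn1, 'u syn2) lax_mor.
      (\<forall>S \<in> Obj Fbox. is_lax_iso (\<theta> S) \<and> LDom (\<theta> S) = FO L S \<and> LCod (\<theta> S) = syntactic_lax S) \<and>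
      (\<forall>m \<in> Arr Fbox. lax_comp (FM L m) (\<theta> (Cod Fbox m)) =
        lax_comp (\<theta> (Dom Fbox m)) (syntactic_lax_mor m)))"

end

theory Submission
  imports Defs
begin

text \<open>The right adjoint sends a lax monoidal functor \<open>F : X \<rightarrow> A\<close> to the signature whose edges are the
  arrows between tensor products of lists of objects.  A signature morphism into it extends uniquely
  to the syntactic 2-category: a 2-cell is interpreted in every context, i.e. whiskered with a path
  from \<open>ZA\<close> on the left and a path to \<open>ZA\<close> on the right, so that the surrounding paths denote
  objects of \<open>A\<close>, a box contributing the value of \<open>F\<close> at the tensor product of its content.
  The unit of the adjunction is interpreted by \<open>\<epsilon>\<close> and the counit by \<open>\<mu>\<close>; the snake equations become
  the unit laws.  The interpretation respects the interchange law since 2-cells at disjoint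
  positions slide past each other.  It suffices to check this for generators, where it is
  interchange in \<open>A\<close> if the positions are separated by the 0-cell \<open>ZA\<close>, and otherwise functoriality
  of \<open>F\<close>, naturality of \<open>\<mu>\<close> or associativity of \<open>\<mu>\<close> inside a common box.  A 2-cell whose domain is a
  composite of generators \<open>X\<close> is built from functor box edges alone, which gives the interpretation
  in \<open>X\<close>.  As terms over an infinite type can be coded in that type, the free object has a copy
  inside the universe.\<close>

section \<open>Lax monoidal functors and signatures\<close>

text \<open>A lax monoidal functor does not come with a 2-category in which \<open>Up\<close> and
  \<open>Down\<close> could denote adjoint 1-cells, so a 2-cell with an end at \<open>ZX\<close> has
  no value of its own unless it consists of box edges. This is why values exist only for 2-cells
  closed up to endo-cells of \<open>ZA\<close>, and why a horizontal composite cannot be interpreted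
  as a tensor product: it becomes a sequential composite in an arbitrarily chosen order. Uniqueness
  runs the same decomposition backwards. In a closing context every 2-cell is a vertical composite
  of whiskered generators, and a morphism out of the syntactic lax functor is determined on these:
  as it preserves tensor products for generators based at \<open>ZA\<close>, as it preserves
  \<open>mu\<close> for the counit, and as it commutes with the functors for box edges. The
  universal property is proved for the syntactic lax functor over its own types and for codomains
  over arbitrary types. Functoriality of the construction then follows from uniqueness, and only at
  the end is everything conjugated by the isomorphism with the coded copy.\<close>

lemma homI: "f \<in> Arr C \<Longrightarrow> Dom C f = a \<Longrightarrow> Cod C f = b \<Longrightarrow> f \<in> hom C a b"
  by (simp add: hom_def)

lemma homD:
  assumes "f \<in> hom C a b"
  shows "f \<in> Arr C" "Dom C f = a" "Cod C f = b"
  using assms by (auto simp: hom_def)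

context category
begin

lemma hom_obj:
  assumes "f \<in> hom C a b"
  shows "a \<in> Obj C" "b \<in> Obj C"
  using assms dom_obj cod_obj by (auto simp: hom_def)

lemma arr_hom: "f \<in> Arr C \<Longrightarrow> f \<in> hom C (Dom C f) (Cod C f)"
  by (simp add: hom_def)

end

context is_functor
begin

lemma map_arr: "f \<in> Arr C \<Longrightarrow> FM F f \<in> Arr D"
  using map_hom[OF C.arr_hom] by (auto dest: homD)

lemma map_dom: "f \<in> Arr C \<Longrightarrow> Dom D (FM F f) = FO F (Dom C f)"
  using map_hom[OF C.arr_hom] by (auto dest: homD)

lemma map_cod: "f \<in> Arr C \<Longrightarrow> Cod D (FM F f) = FO F (Cod C f)"
  using map_hom[OF C.arr_hom] by (auto dest: homD)

end

lemma fct_eqI: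
  assumes "functor_extensional C F" "functor_extensional C G"
    and "\<And>a. a \<in> Obj C \<Longrightarrow> FO F a = FO G a" "\<And>f. f \<in> Arr C \<Longrightarrow> FM F f = FM G f"
  shows "F = (G :: ('o, 'm, 'p, 'n) fct)"
proof -
  have "FO F = FO G"
    using assms by (auto simp: functor_extensional_def intro: extensionalityI)
  moreover have "FM F = FM G"
    using assms by (auto simp: functor_extensional_def intro: extensionalityI)
  ultimately show ?thesis by simp
qed

lemma comp_functor_simps:
  "a \<in> Obj C \<Longrightarrow> FO (comp_functor C F G) a = FO G (FO F a)"
  "f \<in> Arr C \<Longrightarrow> FM (comp_functor C F G) f = FM G (FM F f)"
  by (simp_all add: comp_functor_def)

lemma comp_functor_extensional: "functor_extensional C (comp_functor C F G)"
  by (simp add: functor_extensional_def comp_functor_def)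

lemma id_functor_extensional: "functor_extensional C (id_functor C)"
  by (simp add: functor_extensional_def id_functor_def)

lemma id_functor_simps:
  "a \<in> Obj C \<Longrightarrow> FO (id_functor C) a = a"
  "f \<in> Arr C \<Longrightarrow> FM (id_functor C) f = f"
  by (simp_all add: id_functor_def)

lemma id_monoidal_functor:
  assumes "monoidal_category M"
  shows "monoidal_functor M M (id_functor M)"
proof -
  interpret M: monoidal_category M by fact
  show ?thesis
    by unfold_locales
      (auto simp: id_functor_def hom_def M.unit_obj M.ten_obj M.dom_obj M.cod_obj
        dest: homD[OF M.id_hom] homD[OF M.comp_hom] homD[OF M.ten_hom, OF M.arr_hom M.arr_hom]
          homD[OF M.comp_hom, OF homI homI])
qed

lemma comp_monoidal_functor:
  assumes "monoidal_functor M N F" "monoidal_functor N P G"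
  shows "monoidal_functor M P (comp_functor M F G)"
proof -
  interpret F: monoidal_functor M N F by fact
  interpret G: monoidal_functor N P G by fact
  show ?thesis
  proof unfold_locales
    fix f a b assume f: "f \<in> hom M a b"
    then show "FM (comp_functor M F G) f
        \<in> hom P (FO (comp_functor M F G) a) (FO (comp_functor M F G) b)"
      using F.M.hom_obj[OF f] G.map_hom[OF F.map_hom[OF f]]
      by (simp add: comp_functor_simps homD)
  next
    fix f g a b c assume fg: "f \<in> hom M a b" "g \<in> hom M b c"
    then show "FM (comp_functor M F G) (f ;;\<^bsub>M\<^esub> g)
        = FM (comp_functor M F G) f ;;\<^bsub>P\<^esub> FM (comp_functor M F G) g"
      using F.M.comp_hom[OF fg] F.map_comp[OF fg] G.map_comp[OF F.map_hom F.map_hom, OF fg]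
      by (simp add: comp_functor_simps homD)
  next
    fix f g assume fg: "f \<in> Arr M" "g \<in> Arr M"
    then have "TenA M f g \<in> Arr M"
      using F.M.ten_hom[OF F.M.arr_hom F.M.arr_hom] homD by metis
    then show "FM (comp_functor M F G) (TenA M f g)
        = TenA P (FM (comp_functor M F G) f) (FM (comp_functor M F G) g)"
      using fg by (simp add: comp_functor_simps F.map_ten G.map_ten F.map_arr)
  next
    fix a assume "a \<in> Obj M"
    then show "FM (comp_functor M F G) (Idn M a) = Idn P (FO (comp_functor M F G) a)"
      using homD(1)[OF F.M.id_hom]
      by (simp add: comp_functor_simps F.map_obj F.map_id G.map_id)
  qed (auto simp: comp_functor_simps F.map_obj G.map_obj F.map_unit G.map_unit F.M.unit_obj
      F.map_ten_obj G.map_ten_obj F.M.ten_obj)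
qed

locale lax_functor =
  fixes T :: "('xo, 'xm, 'ao, 'am) lax"
  assumes lax: "lax_monoidal T"
begin

sublocale X: monoidal_category "Source T"
  using lax by (simp add: lax_monoidal_def Let_def)

sublocale A: monoidal_category "Target T"
  using lax by (simp add: lax_monoidal_def Let_def)

sublocale F: is_functor "Source T" "Target T" "Fun T"
  using lax by (simp add: lax_monoidal_def Let_def)

lemma eps_hom: "eps T \<in> hom (Target T) (Unit (Target T)) (FO (Fun T) (Unit (Source T)))"
  using lax by (simp add: lax_monoidal_def Let_def)

lemma mu_hom:
  "x \<in> Obj (Source T) \<Longrightarrow> y \<in> Obj (Source T) \<Longrightarrow> mu T x y \<in>
    hom (Target T) (TenO (Target T) (FO (Fun T) x) (FO (Fun T) y))
      (FO (Fun T) (TenO (Source T) x y))"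
  using lax by (simp add: lax_monoidal_def Let_def)

lemma mu_natural:
  "f \<in> hom (Source T) a b \<Longrightarrow> g \<in> hom (Source T) c d \<Longrightarrow>
    TenA (Target T) (FM (Fun T) f) (FM (Fun T) g) ;;\<^bsub>Target T\<^esub> mu T b d =
    mu T a c ;;\<^bsub>Target T\<^esub> FM (Fun T) (TenA (Source T) f g)"
  using lax by (auto simp: lax_monoidal_def Let_def hom_def)

lemma mu_assoc:
  "x \<in> Obj (Source T) \<Longrightarrow> y \<in> Obj (Source T) \<Longrightarrow> z \<in> Obj (Source T) \<Longrightarrow>
    TenA (Target T) (mu T x y) (Idn (Target T) (FO (Fun T) z)) ;;\<^bsub>Target T\<^esub>
      mu T (TenO (Source T) x y) z =
    TenA (Target T) (Idn (Target T) (FO (Fun T) x)) (mu T y z) ;;\<^bsub>Target T\<^esub>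
      mu T x (TenO (Source T) y z)"
  using lax by (simp add: lax_monoidal_def Let_def)

lemma mu_unit:
  assumes "x \<in> Obj (Source T)"
  shows "TenA (Target T) (eps T) (Idn (Target T) (FO (Fun T) x)) ;;\<^bsub>Target T\<^esub>
      mu T (Unit (Source T)) x = Idn (Target T) (FO (Fun T) x)"
    and "TenA (Target T) (Idn (Target T) (FO (Fun T) x)) (eps T) ;;\<^bsub>Target T\<^esub>
      mu T x (Unit (Source T)) = Idn (Target T) (FO (Fun T) x)"
  using lax assms by (simp_all add: lax_monoidal_def Let_def)

end

text \<open>Extensionality of the component functors turns agreement on the carriers into equality
  of records; the equations between composite morphisms rest on this.\<close>

lemma lax_mor_eqI:
  fixes m m' :: "('xo, 'xm, 'ao, 'am, 'yo, 'ym, 'bo, 'bm) lax_mor"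
  assumes "is_lax_mor m" "is_lax_mor m'" "LDom m = LDom m'" "LCod m = LCod m'"
    and "\<And>a. a \<in> Obj (Source (LDom m)) \<Longrightarrow> FO (LH m) a = FO (LH m') a"
    and "\<And>f. f \<in> Arr (Source (LDom m)) \<Longrightarrow> FM (LH m) f = FM (LH m') f"
    and "\<And>a. a \<in> Obj (Target (LDom m)) \<Longrightarrow> FO (LK m) a = FO (LK m') a"
    and "\<And>f. f \<in> Arr (Target (LDom m)) \<Longrightarrow> FM (LK m) f = FM (LK m') f"
  shows "m = m'"
proof -
  have "LH m = LH m'"
    using assms by (intro fct_eqI[of "Source (LDom m)"]) (auto simp: is_lax_mor_def Let_def)
  moreover have "LK m = LK m'"
    using assms by (intro fct_eqI[of "Target (LDom m)"]) (auto simp: is_lax_mor_def Let_def)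
  ultimately show ?thesis using assms by simp
qed

locale lax_morphism =
  fixes m :: "('xo, 'xm, 'ao, 'am, 'yo, 'ym, 'bo, 'bm) lax_mor"
  assumes mor: "is_lax_mor m"
begin

sublocale D: lax_functor "LDom m"
  using mor by unfold_locales (simp add: is_lax_mor_def Let_def)

sublocale C: lax_functor "LCod m"
  using mor by unfold_locales (simp add: is_lax_mor_def Let_def)

sublocale H: monoidal_functor "Source (LDom m)" "Source (LCod m)" "LH m"
  using mor by (simp add: is_lax_mor_def Let_def)

sublocale K: monoidal_functor "Target (LDom m)" "Target (LCod m)" "LK m"
  using mor by (simp add: is_lax_mor_def Let_def)

lemma fun_obj: "x \<in> Obj (Source (LDom m)) \<Longrightarrow>
    FO (LK m) (FO (Fun (LDom m)) x) = FO (Fun (LCod m)) (FO (LH m) x)"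
  using mor by (simp add: is_lax_mor_def Let_def)

lemma fun_arr: "f \<in> Arr (Source (LDom m)) \<Longrightarrow>
    FM (LK m) (FM (Fun (LDom m)) f) = FM (Fun (LCod m)) (FM (LH m) f)"
  using mor by (simp add: is_lax_mor_def Let_def)

lemma map_eps: "FM (LK m) (eps (LDom m)) = eps (LCod m)"
  using mor by (simp add: is_lax_mor_def Let_def)

lemma map_mu: "x \<in> Obj (Source (LDom m)) \<Longrightarrow> y \<in> Obj (Source (LDom m)) \<Longrightarrow>
    FM (LK m) (mu (LDom m) x y) = mu (LCod m) (FO (LH m) x) (FO (LH m) y)"
  using mor by (simp add: is_lax_mor_def Let_def)

end

lemma lax_id_mor:
  assumes "lax_monoidal T"
  shows "is_lax_mor (lax_id T)"
proof -
  interpret lax_functor T by unfold_locales fact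
  show ?thesis
    using assms
    by (auto simp: is_lax_mor_def Let_def lax_id_def id_monoidal_functor X.monoidal_category_axioms
        A.monoidal_category_axioms id_functor_extensional id_functor_simps F.map_obj F.map_arr
        homD(1)[OF eps_hom] homD(1)[OF mu_hom])
qed

lemma lax_comp_simps:
  "LDom (lax_comp m m') = LDom m" "LCod (lax_comp m m') = LCod m'"
  "LH (lax_comp m m') = comp_functor (Source (LDom m)) (LH m) (LH m')"
  "LK (lax_comp m m') = comp_functor (Target (LDom m)) (LK m) (LK m')"
  by (simp_all add: lax_comp_def)

lemma lax_comp_mor:
  assumes "is_lax_mor m" "is_lax_mor m'" "LCod m = LDom m'"
  shows "is_lax_mor (lax_comp m m')"
proof -
  interpret m: lax_morphism m by unfold_locales fact
  interpret m': lax_morphism m' by unfold_locales fact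
  show ?thesis
    unfolding is_lax_mor_def Let_def lax_comp_simps
    using m.D.lax m'.C.lax m.H.monoidal_functor_axioms m'.H.monoidal_functor_axioms
      m.K.monoidal_functor_axioms m'.K.monoidal_functor_axioms
    by (auto simp: assms(3) comp_monoidal_functor comp_functor_extensional comp_functor_simps
        m.D.F.map_obj m.D.F.map_arr m.fun_obj m.fun_arr m'.fun_obj m'.fun_arr
        m.map_eps m'.map_eps m.map_mu m'.map_mu homD(1)[OF m.D.eps_hom] homD(1)[OF m.D.mu_hom]
        m.H.map_obj[unfolded assms(3)] m.H.map_arr[unfolded assms(3)]
        m.map_eps[unfolded assms(3)] m.map_mu[unfolded assms(3)]
        m.fun_obj[unfolded assms(3)] m.fun_arr[unfolded assms(3)])
qed

text \<open>The two bracketings differ only in where functions are restricted, and it is enough that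
  the functors of \<open>m\<close> map carriers into carriers.\<close>

lemma lax_comp_assoc:
  assumes "is_lax_mor m" "LCod m = LDom m'"
  shows "lax_comp (lax_comp m m') m'' = lax_comp m (lax_comp m' m'')"
proof -
  interpret m: lax_morphism m by unfold_locales fact
  show ?thesis
    using m.H.map_obj m.H.map_arr m.K.map_obj m.K.map_arr
    by (auto simp: lax_comp_def comp_functor_def assms(2) restrict_def fun_eq_iff)
qed

lemma lax_id_comp:
  assumes "is_lax_mor m" "LDom m = T"
  shows "lax_comp (lax_id T) m = m"
proof -
  interpret m: lax_morphism m by unfold_locales fact
  have 1: "is_lax_mor (lax_id T)" "LCod (lax_id T) = LDom m"
    using m.D.lax assms(2) by (auto simp: lax_id_mor) (simp add: lax_id_def)
  show ?thesis
    by (rule lax_mor_eqI[OF lax_comp_mor[OF 1(1) assms(1) 1(2)] assms(1)])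
      (auto simp: lax_comp_def comp_functor_simps id_functor_simps assms(2)[symmetric] lax_id_def)
qed

lemma lax_comp_id:
  assumes "is_lax_mor m" "LCod m = T"
  shows "lax_comp m (lax_id T) = m"
proof -
  interpret m: lax_morphism m by unfold_locales fact
  have 1: "is_lax_mor (lax_id T)" "LCod m = LDom (lax_id T)"
    using m.C.lax assms(2) by (auto simp: lax_id_mor) (simp add: lax_id_def)
  show ?thesis
    by (rule lax_mor_eqI[OF lax_comp_mor[OF assms(1) 1] assms(1)])
      (auto simp: lax_comp_def comp_functor_simps id_functor_simps assms(2)[symmetric] lax_id_def
        m.H.map_obj m.H.map_arr m.K.map_obj m.K.map_arr)
qed

lemma Lax_simps:
  "Obj Lax = {T. lax_monoidal T}" "Arr Lax = {m. is_lax_mor m}" "Dom Lax = LDom"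
  "Cod Lax = LCod" "Idn Lax = lax_id" "Cmp Lax = lax_comp"
  by (simp_all add: Lax_def)

lemma Lax_category: "category (Lax :: ('u ulax, 'u ulax_mor) cat)"
proof unfold_locales
  fix f :: "'u ulax_mor" assume "f \<in> Arr Lax"
  then interpret lax_morphism f by unfold_locales (simp add: Lax_simps)
  show "Dom Lax f \<in> Obj Lax" "Cod Lax f \<in> Obj Lax"
    using D.lax C.lax by (simp_all add: Lax_simps)
qed (auto simp: Lax_simps hom_def lax_id_mor lax_comp_mor lax_comp_simps lax_comp_assoc
    lax_id_comp lax_comp_id, (simp_all add: lax_id_def))

section \<open>The category of functor box signatures\<close>

lemma Fbox_simps:
  "Obj Fbox = {S. is_fsig S}" "Arr Fbox = {m. is_fsig_mor m}" "Dom Fbox = SDom"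
  "Cod Fbox = SCod" "Idn Fbox = fsig_id" "Cmp Fbox = fsig_comp"
  by (simp_all add: Fbox_def)

lemma fsig_listsD:
  assumes "is_fsig S"
  shows "e \<in> Plain S us vs \<Longrightarrow> us \<in> lists (AObj S) \<and> vs \<in> lists (AObj S)"
    and "e \<in> FBox S us vs \<Longrightarrow> us \<in> lists (XObj S) \<and> vs \<in> lists (XObj S)"
    and "e \<in> InBox S us vs \<Longrightarrow> us \<in> lists (AObj S) \<and> vs \<in> lists (XObj S)"
    and "e \<in> OutBox S us vs \<Longrightarrow> us \<in> lists (XObj S) \<and> vs \<in> lists (AObj S)"
  using assms unfolding is_fsig_def by blast+

locale fsig_morphism =
  fixes m :: "'u fsig_mor"
  assumes mor: "is_fsig_mor m"
begin

lemma dom_cod: "is_fsig (SDom m)" "is_fsig (SCod m)"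
  using mor by (auto simp: is_fsig_mor_def Let_def)

lemma hobj: "a \<in> AObj (SDom m) \<Longrightarrow> hobj m a \<in> AObj (SCod m)"
  and kobj: "x \<in> XObj (SDom m) \<Longrightarrow> kobj m x \<in> XObj (SCod m)"
  using mor by (auto simp: is_fsig_mor_def Let_def PiE_def)

lemma hPlain: "e \<in> Plain (SDom m) us vs \<Longrightarrow>
    hPlain m us vs e \<in> Plain (SCod m) (map (hobj m) us) (map (hobj m) vs)"
  and hFBox: "e \<in> FBox (SDom m) us vs \<Longrightarrow>
    hFBox m us vs e \<in> FBox (SCod m) (map (kobj m) us) (map (kobj m) vs)"
  and hInBox: "e \<in> InBox (SDom m) us vs \<Longrightarrow>
    hInBox m us vs e \<in> InBox (SCod m) (map (hobj m) us) (map (kobj m) vs)"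
  and hOutBox: "e \<in> OutBox (SDom m) us vs \<Longrightarrow>
    hOutBox m us vs e \<in> OutBox (SCod m) (map (kobj m) us) (map (hobj m) vs)"
  using mor unfolding is_fsig_mor_def Let_def by blast+

lemma extensional:
  "hobj m \<in> extensional (AObj (SDom m))" "kobj m \<in> extensional (XObj (SDom m))"
  "hPlain m us vs \<in> extensional (Plain (SDom m) us vs)"
  "hFBox m us vs \<in> extensional (FBox (SDom m) us vs)"
  "hInBox m us vs \<in> extensional (InBox (SDom m) us vs)"
  "hOutBox m us vs \<in> extensional (OutBox (SDom m) us vs)"
  using mor unfolding is_fsig_mor_def Let_def PiE_def by blast+

end

lemma fsig_mor_eqI:
  fixes m m' :: "'u fsig_mor"
  assumes "is_fsig_mor m" "is_fsig_mor m'" "SDom m = SDom m'" "SCod m = SCod m'"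
    and "\<And>a. a \<in> AObj (SDom m) \<Longrightarrow> hobj m a = hobj m' a"
    and "\<And>x. x \<in> XObj (SDom m) \<Longrightarrow> kobj m x = kobj m' x"
    and "\<And>us vs e. e \<in> Plain (SDom m) us vs \<Longrightarrow> hPlain m us vs e = hPlain m' us vs e"
    and "\<And>us vs e. e \<in> FBox (SDom m) us vs \<Longrightarrow> hFBox m us vs e = hFBox m' us vs e"
    and "\<And>us vs e. e \<in> InBox (SDom m) us vs \<Longrightarrow> hInBox m us vs e = hInBox m' us vs e"
    and "\<And>us vs e. e \<in> OutBox (SDom m) us vs \<Longrightarrow> hOutBox m us vs e = hOutBox m' us vs e"
  shows "m = m'"
proof -
  interpret m: fsig_morphism m by unfold_locales fact
  interpret m': fsig_morphism m' by unfold_locales fact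
  note e = m.extensional m'.extensional[folded assms(3)]
  have "hobj m = hobj m'" "kobj m = kobj m'"
    using assms(5,6) by (blast intro: extensionalityI e)+
  moreover have "hPlain m = hPlain m'" "hFBox m = hFBox m'" "hInBox m = hInBox m'"
    "hOutBox m = hOutBox m'"
    using assms(7-10) by (blast intro: extensionalityI e ext)+
  ultimately show ?thesis using assms(3,4) by simp
qed

text \<open>Edge sets are empty except at lists of objects, so the edge clauses may assume that the
  index lists consist of objects. This matters because the object maps are restricted functions,
  meaningful on such lists only.\<close>

lemma fsig_morI:
  fixes m :: "'u fsig_mor"
  assumes "is_fsig (SDom m)" "is_fsig (SCod m)"
    and "hobj m \<in> extensional (AObj (SDom m))" "kobj m \<in> extensional (XObj (SDom m))"
    and "\<And>us vs. hPlain m us vs \<in> extensional (Plain (SDom m) us vs)"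
    and "\<And>us vs. hFBox m us vs \<in> extensional (FBox (SDom m) us vs)"
    and "\<And>us vs. hInBox m us vs \<in> extensional (InBox (SDom m) us vs)"
    and "\<And>us vs. hOutBox m us vs \<in> extensional (OutBox (SDom m) us vs)"
    and "\<And>a. a \<in> AObj (SDom m) \<Longrightarrow> hobj m a \<in> AObj (SCod m)"
    and "\<And>x. x \<in> XObj (SDom m) \<Longrightarrow> kobj m x \<in> XObj (SCod m)"
    and "\<And>us vs e. e \<in> Plain (SDom m) us vs \<Longrightarrow>
      us \<in> lists (AObj (SDom m)) \<Longrightarrow> vs \<in> lists (AObj (SDom m)) \<Longrightarrow>
      hPlain m us vs e \<in> Plain (SCod m) (map (hobj m) us) (map (hobj m) vs)"
    and "\<And>us vs e. e \<in> FBox (SDom m) us vs \<Longrightarrow>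
      us \<in> lists (XObj (SDom m)) \<Longrightarrow> vs \<in> lists (XObj (SDom m)) \<Longrightarrow>
      hFBox m us vs e \<in> FBox (SCod m) (map (kobj m) us) (map (kobj m) vs)"
    and "\<And>us vs e. e \<in> InBox (SDom m) us vs \<Longrightarrow>
      us \<in> lists (AObj (SDom m)) \<Longrightarrow> vs \<in> lists (XObj (SDom m)) \<Longrightarrow>
      hInBox m us vs e \<in> InBox (SCod m) (map (hobj m) us) (map (kobj m) vs)"
    and "\<And>us vs e. e \<in> OutBox (SDom m) us vs \<Longrightarrow>
      us \<in> lists (XObj (SDom m)) \<Longrightarrow> vs \<in> lists (AObj (SDom m)) \<Longrightarrow>
      hOutBox m us vs e \<in> OutBox (SCod m) (map (kobj m) us) (map (hobj m) vs)"
  shows "is_fsig_mor m"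
  unfolding is_fsig_mor_def Let_def PiE_def
  using assms fsig_listsD[OF assms(1)] by (intro conjI allI IntI Pi_I) simp_all

text \<open>The object maps of an identity are restricted, so an index list is returned unchanged
  only if its entries are objects.\<close>

lemma map_restrict_id: "us \<in> lists A \<Longrightarrow> map (restrict (\<lambda>a. a) A) us = us"
  by (induction us) auto

lemma fsig_id_mor: "is_fsig S \<Longrightarrow> is_fsig_mor (fsig_id S)"
  by (rule fsig_morI) (simp_all add: fsig_id_def map_restrict_id del: in_lists_conv_set)

lemma fsig_comp_simps:
  "SDom (fsig_comp m m') = SDom m" "SCod (fsig_comp m m') = SCod m'"
  "a \<in> AObj (SDom m) \<Longrightarrow> hobj (fsig_comp m m') a = hobj m' (hobj m a)"
  "x \<in> XObj (SDom m) \<Longrightarrow> kobj (fsig_comp m m') x = kobj m' (kobj m x)"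
  "e \<in> Plain (SDom m) us vs \<Longrightarrow> hPlain (fsig_comp m m') us vs e =
    hPlain m' (map (hobj m) us) (map (hobj m) vs) (hPlain m us vs e)"
  "e \<in> FBox (SDom m) us vs \<Longrightarrow> hFBox (fsig_comp m m') us vs e =
    hFBox m' (map (kobj m) us) (map (kobj m) vs) (hFBox m us vs e)"
  "e \<in> InBox (SDom m) us vs \<Longrightarrow> hInBox (fsig_comp m m') us vs e =
    hInBox m' (map (hobj m) us) (map (kobj m) vs) (hInBox m us vs e)"
  "e \<in> OutBox (SDom m) us vs \<Longrightarrow> hOutBox (fsig_comp m m') us vs e =
    hOutBox m' (map (kobj m) us) (map (hobj m) vs) (hOutBox m us vs e)"
  by (simp_all add: fsig_comp_def Let_def compose_eq)

lemma map_obj_comp: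
  "us \<in> lists (AObj (SDom m)) \<Longrightarrow>
    map (hobj (fsig_comp m m')) us = map (hobj m') (map (hobj m) us)"
  "us \<in> lists (XObj (SDom m)) \<Longrightarrow>
    map (kobj (fsig_comp m m')) us = map (kobj m') (map (kobj m) us)"
  by (induction us) (auto simp: fsig_comp_simps)

lemma fsig_comp_mor:
  assumes "is_fsig_mor m" "is_fsig_mor m'" "SCod m = SDom m'"
  shows "is_fsig_mor (fsig_comp m m')"
proof -
  interpret m: fsig_morphism m by unfold_locales fact
  interpret m': fsig_morphism m' by unfold_locales fact
  show ?thesis
    apply (rule fsig_morI)
    subgoal using m.dom_cod by (simp add: fsig_comp_simps)
    subgoal using m'.dom_cod by (simp add: fsig_comp_simps)
    subgoal by (simp add: fsig_comp_def Let_def)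
    subgoal by (simp add: fsig_comp_def Let_def)
    subgoal by (simp add: fsig_comp_def Let_def)
    subgoal by (simp add: fsig_comp_def Let_def)
    subgoal by (simp add: fsig_comp_def Let_def)
    subgoal by (simp add: fsig_comp_def Let_def)
    by (simp_all add: fsig_comp_simps map_obj_comp assms(3) m.hobj[unfolded assms(3)]
        m.kobj[unfolded assms(3)] m'.hobj m'.kobj
        m'.hPlain m.hPlain[unfolded assms(3)] m'.hFBox m.hFBox[unfolded assms(3)]
        m'.hInBox m.hInBox[unfolded assms(3)] m'.hOutBox m.hOutBox[unfolded assms(3)]
        del: map_map in_lists_conv_set)
qed

lemma Fbox_category: "category (Fbox :: ('u fsig, 'u fsig_mor) cat)"
proof unfold_locales
  fix f :: "'u fsig_mor" assume "f \<in> Arr Fbox"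
  then interpret fsig_morphism f by unfold_locales (simp add: Fbox_simps)
  show "Dom Fbox f \<in> Obj Fbox" "Cod Fbox f \<in> Obj Fbox"
    using dom_cod by (simp_all add: Fbox_simps)
next
  fix a :: "'u fsig" assume "a \<in> Obj Fbox"
  then show "Idn Fbox a \<in> hom Fbox a a"
    by (auto simp: Fbox_simps hom_def fsig_id_mor) (simp_all add: fsig_id_def)
next
  fix f g :: "'u fsig_mor" and a b c
  assume "f \<in> hom Fbox a b" "g \<in> hom Fbox b c"
  then show "f ;;\<^bsub>Fbox\<^esub> g \<in> hom Fbox a c"
    by (auto simp: Fbox_simps hom_def fsig_comp_mor fsig_comp_simps)
next
  fix f :: "'u fsig_mor" and a b
  assume "f \<in> hom Fbox a b"
  then have f: "is_fsig_mor f" "SDom f = a" "SCod f = b" by (auto simp: Fbox_simps hom_def)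
  interpret fsig_morphism f by unfold_locales fact
  have i: "is_fsig_mor (fsig_id a)" "is_fsig_mor (fsig_id b)"
    using dom_cod f by (auto intro: fsig_id_mor)
  have s: "SDom (fsig_id c) = c" "SCod (fsig_id c) = c"
    "hobj (fsig_id c) = restrict (\<lambda>a. a) (AObj c)"
    "kobj (fsig_id c) = restrict (\<lambda>a. a) (XObj c)"
    "e \<in> Plain c us vs \<Longrightarrow> hPlain (fsig_id c) us vs e = e"
    "e \<in> FBox c us vs \<Longrightarrow> hFBox (fsig_id c) us vs e = e"
    "e \<in> InBox c us vs \<Longrightarrow> hInBox (fsig_id c) us vs e = e"
    "e \<in> OutBox c us vs \<Longrightarrow> hOutBox (fsig_id c) us vs e = e"
    for c :: "'u fsig" and us vs e
    by (simp_all add: fsig_id_def)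
  note l = fsig_listsD[OF dom_cod(1)]
  \<comment> \<open>After composition with an identity, the edge maps of \<open>f\<close> are
    indexed by lists that went through a restricted identity; the presence of an edge guarantees
    that these are the original lists.\<close>
  have r: "e \<in> Plain (SDom f) us vs \<Longrightarrow>
      hPlain f (map (\<lambda>a\<in>AObj (SDom f). a) us) (map (\<lambda>a\<in>AObj (SDom f). a) vs) e = hPlain f us vs e"
    "e \<in> FBox (SDom f) us vs \<Longrightarrow>
      hFBox f (map (\<lambda>a\<in>XObj (SDom f). a) us) (map (\<lambda>a\<in>XObj (SDom f). a) vs) e = hFBox f us vs e"
    "e \<in> InBox (SDom f) us vs \<Longrightarrow>
      hInBox f (map (\<lambda>a\<in>AObj (SDom f). a) us) (map (\<lambda>a\<in>XObj (SDom f). a) vs) e = hInBox f us vs e"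
    "e \<in> OutBox (SDom f) us vs \<Longrightarrow>
      hOutBox f (map (\<lambda>a\<in>XObj (SDom f). a) us) (map (\<lambda>a\<in>AObj (SDom f). a) vs) e = hOutBox f us vs e"
    for us vs e
    using l by (simp_all add: map_restrict_id del: in_lists_conv_set)
  show "Idn Fbox a ;;\<^bsub>Fbox\<^esub> f = f"
    unfolding Fbox_simps f(2)[symmetric]
    by (rule fsig_mor_eqI)
      (use f(1) i in \<open>simp_all add: fsig_comp_simps s fsig_comp_mor r f(2)[symmetric]\<close>)
  show "f ;;\<^bsub>Fbox\<^esub> Idn Fbox b = f"
    unfolding Fbox_simps
    by (rule fsig_mor_eqI)
      (use f(1,3) i hobj kobj hPlain hFBox hInBox hOutBox in
        \<open>auto simp: fsig_comp_simps s fsig_comp_mor\<close>)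
next
  fix f g h :: "'u fsig_mor" and a b c d
  assume "f \<in> hom Fbox a b" "g \<in> hom Fbox b c" "h \<in> hom Fbox c d"
  then have f: "is_fsig_mor f" "SCod f = SDom g"
    and g: "is_fsig_mor g" "SCod g = SDom h" and h: "is_fsig_mor h"
    by (auto simp: Fbox_simps hom_def)
  interpret fsig_morphism f by unfold_locales fact
  note l = fsig_listsD[OF dom_cod(1)]
  show "(f ;;\<^bsub>Fbox\<^esub> g) ;;\<^bsub>Fbox\<^esub> h = f ;;\<^bsub>Fbox\<^esub> (g ;;\<^bsub>Fbox\<^esub> h)"
    unfolding Fbox_simps
    by (rule fsig_mor_eqI)
      (use f g h l in \<open>simp_all add: fsig_comp_simps fsig_comp_mor map_obj_comp
        hobj[unfolded f] kobj[unfolded f] hPlain[unfolded f] hFBox[unfolded f]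
        hInBox[unfolded f] hOutBox[unfolded f] del: map_map in_lists_conv_set\<close>)
qed

section \<open>The right adjoint: the underlying signature of a lax monoidal functor\<close>

definition tens :: "('o, 'm) moncat \<Rightarrow> 'o list \<Rightarrow> 'o" where
  "tens M us = foldr (TenO M) us (Unit M)"

lemma tens_simps [simp]:
  "tens M [] = Unit M"
  "tens M (u # us) = TenO M u (tens M us)"
  by (simp_all add: tens_def)

lemma (in monoidal_category) tens_obj: "us \<in> lists (Obj M) \<Longrightarrow> tens M us \<in> Obj M"
  by (induction us) (auto simp: unit_obj ten_obj)

lemma (in monoidal_category) tens_append:
  "us \<in> lists (Obj M) \<Longrightarrow> vs \<in> lists (Obj M) \<Longrightarrow>
    tens M (us @ vs) = TenO M (tens M us) (tens M vs)"
  by (induction us) (auto simp: ten_obj_unit_left ten_obj_assoc tens_obj simp flip: in_lists_conv_set)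

lemma (in monoidal_functor) map_tens:
  "us \<in> lists (Obj M) \<Longrightarrow> FO F (tens M us) = tens N (map (FO F) us)"
  by (induction us) (auto simp: map_unit map_ten_obj M.tens_obj simp flip: in_lists_conv_set)

text \<open>An arrow is an edge once for each way of writing its ends as tensor products of lists.
  The list conditions make the edge sets empty at all other indices, as \<open>is_fsig\<close>
  demands.\<close>

definition underlying_sig :: "'u ulax \<Rightarrow> 'u fsig" where
  "underlying_sig T = (let A = Target T; X = Source T; F = FO (Fun T) in
    \<lparr>AObj = Obj A, XObj = Obj X,
     Plain = (\<lambda>us vs. {e. us \<in> lists (Obj A) \<and> vs \<in> lists (Obj A) \<and>
       e \<in> hom A (tens A us) (tens A vs)}),
     FBox = (\<lambda>us vs. {e. us \<in> lists (Obj X) \<and> vs \<in> lists (Obj X) \<and>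
       e \<in> hom X (tens X us) (tens X vs)}),
     InBox = (\<lambda>us vs. {e. us \<in> lists (Obj A) \<and> vs \<in> lists (Obj X) \<and>
       e \<in> hom A (tens A us) (F (tens X vs))}),
     OutBox = (\<lambda>us vs. {e. us \<in> lists (Obj X) \<and> vs \<in> lists (Obj A) \<and>
       e \<in> hom A (F (tens X us)) (tens A vs)})\<rparr>)"

definition underlying_mor :: "'u ulax_mor \<Rightarrow> 'u fsig_mor" where
  "underlying_mor m = (let S = underlying_sig (LDom m) in
    \<lparr>SDom = S, SCod = underlying_sig (LCod m),
     hobj = restrict (FO (LK m)) (AObj S), kobj = restrict (FO (LH m)) (XObj S),
     hPlain = (\<lambda>us vs. restrict (FM (LK m)) (Plain S us vs)),
     hFBox = (\<lambda>us vs. restrict (FM (LH m)) (FBox S us vs)),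
     hInBox = (\<lambda>us vs. restrict (FM (LK m)) (InBox S us vs)),
     hOutBox = (\<lambda>us vs. restrict (FM (LK m)) (OutBox S us vs))\<rparr>)"

definition underlying :: "('u ulax, 'u ulax_mor, 'u fsig, 'u fsig_mor) fct" where
  "underlying = \<lparr>FO = underlying_sig, FM = underlying_mor\<rparr>"

lemma underlying_sig_simps:
  "AObj (underlying_sig T) = Obj (Target T)" "XObj (underlying_sig T) = Obj (Source T)"
  "e \<in> Plain (underlying_sig T) us vs \<longleftrightarrow>
    us \<in> lists (Obj (Target T)) \<and> vs \<in> lists (Obj (Target T)) \<and>
    e \<in> hom (Target T) (tens (Target T) us) (tens (Target T) vs)"
  "e \<in> FBox (underlying_sig T) us vs \<longleftrightarrow>
    us \<in> lists (Obj (Source T)) \<and> vs \<in> lists (Obj (Source T)) \<and>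
    e \<in> hom (Source T) (tens (Source T) us) (tens (Source T) vs)"
  "e \<in> InBox (underlying_sig T) us vs \<longleftrightarrow>
    us \<in> lists (Obj (Target T)) \<and> vs \<in> lists (Obj (Source T)) \<and>
    e \<in> hom (Target T) (tens (Target T) us) (FO (Fun T) (tens (Source T) vs))"
  "e \<in> OutBox (underlying_sig T) us vs \<longleftrightarrow>
    us \<in> lists (Obj (Source T)) \<and> vs \<in> lists (Obj (Target T)) \<and>
    e \<in> hom (Target T) (FO (Fun T) (tens (Source T) us)) (tens (Target T) vs)"
  by (simp_all add: underlying_sig_def Let_def)

lemma underlying_sig: "is_fsig (underlying_sig T)"
  by (auto simp: is_fsig_def underlying_sig_def Let_def)

lemma underlying_mor_simps:
  "SDom (underlying_mor m) = underlying_sig (LDom m)"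
  "SCod (underlying_mor m) = underlying_sig (LCod m)"
  "a \<in> Obj (Target (LDom m)) \<Longrightarrow> hobj (underlying_mor m) a = FO (LK m) a"
  "x \<in> Obj (Source (LDom m)) \<Longrightarrow> kobj (underlying_mor m) x = FO (LH m) x"
  "e \<in> Plain (underlying_sig (LDom m)) us vs \<Longrightarrow> hPlain (underlying_mor m) us vs e = FM (LK m) e"
  "e \<in> FBox (underlying_sig (LDom m)) us vs \<Longrightarrow> hFBox (underlying_mor m) us vs e = FM (LH m) e"
  "e \<in> InBox (underlying_sig (LDom m)) us vs \<Longrightarrow> hInBox (underlying_mor m) us vs e = FM (LK m) e"
  "e \<in> OutBox (underlying_sig (LDom m)) us vs \<Longrightarrow>
    hOutBox (underlying_mor m) us vs e = FM (LK m) e"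
  by (simp_all add: underlying_mor_def Let_def underlying_sig_simps(1,2))

lemma map_underlying_mor:
  "us \<in> lists (Obj (Target (LDom m))) \<Longrightarrow> map (hobj (underlying_mor m)) us = map (FO (LK m)) us"
  "us \<in> lists (Obj (Source (LDom m))) \<Longrightarrow> map (kobj (underlying_mor m)) us = map (FO (LH m)) us"
  by (auto simp: underlying_mor_simps)

text \<open>Strict monoidal functors commute with tensor products of lists; the in-box and out-box
  cases also use that the square of functors commutes on objects.\<close>

lemma (in lax_morphism) map_edges:
  "us \<in> lists (Obj (Target (LDom m))) \<Longrightarrow> vs \<in> lists (Obj (Target (LDom m))) \<Longrightarrow>
    e \<in> hom (Target (LDom m)) (tens (Target (LDom m)) us) (tens (Target (LDom m)) vs) \<Longrightarrow>
    FM (LK m) e \<in> hom (Target (LCod m)) (tens (Target (LCod m)) (map (FO (LK m)) us))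
      (tens (Target (LCod m)) (map (FO (LK m)) vs))"
  "xs \<in> lists (Obj (Source (LDom m))) \<Longrightarrow> ys \<in> lists (Obj (Source (LDom m))) \<Longrightarrow>
    f \<in> hom (Source (LDom m)) (tens (Source (LDom m)) xs) (tens (Source (LDom m)) ys) \<Longrightarrow>
    FM (LH m) f \<in> hom (Source (LCod m)) (tens (Source (LCod m)) (map (FO (LH m)) xs))
      (tens (Source (LCod m)) (map (FO (LH m)) ys))"
  "us \<in> lists (Obj (Target (LDom m))) \<Longrightarrow> ys \<in> lists (Obj (Source (LDom m))) \<Longrightarrow>
    e \<in> hom (Target (LDom m)) (tens (Target (LDom m)) us)
      (FO (Fun (LDom m)) (tens (Source (LDom m)) ys)) \<Longrightarrow>
    FM (LK m) e \<in> hom (Target (LCod m)) (tens (Target (LCod m)) (map (FO (LK m)) us))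
      (FO (Fun (LCod m)) (tens (Source (LCod m)) (map (FO (LH m)) ys)))"
  "xs \<in> lists (Obj (Source (LDom m))) \<Longrightarrow> vs \<in> lists (Obj (Target (LDom m))) \<Longrightarrow>
    e \<in> hom (Target (LDom m)) (FO (Fun (LDom m)) (tens (Source (LDom m)) xs))
      (tens (Target (LDom m)) vs) \<Longrightarrow>
    FM (LK m) e \<in> hom (Target (LCod m))
      (FO (Fun (LCod m)) (tens (Source (LCod m)) (map (FO (LH m)) xs)))
      (tens (Target (LCod m)) (map (FO (LK m)) vs))"
  using K.map_hom H.map_hom
  by (simp_all add: K.map_tens[symmetric] H.map_tens[symmetric] D.X.tens_obj fun_obj[symmetric]
      del: in_lists_conv_set)

lemma underlying_mor:
  assumes "is_lax_mor m"
  shows "is_fsig_mor (underlying_mor m)"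
proof -
  interpret lax_morphism m by unfold_locales fact
  have l: "map (FO (LK m)) us \<in> lists (Obj (Target (LCod m)))"
    if "us \<in> lists (Obj (Target (LDom m)))" for us
    using that K.map_obj by auto
  have l': "map (FO (LH m)) us \<in> lists (Obj (Source (LCod m)))"
    if "us \<in> lists (Obj (Source (LDom m)))" for us
    using that H.map_obj by auto
  show ?thesis
    apply (rule fsig_morI)
    subgoal by (simp add: underlying_mor_simps underlying_sig)
    subgoal by (simp add: underlying_mor_simps underlying_sig)
    subgoal by (simp add: underlying_mor_def Let_def)
    subgoal by (simp add: underlying_mor_def Let_def)
    subgoal by (simp add: underlying_mor_def Let_def)
    subgoal by (simp add: underlying_mor_def Let_def)
    subgoal by (simp add: underlying_mor_def Let_def)
    subgoal by (simp add: underlying_mor_def Let_def)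
    by (simp_all add: underlying_mor_simps underlying_sig_simps map_underlying_mor
        K.map_obj H.map_obj map_edges l l' del: in_lists_conv_set)
qed

lemma underlying_functor: "is_functor Lax Fbox (underlying :: ('u ulax, 'u ulax_mor, 'u fsig, 'u fsig_mor) fct)"
proof -
  interpret L: category "Lax :: ('u ulax, 'u ulax_mor) cat" by (rule Lax_category)
  interpret B: category "Fbox :: ('u fsig, 'u fsig_mor) cat" by (rule Fbox_category)
  show ?thesis
  proof unfold_locales
    fix T :: "'u ulax" assume T: "T \<in> Obj Lax"
    show "FO underlying T \<in> Obj Fbox"
      by (simp add: underlying_def Fbox_simps underlying_sig)
    have "is_lax_mor (lax_id T)" using T by (simp add: Lax_simps lax_id_mor)
    then have m: "is_fsig_mor (underlying_mor (lax_id T))"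
      by (rule underlying_mor)
    show "FM underlying (Idn Lax T) = Idn Fbox (FO underlying T)"
      unfolding underlying_def Lax_simps Fbox_simps fct.simps
      by (rule fsig_mor_eqI[OF m fsig_id_mor[OF underlying_sig]])
        (auto simp: underlying_mor_def Let_def lax_id_def fsig_id_def underlying_sig_simps
          id_functor_simps homD)
  next
    fix m :: "'u ulax_mor" and S T assume "m \<in> hom Lax S T"
    then show "FM underlying m \<in> hom Fbox (FO underlying S) (FO underlying T)"
      by (auto simp: underlying_def Lax_simps Fbox_simps hom_def underlying_mor
          underlying_mor_simps)
  next
    fix m m' :: "'u ulax_mor" and S T U assume "m \<in> hom Lax S T" "m' \<in> hom Lax T U"
    then have m: "is_lax_mor m" "LCod m = LDom m'" and m': "is_lax_mor m'"
      by (auto simp: Lax_simps hom_def)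
    interpret lax_morphism m by unfold_locales fact
    interpret u: fsig_morphism "underlying_mor m" by unfold_locales (rule underlying_mor[OF m(1)])
    note c = lax_comp_mor[OF m(1) m' m(2)]
    note e = u.hobj u.kobj u.hPlain u.hFBox u.hInBox u.hOutBox
    note e = e[unfolded underlying_mor_simps(1,2) m(2)]
    note s = underlying_mor_simps(3,4)[of _ m', folded underlying_sig_simps]
      underlying_mor_simps(3,4)[of _ m, folded underlying_sig_simps]
    have d: "AObj (underlying_sig T) = Obj (Target T)" "XObj (underlying_sig T) = Obj (Source T)"
      "e \<in> Plain (underlying_sig T) us vs \<Longrightarrow> e \<in> Arr (Target T)"
      "e \<in> FBox (underlying_sig T) us vs \<Longrightarrow> e \<in> Arr (Source T)"
      "e \<in> InBox (underlying_sig T) us vs \<Longrightarrow> e \<in> Arr (Target T)"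
      "e \<in> OutBox (underlying_sig T) us vs \<Longrightarrow> e \<in> Arr (Target T)" for T :: "'u ulax" and e us vs
      by (auto simp: underlying_sig_simps dest: homD)
    show "FM underlying (m ;;\<^bsub>Lax\<^esub> m') = FM underlying m ;;\<^bsub>Fbox\<^esub> FM underlying m'"
      unfolding underlying_def Lax_simps Fbox_simps fct.simps
      by (rule fsig_mor_eqI[OF underlying_mor[OF c] fsig_comp_mor[OF underlying_mor[OF m(1)]
              underlying_mor[OF m']]])
        (use e in \<open>auto simp: m(2) underlying_mor_simps fsig_comp_simps lax_comp_simps
          comp_functor_simps d K.map_obj[unfolded m(2)] H.map_obj[unfolded m(2)]\<close>)
  qed
qed

section \<open>Freely presented 2-categories\<close>

(* Keeps paths, which are triples, from being split in quantified statements. *)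
declare split_paired_Ex [simp del] split_paired_All [simp del]

lemma path_comp_simps [simp]:
  "path_comp (a, gs, b) (c, hs, d) = (a, gs @ hs, d)"
  "path_dom (a, gs, b) = a" "path_cod (a, gs, b) = b"
  "path_dom (path_comp p q) = path_dom p" "path_cod (path_comp p q) = path_cod q"
  by (simp_all add: path_comp_def path_dom_def path_cod_def)

lemma path_comp_assoc: "path_comp (path_comp p q) r = path_comp p (path_comp q r)"
  by (simp add: path_comp_def)

lemma path_comp_unit:
  "path_dom p = c \<Longrightarrow> path_comp (c, [], c) p = p"
  "path_cod p = c \<Longrightarrow> path_comp p (c, [], c) = p"
  by (auto simp: path_comp_def path_dom_def path_cod_def)

lemma path_from_ends: "path_from P c gs d \<Longrightarrow> c \<in> Gens0 P \<and> d \<in> Gens0 P"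
  by (induction gs arbitrary: c) auto

lemma path_from_append:
  "path_from P c gs d \<Longrightarrow> path_from P d hs e \<Longrightarrow> path_from P c (gs @ hs) e"
  by (induction gs arbitrary: c) auto

lemma path_from_appendD:
  "path_from P c (gs @ hs) e \<Longrightarrow> \<exists>d. path_from P c gs d \<and> path_from P d hs e"
  by (induction gs arbitrary: c) (auto dest: path_from_ends)

lemma is_path_comp:
  "is_path P p \<Longrightarrow> is_path P q \<Longrightarrow> path_cod p = path_dom q \<Longrightarrow> is_path P (path_comp p q)"
  by (cases p; cases q) (auto simp: is_path_def path_from_append)

lemma is_path_empty: "c \<in> Gens0 P \<Longrightarrow> is_path P (c, [], c)"
  by (simp add: is_path_def)

lemma is_path_ends: "is_path P p \<Longrightarrow> path_dom p \<in> Gens0 P" "is_path P p \<Longrightarrow> path_cod p \<in> Gens0 P"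
  by (cases p; auto simp: is_path_def dest: path_from_ends)+

text \<open>These conditions on the ends of generators and relations ensure that the congruence
  relates parallel well-formed terms only (\<open>tm_eq_wf\<close>), so that the ends of a class are
  well defined.\<close>

locale presented =
  fixes P :: "('z, 'g, 'c) presentation"
  assumes gen2_path: "c \<in> Gens2 P \<Longrightarrow> is_path P (gdom2 P c) \<and> is_path P (gcod2 P c) \<and>
      path_dom (gdom2 P c) = path_dom (gcod2 P c) \<and> path_cod (gdom2 P c) = path_cod (gcod2 P c)"
    and rels_wf: "(s, t) \<in> Rels P \<Longrightarrow>
      wf_tm P s \<and> wf_tm P t \<and> tdom P s = tdom P t \<and> tcod P s = tcod P t"
begin

lemma wf_path:
  "wf_tm P t \<Longrightarrow> is_path P (tdom P t) \<and> is_path P (tcod P t) \<and>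
    path_dom (tdom P t) = path_dom (tcod P t) \<and> path_cod (tdom P t) = path_cod (tcod P t)"
  by (induction t) (auto simp: gen2_path is_path_comp)

lemma tm_eq_wf: "tm_eq P s t \<Longrightarrow> wf_tm P s \<and> wf_tm P t \<and> tdom P s = tdom P t \<and> tcod P s = tcod P t"
proof (induction rule: tm_eq.induct)
  case (relation s t)
  then show ?case by (rule rels_wf)
qed (auto simp: wf_path path_comp_unit path_comp_assoc is_path_comp is_path_empty is_path_ends)

lemma tm_class_eq: "tm_eq P s t \<Longrightarrow> tm_class P s = tm_class P t"
  unfolding tm_class_def by (rule Collect_cong) (meson tm_eq.sym tm_eq.trans)

lemma rep_class: "wf_tm P t \<Longrightarrow> tm_eq P t (rep (tm_class P t))"
  unfolding rep_def tm_class_def by (rule someI2[of _ t]) (auto intro: tm_eq.refl)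

abbreviation C where "C \<equiv> free_two_cat P"

text \<open>\<open>Dom2\<close> and \<open>Cod2\<close> read the ends off a chosen representative.
  Quantifying over all representatives instead allows the laws of a 2-category to be proved on
  terms, without touching the choice.\<close>

definition cell :: "('z, 'g, 'c) tm set \<Rightarrow> ('z, 'g) path \<Rightarrow> ('z, 'g) path \<Rightarrow> bool" where
  "cell m p q \<longleftrightarrow> (\<exists>t. wf_tm P t \<and> tdom P t = p \<and> tcod P t = q \<and> m = tm_class P t)"

lemma cellI: "wf_tm P t \<Longrightarrow> cell (tm_class P t) (tdom P t) (tcod P t)"
  by (auto simp: cell_def)

lemma cellI': "wf_tm P t \<Longrightarrow> tdom P t = p \<Longrightarrow> tcod P t = q \<Longrightarrow> cell (tm_class P t) p q"
  by (auto simp: cell_def)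

lemma cell_path:
  assumes "cell m p q"
  shows "is_path P p" "is_path P q" "path_dom q = path_dom p" "path_cod q = path_cod p"
  using assms wf_path by (auto simp: cell_def)

lemma rep_cell:
  assumes "cell m p q"
  shows "wf_tm P (rep m)" "tdom P (rep m) = p" "tcod P (rep m) = q" "tm_class P (rep m) = m"
  using assms rep_class tm_eq_wf tm_class_eq by (auto simp: cell_def) metis+

lemma C_simps:
  "Cells0 C = Gens0 P" "Cells1 C = {p. is_path P p}" "Dom1 C = path_dom" "Cod1 C = path_cod"
  "Id1 C = (\<lambda>c. (c, [], c))" "Comp1 C = path_comp" "Id2 C p = tm_class P (IdT p)"
  by (simp_all add: free_two_cat_def)

lemma Cells2_iff: "m \<in> Cells2 C \<longleftrightarrow> (\<exists>p q. cell m p q)"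
  by (auto simp: free_two_cat_def cell_def)

lemma Dom2_cell: "cell m p q \<Longrightarrow> Dom2 C m = p"
  and Cod2_cell: "cell m p q \<Longrightarrow> Cod2 C m = q"
  using rep_cell by (auto simp: free_two_cat_def)

text \<open>Independence of the chosen representatives, by the congruence rule; likewise for
  \<open>HComp_class\<close>.\<close>

lemma VComp_class: "wf_tm P (VT s t) \<Longrightarrow> VComp C (tm_class P s) (tm_class P t) = tm_class P (VT s t)"
  using tm_class_eq[OF tm_eq.vcong[OF rep_class rep_class]]
  by (simp add: free_two_cat_def)

lemma HComp_class: "wf_tm P (HT s t) \<Longrightarrow> HComp C (tm_class P s) (tm_class P t) = tm_class P (HT s t)"
  using tm_class_eq[OF tm_eq.hcong[OF rep_class rep_class]]
  by (simp add: free_two_cat_def)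

lemma id_cell: "is_path P p \<Longrightarrow> cell (Id2 C p) p p"
  unfolding cell_def C_simps by (rule exI[of _ "IdT p"]) simp

lemma vcomp_cell:
  assumes "cell m p q" "cell n q r"
  shows "cell (VComp C m n) p r"
proof -
  obtain s t where "m = tm_class P s" "n = tm_class P t" "wf_tm P (VT s t)" "tdom P s = p" "tcod P t = r"
    using assms by (auto simp: cell_def)
  then show ?thesis by (metis VComp_class cellI tcod.simps(3) tdom.simps(3))
qed

lemma hcomp_cell:
  assumes "cell m p q" "cell n p' q'" "path_cod p = path_dom p'"
  shows "cell (HComp C m n) (path_comp p p') (path_comp q q')"
proof -
  obtain s t where "m = tm_class P s" "n = tm_class P t" "wf_tm P (HT s t)" "tdom P s = p" "tcod P s = q"
    "tdom P t = p'" "tcod P t = q'"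
    using assms by (auto simp: cell_def)
  then show ?thesis by (metis HComp_class cellI tcod.simps(4) tdom.simps(4))
qed

lemma vcomp_id_left: "cell m p q \<Longrightarrow> VComp C (Id2 C p) m = m"
  and vcomp_id_right: "cell m p q \<Longrightarrow> VComp C m (Id2 C q) = m"
  by (clarsimp simp: cell_def C_simps VComp_class wf_path;
      intro tm_class_eq tm_eq.vid_left tm_eq.vid_right; assumption)+

lemma vcomp_assoc:
  "cell m p q \<Longrightarrow> cell n q r \<Longrightarrow> cell k r s \<Longrightarrow> VComp C (VComp C m n) k = VComp C m (VComp C n k)"
  by (clarsimp simp: cell_def VComp_class) (intro tm_class_eq tm_eq.vassoc, simp)

lemma hcomp_id_left:
  assumes "cell m p q" "path_dom p = c"
  shows "HComp C (Id2 C (c, [], c)) m = m"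
proof -
  obtain t where t: "wf_tm P t" "m = tm_class P t" "c = path_dom (tdom P t)"
    using assms by (auto simp: cell_def)
  then have "wf_tm P (HT (IdT (c, [], c)) t)"
    using wf_path[OF t(1)] by (simp add: is_path_empty is_path_ends)
  with t show ?thesis
    by (simp only: C_simps HComp_class tm_class_eq[OF tm_eq.hid_left])
qed

lemma hcomp_id_right:
  assumes "cell m p q" "path_cod p = c"
  shows "HComp C m (Id2 C (c, [], c)) = m"
proof -
  obtain t where t: "wf_tm P t" "m = tm_class P t" "c = path_cod (tdom P t)"
    using assms by (auto simp: cell_def)
  then have "wf_tm P (HT t (IdT (c, [], c)))"
    using wf_path[OF t(1)] by (simp add: is_path_empty is_path_ends)
  with t show ?thesis
    by (simp only: C_simps HComp_class tm_class_eq[OF tm_eq.hid_right])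
qed

lemma hcomp_assoc:
  "cell m p q \<Longrightarrow> cell n p' q' \<Longrightarrow> cell k p'' q'' \<Longrightarrow> path_cod p = path_dom p' \<Longrightarrow>
    path_cod p' = path_dom p'' \<Longrightarrow> HComp C (HComp C m n) k = HComp C m (HComp C n k)"
  by (clarsimp simp: cell_def HComp_class) (intro tm_class_eq tm_eq.hassoc, simp)

lemma hcomp_id: "is_path P p \<Longrightarrow> is_path P q \<Longrightarrow> path_cod p = path_dom q \<Longrightarrow>
    HComp C (Id2 C p) (Id2 C q) = Id2 C (path_comp p q)"
  by (simp add: C_simps HComp_class) (intro tm_class_eq tm_eq.hid_comp, simp)

lemma interchange:
  assumes "cell m p q" "cell n q r" "cell m' p' q'" "cell n' q' r'" "path_cod p = path_dom p'"
  shows "HComp C (VComp C m n) (VComp C m' n') = VComp C (HComp C m m') (HComp C n n')"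
proof -
  obtain s t s' t' where *: "m = tm_class P s" "n = tm_class P t" "wf_tm P s" "wf_tm P t" "tcod P s = q" "tdom P t = q"
     "m' = tm_class P s'" "n' = tm_class P t'" "wf_tm P s'" "wf_tm P t'" "tcod P s' = q'" "tdom P t' = q'"
     "tdom P s = p" "tdom P s' = p'"
    using assms(1-4) by (auto simp: cell_def)
  then have "path_cod q = path_dom q'" using assms(5) wf_path by metis
  with * show ?thesis using assms(5)
    by (simp add: VComp_class HComp_class) (intro tm_class_eq tm_eq.interchange, simp)
qed

text \<open>Interchange with identities in two opposite corners. Together with
  \<open>slide_right\<close> it allows a horizontal composite to be read as a sequence in either
  order.\<close>

lemma slide_left:
  assumes "cell m p q" "cell n p' q'" "path_cod p = path_dom p'"
  shows "VComp C (HComp C m (Id2 C p')) (HComp C (Id2 C q) n) = HComp C m n"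
  using assms by (subst interchange[symmetric])
    (auto intro: id_cell cell_path simp: vcomp_id_left vcomp_id_right)

lemma slide_right:
  assumes "cell m p q" "cell n p' q'" "path_cod p = path_dom p'"
  shows "VComp C (HComp C (Id2 C p) n) (HComp C m (Id2 C q')) = HComp C m n"
  using assms by (subst interchange[symmetric])
    (auto intro: id_cell cell_path simp: vcomp_id_left vcomp_id_right)

definition endos :: "'z \<Rightarrow> ('z, 'g) path set" where
  "endos c = {p. is_path P p \<and> path_dom p = c \<and> path_cod p = c}"

lemma endo_simps:
  "Obj (endo_moncat C c) = endos c"
  "Dom (endo_moncat C c) = Dom2 C" "Cod (endo_moncat C c) = Cod2 C" "Idn (endo_moncat C c) = Id2 C"
  "Cmp (endo_moncat C c) = VComp C" "Unit (endo_moncat C c) = (c, [], c)"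
  "TenO (endo_moncat C c) = path_comp" "TenA (endo_moncat C c) = HComp C"
  by (simp_all add: endo_moncat_def Let_def endos_def C_simps)

lemma endo_Arr: "m \<in> Arr (endo_moncat C c) \<longleftrightarrow> (\<exists>p q. cell m p q \<and> p \<in> endos c \<and> q \<in> endos c)"
proof -
  have "m \<in> Arr (endo_moncat C c) \<longleftrightarrow> m \<in> Cells2 C \<and> Dom2 C m \<in> endos c \<and> Cod2 C m \<in> endos c"
    by (simp add: endo_moncat_def Let_def endos_def C_simps)
  then show ?thesis unfolding Cells2_iff using Dom2_cell Cod2_cell by blast
qed

lemma endo_hom: "m \<in> hom (endo_moncat C c) p q \<longleftrightarrow> cell m p q \<and> p \<in> endos c \<and> q \<in> endos c"
  by (auto simp: hom_def endo_Arr endo_simps Dom2_cell Cod2_cell)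

lemma endo_monoidal:
  assumes "c \<in> Gens0 P"
  shows "monoidal_category (endo_moncat C c)"
proof unfold_locales
  show "Unit (endo_moncat C c) \<in> Obj (endo_moncat C c)"
    using assms by (simp add: endo_simps endos_def is_path_empty)
qed (auto simp: endo_simps endo_hom endo_Arr Dom2_cell Cod2_cell vcomp_cell vcomp_id_left vcomp_id_right
    vcomp_assoc hcomp_assoc path_comp_assoc path_comp_unit is_path_comp endos_def
    hcomp_id_left hcomp_id_right hcomp_id interchange intro: id_cell hcomp_cell)

end

lemma full_monoidal_subcategory_simps:
  "Obj (full_monoidal_subcategory M S) = S"
  "Arr (full_monoidal_subcategory M S) = {f \<in> Arr M. Dom M f \<in> S \<and> Cod M f \<in> S}"
  "Dom (full_monoidal_subcategory M S) = Dom M" "Cod (full_monoidal_subcategory M S) = Cod M"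
  "Idn (full_monoidal_subcategory M S) = Idn M" "Cmp (full_monoidal_subcategory M S) = Cmp M"
  "Unit (full_monoidal_subcategory M S) = Unit M"
  "TenO (full_monoidal_subcategory M S) = TenO M" "TenA (full_monoidal_subcategory M S) = TenA M"
  by (simp_all add: full_monoidal_subcategory_def)

lemma full_monoidal_subcategory_hom:
  "f \<in> hom (full_monoidal_subcategory M S) a b \<longleftrightarrow> f \<in> hom M a b \<and> a \<in> S \<and> b \<in> S"
  by (auto simp: hom_def full_monoidal_subcategory_simps)

lemma full_monoidal_subcategory:
  assumes "monoidal_category M" "S \<subseteq> Obj M" "Unit M \<in> S" "\<And>a b. a \<in> S \<Longrightarrow> b \<in> S \<Longrightarrow> TenO M a b \<in> S"
  shows "monoidal_category (full_monoidal_subcategory M S)"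
proof -
  interpret M: monoidal_category M by fact
  show ?thesis
    using assms(2-4)
    by unfold_locales
      (auto simp: full_monoidal_subcategory_simps full_monoidal_subcategory_hom subset_iff
        M.id_left M.id_right M.comp_assoc M.ten_obj_assoc M.ten_obj_unit_left M.ten_obj_unit_right
        M.ten_id M.ten_comp M.ten_assoc M.ten_unit_left M.ten_unit_right
        intro: M.id_hom M.comp_hom M.ten_hom)
qed

section \<open>The lax monoidal functor of an adjunction\<close>

text \<open>The lax structure depends on an adjunction in a presented 2-category and on a set of
  endo 1-cells closed under composition, not on the particular generators; \<open>u\<close> is the
  left adjoint and \<open>d\<close> the right one.\<close>

locale presented_adjunction = presented P
  for P :: "('z, 'g, 'c) presentation" +
  fixes a x :: 'z and u d :: "('z, 'g) path" and n e :: "('z, 'g, 'c) tm set" and Ws :: "('z, 'g) path set"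
  assumes u: "is_path P u" "path_dom u = a" "path_cod u = x"
    and d: "is_path P d" "path_dom d = x" "path_cod d = a"
    and n: "cell n (a, [], a) (path_comp u d)"
    and e: "cell e (path_comp d u) (x, [], x)"
    and snake_u: "VComp C (HComp C n (Id2 C u)) (HComp C (Id2 C u) e) = Id2 C u"
    and snake_d: "VComp C (HComp C (Id2 C d) n) (HComp C e (Id2 C d)) = Id2 C d"
    and Ws: "Ws \<subseteq> endos x" "(x, [], x) \<in> Ws"
      "\<And>p q. p \<in> Ws \<Longrightarrow> q \<in> Ws \<Longrightarrow> path_comp p q \<in> Ws"
begin

abbreviation T where "T \<equiv> presented_lax C a x u d n e Ws"

lemma T_simps:
  "Source T = full_monoidal_subcategory (endo_moncat C x) Ws" "Target T = endo_moncat C a"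
  "FO (Fun T) W = path_comp u (path_comp W d)"
  "FM (Fun T) m = HComp C (HComp C (Id2 C u) m) (Id2 C d)"
  "eps T = n"
  "mu T W V = HComp C (HComp C (Id2 C (path_comp u W)) e) (Id2 C (path_comp V d))"
  by (simp_all add: presented_lax_def C_simps path_comp_assoc)

lemma WsD: "W \<in> Ws \<Longrightarrow> is_path P W" "W \<in> Ws \<Longrightarrow> path_dom W = x" "W \<in> Ws \<Longrightarrow> path_cod W = x"
  using Ws(1) by (auto simp: endos_def)

lemma ax: "a \<in> Gens0 P" "x \<in> Gens0 P"
  using is_path_ends[OF u(1)] u by auto

lemma source_monoidal: "monoidal_category (Source T)"
  unfolding T_simps
  by (rule full_monoidal_subcategory[OF endo_monoidal]) (use Ws ax in \<open>auto simp: endo_simps\<close>)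

lemma source_hom: "m \<in> hom (Source T) W V \<longleftrightarrow> cell m W V \<and> W \<in> Ws \<and> V \<in> Ws"
  using Ws(1) by (auto simp: T_simps full_monoidal_subcategory_hom endo_hom)

lemma source_Arr: "m \<in> Arr (Source T) \<longleftrightarrow> (\<exists>W V. cell m W V \<and> W \<in> Ws \<and> V \<in> Ws)"
proof -
  have "m \<in> Arr (Source T) \<longleftrightarrow> (\<exists>W V. m \<in> hom (Source T) W V)"
    by (auto simp: hom_def)
  then show ?thesis by (simp add: source_hom)
qed

lemma box_cell:
  "cell m W V \<Longrightarrow> path_dom W = x \<Longrightarrow> path_cod W = x \<Longrightarrow>
    cell (FM (Fun T) m) (FO (Fun T) W) (FO (Fun T) V)"
  unfolding T_simps path_comp_assoc[symmetric]
  by (intro hcomp_cell id_cell) (auto simp: u d)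

lemmas path_simps = u d WsD is_path_comp path_comp_assoc is_path_empty ax path_comp_unit

lemma box_functor: "is_functor (Source T) (Target T) (Fun T)"
proof -
  interpret X: monoidal_category "Source T" by (rule source_monoidal)
  interpret A: monoidal_category "Target T"
    unfolding T_simps by (rule endo_monoidal) (rule ax)
  show ?thesis
  proof unfold_locales
    fix W assume "W \<in> Obj (Source T)"
    then have W: "W \<in> Ws" by (simp add: T_simps full_monoidal_subcategory_simps)
    then show "FO (Fun T) W \<in> Obj (Target T)"
      by (simp add: T_simps endo_simps endos_def path_simps)
    show "FM (Fun T) (Idn (Source T) W) = Idn (Target T) (FO (Fun T) W)"
      using W by (simp add: T_simps full_monoidal_subcategory_simps endo_simps hcomp_id path_simps)
  next
    fix m W V assume "m \<in> hom (Source T) W V"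
    then have "cell m W V" "W \<in> Ws" "V \<in> Ws" by (simp_all add: source_hom)
    then show "FM (Fun T) m \<in> hom (Target T) (FO (Fun T) W) (FO (Fun T) V)"
      using box_cell[of m W V]
      by (simp add: T_simps(2,3) endo_hom endos_def path_simps)
  next
    fix m n W V Z assume "m \<in> hom (Source T) W V" "n \<in> hom (Source T) V Z"
    then have c: "cell m W V" "cell n V Z" and w: "W \<in> Ws" "V \<in> Ws" "Z \<in> Ws"
      by (simp_all add: source_hom)
    have i: "cell (Id2 C u) u u" "cell (Id2 C d) d d" by (auto intro: id_cell simp: u d)
    have h: "cell (HComp C (Id2 C u) m) (path_comp u W) (path_comp u V)"
      "cell (HComp C (Id2 C u) n) (path_comp u V) (path_comp u Z)"
      using c w i by (auto intro!: hcomp_cell simp: path_simps)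
    \<comment> \<open>Writing the identities on \<open>u\<close> and \<open>d\<close> as composites
      of themselves turns functoriality of whiskering into interchange.\<close>
    have "FM (Fun T) (VComp C m n) = HComp C (HComp C (VComp C (Id2 C u) (Id2 C u)) (VComp C m n)) (VComp C (Id2 C d) (Id2 C d))"
      using i by (simp add: T_simps vcomp_id_left)
    also have "HComp C (VComp C (Id2 C u) (Id2 C u)) (VComp C m n) =
        VComp C (HComp C (Id2 C u) m) (HComp C (Id2 C u) n)"
      by (rule interchange[OF i(1) i(1) c]) (simp add: path_simps w)
    also have "HComp C \<dots> (VComp C (Id2 C d) (Id2 C d)) = VComp C (FM (Fun T) m) (FM (Fun T) n)"
      unfolding T_simps by (rule interchange[OF h i(2) i(2)]) (simp add: path_simps w)
    finally show "FM (Fun T) (m ;;\<^bsub>Source T\<^esub> n) = FM (Fun T) m ;;\<^bsub>Target T\<^esub> FM (Fun T) n"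
      by (simp add: T_simps(1,2) full_monoidal_subcategory_simps endo_simps)
  qed
qed

lemma mu_cell: "W \<in> Ws \<Longrightarrow> V \<in> Ws \<Longrightarrow>
    cell (mu T W V) (path_comp (FO (Fun T) W) (FO (Fun T) V)) (FO (Fun T) (path_comp W V))"
  using hcomp_cell[OF hcomp_cell[OF id_cell[of "path_comp u W"] e] id_cell[of "path_comp V d"]]
  by (simp add: T_simps path_simps)

text \<open>Bracketed to the right, so that whatever stands to the right of \<open>e\<close> can
  slide past it.\<close>

lemma mu_eq: "W \<in> Ws \<Longrightarrow> V \<in> Ws \<Longrightarrow>
    mu T W V = HComp C (Id2 C (path_comp u W)) (HComp C e (Id2 C (path_comp V d)))"
  unfolding T_simps by (rule hcomp_assoc[OF id_cell e id_cell]) (simp_all add: path_simps)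

text \<open>Since \<open>m\<close> lies to the left of \<open>e\<close> and \<open>k\<close> to its
  right, both sides equal the horizontal composite of \<open>?A\<close>, \<open>e\<close> and
  \<open>?B\<close>, with \<open>e\<close> carried out last on one side and first on the
  other.\<close>

lemma mu_natural:
  assumes m: "cell m W W'" "W \<in> Ws" "W' \<in> Ws" and n: "cell k V V'" "V \<in> Ws" "V' \<in> Ws"
  shows "VComp C (HComp C (FM (Fun T) m) (FM (Fun T) k)) (mu T W' V') =
    VComp C (mu T W V) (FM (Fun T) (HComp C m k))"
proof -
  let ?A = "HComp C (Id2 C u) m" and ?B = "HComp C k (Id2 C d)"
  have i: "cell (Id2 C u) u u" "cell (Id2 C d) d d" by (auto intro: id_cell simp: u d)
  have A: "cell ?A (path_comp u W) (path_comp u W')"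
    using m i by (auto intro!: hcomp_cell simp: path_simps)
  have B: "cell ?B (path_comp V d) (path_comp V' d)"
    using n i by (auto intro!: hcomp_cell simp: path_simps)
  have du: "is_path P (path_comp d u)" "is_path P (x, [], x)"
    by (simp_all add: path_simps)
  have iu: "is_path P (path_comp u W)" "is_path P (path_comp u W')"
    "is_path P (path_comp V d)" "is_path P (path_comp V' d)"
    using m n by (simp_all add: path_simps)
  have eB: "cell (HComp C (Id2 C (path_comp d u)) ?B)
      (path_comp (path_comp d u) (path_comp V d)) (path_comp (path_comp d u) (path_comp V' d))"
    "cell (HComp C e (Id2 C (path_comp V' d))) (path_comp (path_comp d u) (path_comp V' d))
      (path_comp (x, [], x) (path_comp V' d))"
    "cell (HComp C e (Id2 C (path_comp V d))) (path_comp (path_comp d u) (path_comp V d))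
      (path_comp (x, [], x) (path_comp V d))"
    "cell (HComp C (Id2 C (x, [], x)) ?B) (path_comp (x, [], x) (path_comp V d))
      (path_comp (x, [], x) (path_comp V' d))"
    using hcomp_cell[OF id_cell[OF du(1)] B] hcomp_cell[OF e id_cell[OF iu(4)]]
      hcomp_cell[OF e id_cell[OF iu(3)]] hcomp_cell[OF id_cell[OF du(2)] B] n
    by (simp_all add: u d WsD)
  have Fm: "FM (Fun T) m = HComp C ?A (Id2 C d)" by (simp add: T_simps)
  have "HComp C (Id2 C u) (HComp C k (Id2 C d)) = FM (Fun T) k"
    unfolding T_simps using n by (intro hcomp_assoc[OF i(1) n(1) i(2), symmetric]) (auto simp: path_simps)
  then have "HComp C (Id2 C (path_comp d u)) ?B = HComp C (Id2 C d) (FM (Fun T) k)"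
    using hcomp_assoc[OF i(2) i(1) B] n by (simp add: hcomp_id[symmetric] path_simps)
  then have 1: "HComp C (FM (Fun T) m) (FM (Fun T) k) = HComp C ?A (HComp C (Id2 C (path_comp d u)) ?B)"
    unfolding Fm using m n
    by (simp add: hcomp_assoc[OF A i(2) box_cell[OF n(1)]] path_simps T_simps(3))
  have "HComp C m ?B = HComp C (HComp C m k) (Id2 C d)"
    using m n by (intro hcomp_assoc[OF m(1) n(1) i(2), symmetric]) (auto simp: path_simps)
  moreover have "HComp C (Id2 C u) (HComp C (HComp C m k) (Id2 C d)) = FM (Fun T) (HComp C m k)"
    unfolding T_simps using m n
    by (intro hcomp_assoc[OF i(1) hcomp_cell[OF m(1) n(1)] i(2), symmetric]) (auto simp: path_simps)
  moreover have "HComp C ?A ?B = HComp C (Id2 C u) (HComp C m ?B)"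
    using m n by (intro hcomp_assoc[OF i(1) m(1) B]) (auto simp: path_simps)
  moreover have "HComp C (Id2 C (x, [], x)) ?B = ?B"
    using n by (intro hcomp_id_left[OF B]) (simp add: path_simps)
  ultimately have 2: "FM (Fun T) (HComp C m k) = HComp C ?A (HComp C (Id2 C (x, [], x)) ?B)"
    by simp
  have "VComp C (HComp C (FM (Fun T) m) (FM (Fun T) k)) (mu T W' V') = HComp C ?A (HComp C e ?B)"
    unfolding 1 mu_eq[OF m(3) n(3)] using m n
    by (subst interchange[OF A id_cell eB(1,2), symmetric])
      (simp_all add: vcomp_id_right[OF A] slide_right[OF e B] path_simps iu)
  also have "\<dots> = VComp C (mu T W V) (FM (Fun T) (HComp C m k))"
    unfolding 2 mu_eq[OF m(2) n(2)] using m n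
    by (subst interchange[OF id_cell A eB(3,4), symmetric])
      (simp_all add: vcomp_id_left[OF A] slide_left[OF e B] path_simps iu)
  finally show ?thesis .
qed

text \<open>Both sides are the horizontal composite of two copies of \<open>e\<close> at disjoint
  positions, separated by \<open>V\<close> and carried out in different orders. The second copy is
  the one inside \<open>?B\<close>.\<close>

lemma mu_assoc:
  assumes W: "W \<in> Ws" "V \<in> Ws" "Z \<in> Ws"
  shows "VComp C (HComp C (mu T W V) (Id2 C (FO (Fun T) Z))) (mu T (path_comp W V) Z) =
    VComp C (HComp C (Id2 C (FO (Fun T) W)) (mu T V Z)) (mu T W (path_comp V Z))"
proof -
  let ?B = "HComp C (Id2 C V) (HComp C e (Id2 C (path_comp Z d)))"
  let ?D = "path_comp V (path_comp (path_comp d u) (path_comp Z d))" and ?E = "path_comp V (path_comp Z d)"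
  have p: "is_path P (path_comp u W)" "is_path P (path_comp Z d)" "is_path P (path_comp V d)"
    "is_path P (path_comp d u)" "is_path P (x, [], x)" "is_path P ?D" "is_path P ?E"
    using W by (simp_all add: path_simps)
  have eZ: "cell (HComp C e (Id2 C (path_comp Z d))) (path_comp (path_comp d u) (path_comp Z d)) (path_comp Z d)"
    using hcomp_cell[OF e id_cell[OF p(2)]] W by (simp add: path_simps)
  have B: "cell ?B ?D ?E"
    using W by (intro hcomp_cell[OF id_cell eZ]) (auto simp: path_simps)
  have c: "cell (HComp C e (Id2 C ?D)) (path_comp (path_comp d u) ?D) (path_comp (x, [], x) ?D)"
    "cell (HComp C (Id2 C (x, [], x)) ?B) (path_comp (x, [], x) ?D) (path_comp (x, [], x) ?E)"
    "cell (HComp C (Id2 C (path_comp d u)) ?B) (path_comp (path_comp d u) ?D) (path_comp (path_comp d u) ?E)"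
    "cell (HComp C e (Id2 C ?E)) (path_comp (path_comp d u) ?E) (path_comp (x, [], x) ?E)"
    using hcomp_cell[OF e id_cell[OF p(6)]] hcomp_cell[OF id_cell[OF p(5)] B]
      hcomp_cell[OF id_cell[OF p(4)] B] hcomp_cell[OF e id_cell[OF p(7)]] W
    by (simp_all add: u d WsD)
  have mB: "HComp C (Id2 C u) ?B = mu T V Z"
    unfolding mu_eq[OF W(2,3)] using W
    by (subst hcomp_assoc[OF id_cell id_cell eZ, symmetric]) (simp_all add: path_simps hcomp_id)
  have 1: "HComp C (mu T W V) (Id2 C (FO (Fun T) Z)) =
      HComp C (Id2 C (path_comp u W)) (HComp C e (Id2 C ?D))"
    unfolding mu_eq[OF W(1,2)] using W hcomp_cell[OF e id_cell[OF p(3)]]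
    by (subst hcomp_assoc[OF id_cell[OF p(1)] hcomp_cell[OF e id_cell[OF p(3)]] id_cell];
      simp add: path_simps T_simps(3) hcomp_assoc[OF e id_cell[OF p(3)] id_cell] hcomp_id)
  have 2: "mu T (path_comp W V) Z = HComp C (Id2 C (path_comp u W)) (HComp C (Id2 C (x, [], x)) ?B)"
    unfolding mu_eq[OF Ws(3)[OF W(1,2)] W(3)] using W
    by (simp add: hcomp_id_left[OF B] hcomp_assoc[OF id_cell[OF p(1)] id_cell eZ, symmetric] hcomp_id path_simps)
  have 3: "HComp C (Id2 C (FO (Fun T) W)) (mu T V Z) =
      HComp C (Id2 C (path_comp u W)) (HComp C (Id2 C (path_comp d u)) ?B)"
    unfolding mB[symmetric] using W p B
    by (simp add: hcomp_assoc[OF id_cell id_cell B, symmetric] hcomp_id path_simps T_simps(3)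
        hcomp_assoc[OF id_cell id_cell hcomp_cell[OF id_cell B], symmetric])
  have "VComp C (HComp C (mu T W V) (Id2 C (FO (Fun T) Z))) (mu T (path_comp W V) Z) =
      HComp C (Id2 C (path_comp u W)) (HComp C e ?B)"
    unfolding 1 2 using W
    by (subst interchange[OF id_cell id_cell c(1,2), symmetric])
      (simp_all add: vcomp_id_left[OF id_cell] slide_left[OF e B] u d WsD p)
  also have "\<dots> = VComp C (HComp C (Id2 C (FO (Fun T) W)) (mu T V Z)) (mu T W (path_comp V Z))"
    unfolding 3 mu_eq[OF W(1) Ws(3)[OF W(2,3)]] path_comp_assoc[of V Z d] using W
    by (subst interchange[OF id_cell id_cell c(3,4), symmetric])
      (simp_all add: vcomp_id_left[OF id_cell] slide_right[OF e B] u d WsD p)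
  finally show ?thesis .
qed

text \<open>These are the snake equations, whiskered: for the left unit law everything to the right
  of the first \<open>u\<close> stays idle, for the right unit law everything to the left of the
  last \<open>d\<close>.\<close>

lemma mu_unit:
  assumes W: "W \<in> Ws"
  shows "VComp C (HComp C n (Id2 C (FO (Fun T) W))) (mu T (x, [], x) W) = Id2 C (FO (Fun T) W)"
    and "VComp C (HComp C (Id2 C (FO (Fun T) W)) n) (mu T W (x, [], x)) = Id2 C (FO (Fun T) W)"
proof -
  have p: "is_path P (path_comp u W)" "is_path P (path_comp W d)"
    using W by (simp_all add: path_simps)
  have i: "cell (Id2 C u) u u" "cell (Id2 C d) d d" by (auto intro: id_cell simp: u d)
  have c: "cell (HComp C n (Id2 C u)) u (path_comp (path_comp u d) u)"
    "cell (HComp C (Id2 C u) e) (path_comp (path_comp u d) u) u"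
    "cell (HComp C (Id2 C d) n) d (path_comp (path_comp d u) d)"
    "cell (HComp C e (Id2 C d)) (path_comp (path_comp d u) d) d"
    using hcomp_cell[OF n i(1)] hcomp_cell[OF i(1) e] hcomp_cell[OF i(2) n] hcomp_cell[OF e i(2)]
    by (simp_all add: path_simps)
  have "HComp C n (Id2 C (FO (Fun T) W)) = HComp C (HComp C n (Id2 C u)) (Id2 C (path_comp W d))"
    using W p by (simp add: hcomp_assoc[OF n i(1) id_cell] hcomp_id path_simps T_simps(3))
  moreover have "mu T (x, [], x) W = HComp C (HComp C (Id2 C u) e) (Id2 C (path_comp W d))"
    using u by (simp add: T_simps path_comp_unit)
  ultimately show "VComp C (HComp C n (Id2 C (FO (Fun T) W))) (mu T (x, [], x) W) = Id2 C (FO (Fun T) W)"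
    using W p
    by (simp add: interchange[OF c(1,2) id_cell id_cell, symmetric] snake_u vcomp_id_left[OF id_cell]
        hcomp_id path_simps T_simps(3))
  have "HComp C (Id2 C (FO (Fun T) W)) n = HComp C (Id2 C (path_comp u W)) (HComp C (Id2 C d) n)"
    using W p by (simp add: hcomp_assoc[OF id_cell i(2) n, symmetric] hcomp_id path_simps T_simps(3))
  moreover have "mu T W (x, [], x) = HComp C (Id2 C (path_comp u W)) (HComp C e (Id2 C d))"
    using d by (simp add: mu_eq[OF W Ws(2)] path_comp_unit)
  ultimately show "VComp C (HComp C (Id2 C (FO (Fun T) W)) n) (mu T W (x, [], x)) = Id2 C (FO (Fun T) W)"
    using W p
    by (simp add: interchange[OF id_cell id_cell c(3,4), symmetric] snake_d vcomp_id_left[OF id_cell]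
        hcomp_id path_simps T_simps(3))
qed

lemma presented_lax: "lax_monoidal T"
proof -
  have s: "Obj (Source T) = Ws" "Unit (Source T) = (x, [], x)" "TenO (Source T) = path_comp"
    "TenA (Source T) = HComp C" "Dom (Source T) = Dom2 C" "Cod (Source T) = Cod2 C"
    by (simp_all add: T_simps(1) full_monoidal_subcategory_simps endo_simps)
  note t = endo_simps[of a, folded T_simps(2)]
  have h: "m \<in> hom (Target T) p q \<longleftrightarrow> cell m p q \<and> p \<in> endos a \<and> q \<in> endos a" for m p q
    unfolding T_simps(2) by (rule endo_hom)
  have en: "(a, [], a) \<in> endos a" "\<And>W. W \<in> Ws \<Longrightarrow> FO (Fun T) W \<in> endos a"
    "\<And>p q. p \<in> endos a \<Longrightarrow> q \<in> endos a \<Longrightarrow> path_comp p q \<in> endos a"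
    by (simp_all add: endos_def path_simps T_simps(3))
  have "cell (eps T) (Unit (Target T)) (FO (Fun T) (x, [], x))"
    using n d by (simp add: T_simps(3,5) t path_comp_unit)
  moreover have "monoidal_category (Target T)"
    unfolding T_simps by (rule endo_monoidal) (rule ax)
  moreover have "VComp C (HComp C (FM (Fun T) m) (FM (Fun T) k)) (mu T (Cod2 C m) (Cod2 C k)) =
      VComp C (mu T (Dom2 C m) (Dom2 C k)) (FM (Fun T) (HComp C m k))"
    if "m \<in> Arr (Source T)" "k \<in> Arr (Source T)" for m k
  proof -
    from that obtain W W' V V' where "cell m W W'" "cell k V V'" "W \<in> Ws" "W' \<in> Ws" "V \<in> Ws" "V' \<in> Ws"
      unfolding source_Arr by blast
    then show ?thesis by (simp add: Dom2_cell Cod2_cell mu_natural)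
  qed
  ultimately show ?thesis
    using source_monoidal box_functor
    by (simp add: lax_monoidal_def Let_def s t h en Ws mu_cell mu_assoc
        mu_unit T_simps(5))
qed

end

section \<open>Equational rules for arrows of strict monoidal categories\<close>

context category
begin

lemma id_arr: "a \<in> Obj C \<Longrightarrow> Idn C a \<in> Arr C" "a \<in> Obj C \<Longrightarrow> Dom C (Idn C a) = a"
  "a \<in> Obj C \<Longrightarrow> Cod C (Idn C a) = a"
  using id_hom by (auto simp: hom_def)

lemma comp_arr:
  assumes "f \<in> Arr C" "g \<in> Arr C" "Cod C f = Dom C g"
  shows "f ;;\<^bsub>C\<^esub> g \<in> Arr C" "Dom C (f ;;\<^bsub>C\<^esub> g) = Dom C f" "Cod C (f ;;\<^bsub>C\<^esub> g) = Cod C g"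
  using comp_hom[of f "Dom C f" "Cod C f" g "Cod C g"] assms by (auto simp: hom_def)

lemma id_comp:
  "f \<in> Arr C \<Longrightarrow> Dom C f = a \<Longrightarrow> Idn C a ;;\<^bsub>C\<^esub> f = f"
  "f \<in> Arr C \<Longrightarrow> Cod C f = a \<Longrightarrow> f ;;\<^bsub>C\<^esub> Idn C a = f"
  using id_left id_right by (auto simp: hom_def)

lemmas arr_simps = dom_obj cod_obj id_arr comp_arr id_comp

end

context monoidal_category
begin

lemma ten_arr:
  assumes "f \<in> Arr M" "g \<in> Arr M"
  shows "TenA M f g \<in> Arr M" "Dom M (TenA M f g) = TenO M (Dom M f) (Dom M g)"
    "Cod M (TenA M f g) = TenO M (Cod M f) (Cod M g)"
  using ten_hom[OF arr_hom arr_hom, OF assms] by (auto simp: hom_def)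

lemma ten_comp': "f \<in> Arr M \<Longrightarrow> g \<in> Arr M \<Longrightarrow> f' \<in> Arr M \<Longrightarrow> g' \<in> Arr M \<Longrightarrow>
    Cod M f = Dom M g \<Longrightarrow> Cod M f' = Dom M g' \<Longrightarrow>
    TenA M f f' ;;\<^bsub>M\<^esub> TenA M g g' = TenA M (f ;;\<^bsub>M\<^esub> g) (f' ;;\<^bsub>M\<^esub> g')"
  by (rule ten_comp[symmetric]) (auto simp: hom_def)

text \<open>Both sides equal \<open>TenA M f g\<close>. This is what sliding amounts to when the two
  positions are separated by the 0-cell \<open>ZA\<close>.\<close>

lemma slide_ten:
  assumes "f \<in> hom M a b" "g \<in> hom M c d"
  shows "TenA M f (Idn M c) ;;\<^bsub>M\<^esub> TenA M (Idn M b) g = TenA M (Idn M a) g ;;\<^bsub>M\<^esub> TenA M f (Idn M d)"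
  using assms homD[OF assms(1)] homD[OF assms(2)] hom_obj[OF assms(1)] hom_obj[OF assms(2)]
  by (simp add: ten_comp' arr_simps)

lemmas ten_simps = unit_obj ten_obj ten_obj_unit_left ten_obj_unit_right ten_obj_assoc tens_obj
  ten_arr ten_assoc ten_unit_left ten_unit_right

end

context is_functor
begin
lemmas map_simps = map_obj map_arr map_dom map_cod map_id
end

section \<open>The syntactic 2-category\<close>

locale signature =
  fixes S :: "'u fsig"
  assumes fsig: "is_fsig S"
begin

abbreviation P where "P \<equiv> syntactic_presentation S"

lemma P_simps:
  "Gens0 P = {ZA, ZX}" "Gens1 P = GA ` AObj S \<union> GX ` XObj S \<union> {Up, Down}"
  "gdom1 P = gen1_dom" "gcod1 P = gen1_cod" "gdom2 P = gen2_dom" "gcod2 P = gen2_cod"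
  "Rels P = {(VT (HT (GenT Eta) (IdT up_path)) (HT (IdT up_path) (GenT Counit)), IdT up_path),
    (VT (HT (IdT down_path) (GenT Eta)) (HT (GenT Counit) (IdT down_path)), IdT down_path)}"
  by (simp_all add: syntactic_presentation_def)

lemma Gens2_P:
  "g \<in> Gens2 P \<longleftrightarrow> (case g of Eta \<Rightarrow> True | Counit \<Rightarrow> True | PlainG us vs e \<Rightarrow> e \<in> Plain S us vs
    | FBoxG us vs e \<Rightarrow> e \<in> FBox S us vs | InG us vs e \<Rightarrow> e \<in> InBox S us vs
    | OutG us vs e \<Rightarrow> e \<in> OutBox S us vs)"
  by (auto simp: syntactic_presentation_def split: gen2.splits)

lemma Gens0_P: "c \<in> Gens0 P"
  by (cases c) (simp_all add: P_simps)

lemma path_from_GA: "us \<in> lists (AObj S) \<Longrightarrow> path_from P ZA (map GA us) ZA"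
  by (induction us) (auto simp: P_simps)

lemma path_from_GX: "us \<in> lists (XObj S) \<Longrightarrow> path_from P ZX (map GX us) ZX"
  by (induction us) (auto simp: P_simps)

lemma is_path_apath: "us \<in> lists (AObj S) \<Longrightarrow> is_path P (apath us)"
  and is_path_xpath: "us \<in> lists (XObj S) \<Longrightarrow> is_path P (xpath us)"
  by (simp_all add: is_path_def apath_def xpath_def path_from_GA path_from_GX)

lemma is_path_up: "is_path P up_path" and is_path_down: "is_path P down_path"
  by (simp_all add: is_path_def P_simps)

lemma boxpath_eq: "boxpath us = path_comp up_path (path_comp (xpath us) down_path)"
  by (simp add: boxpath_def xpath_def)

lemma path_ends [simp]:
  "path_dom (apath us) = ZA" "path_cod (apath us) = ZA" "path_dom (xpath us) = ZX"
  "path_cod (xpath us) = ZX" "path_dom (boxpath us) = ZA" "path_cod (boxpath us) = ZA"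
  by (simp_all add: apath_def xpath_def boxpath_def)

lemma is_path_boxpath: "us \<in> lists (XObj S) \<Longrightarrow> is_path P (boxpath us)"
  unfolding boxpath_eq by (intro is_path_comp is_path_up is_path_down is_path_xpath) simp_all

text \<open>Only the generators \<open>GX\<close> and \<open>Down\<close> start at
  \<open>ZX\<close>, so the path lists the content of the open box until either the path or the box
  ends.\<close>

lemma path_from_ZX_cases:
  "path_from P ZX gs c \<Longrightarrow> \<exists>xs \<in> lists (XObj S). (c = ZX \<and> gs = map GX xs) \<or>
    (\<exists>gs'. gs = map GX xs @ Down # gs' \<and> path_from P ZA gs' c)"
proof (induction gs)
  case Nil
  then show ?case by (auto intro: bexI[of _ "[]"])
next
  case (Cons g gs)
  show ?case
  proof (cases g)
    case (GX x)
    with Cons.prems have x: "x \<in> XObj S" "path_from P ZX gs c" by (auto simp: P_simps)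
    from Cons.IH[OF x(2)] obtain xs where "xs \<in> lists (XObj S)"
      "(c = ZX \<and> gs = map GX xs) \<or> (\<exists>gs'. gs = map GX xs @ Down # gs' \<and> path_from P ZA gs' c)"
      by blast
    then show ?thesis using x(1) GX by (intro bexI[of _ "x # xs"]) auto
  next
    case Down
    with Cons.prems have "path_from P ZA gs c" by (auto simp: P_simps)
    then show ?thesis using Down by (intro bexI[of _ "[]"]) auto
  qed (use Cons.prems in \<open>auto simp: P_simps\<close>)
qed

text \<open>Dual to \<open>path_from_ZX_cases\<close>: the last \<open>Up\<close> opens the box in
  which the path ends. The induction removes generators from the right end.\<close>

lemma path_to_ZX_cases:
  "path_from P c gs ZX \<Longrightarrow> \<exists>xs \<in> lists (XObj S). (c = ZX \<and> gs = map GX xs) \<or>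
    (\<exists>gs'. gs = gs' @ Up # map GX xs \<and> path_from P c gs' ZA)"
proof (induction gs rule: rev_induct)
  case Nil
  then show ?case by (auto intro: bexI[of _ "[]"])
next
  case (snoc g gs)
  from snoc.prems obtain d where d: "path_from P c gs d" "path_from P d [g] ZX"
    using path_from_appendD by metis
  show ?case
  proof (cases g)
    case (GX x)
    with d have x: "x \<in> XObj S" "path_from P c gs ZX" by (auto simp: P_simps)
    from snoc.IH[OF x(2)] obtain xs where "xs \<in> lists (XObj S)"
      "(c = ZX \<and> gs = map GX xs) \<or> (\<exists>gs'. gs = gs' @ Up # map GX xs \<and> path_from P c gs' ZA)"
      by blast
    then show ?thesis using x(1) GX by (intro bexI[of _ "xs @ [x]"]) auto
  next
    case Up
    with d have "path_from P c gs ZA" by (auto simp: P_simps)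
    then show ?thesis using Up by (intro bexI[of _ "[]"]) auto
  qed (use d in \<open>auto simp: P_simps\<close>)
qed

sublocale presented P
proof
  fix g assume "g \<in> Gens2 P"
  then show "is_path P (gdom2 P g) \<and> is_path P (gcod2 P g) \<and>
      path_dom (gdom2 P g) = path_dom (gcod2 P g) \<and> path_cod (gdom2 P g) = path_cod (gcod2 P g)"
    using fsig_listsD[OF fsig] is_path_apath is_path_xpath is_path_boxpath
    by (cases g; simp add: Gens2_P P_simps(5,6) del: in_lists_conv_set)
      (auto simp: is_path_def P_simps)
next
  fix s t assume "(s, t) \<in> Rels P"
  then show "wf_tm P s \<and> wf_tm P t \<and> tdom P s = tdom P t \<and> tcod P s = tcod P t"
    by (auto simp: P_simps Gens2_P is_path_def)
qed

abbreviation Ws where "Ws \<equiv> {xpath us | us. us \<in> lists (XObj S)}"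

lemma rel_up: "tm_eq P (VT (HT (GenT Eta) (IdT up_path)) (HT (IdT up_path) (GenT Counit))) (IdT up_path)"
  and rel_down: "tm_eq P (VT (HT (IdT down_path) (GenT Eta)) (HT (GenT Counit) (IdT down_path))) (IdT down_path)"
  by (rule tm_eq.relation; simp add: P_simps)+

sublocale adj: presented_adjunction P ZA ZX up_path down_path
  "tm_class P (GenT Eta)" "tm_class P (GenT Counit)" Ws
proof unfold_locales
  show "is_path P up_path" "is_path P down_path" by (rule is_path_up is_path_down)+
  show "cell (tm_class P (GenT Eta)) (ZA, [], ZA) (path_comp up_path down_path)"
    by (rule cellI') (simp_all add: Gens2_P P_simps)
  show "cell (tm_class P (GenT Counit)) (path_comp down_path up_path) (ZX, [], ZX)"
    by (rule cellI') (simp_all add: Gens2_P P_simps)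
  have "wf_tm P (VT (HT (GenT Eta) (IdT up_path)) (HT (IdT up_path) (GenT Counit)))"
    "wf_tm P (VT (HT (IdT down_path) (GenT Eta)) (HT (GenT Counit) (IdT down_path)))"
    using rel_up rel_down tm_eq_wf by blast+
  then show "VComp C (HComp C (tm_class P (GenT Eta)) (Id2 C up_path))
      (HComp C (Id2 C up_path) (tm_class P (GenT Counit))) = Id2 C up_path"
    "VComp C (HComp C (Id2 C down_path) (tm_class P (GenT Eta)))
      (HComp C (tm_class P (GenT Counit)) (Id2 C down_path)) = Id2 C down_path"
    using tm_class_eq[OF rel_up] tm_class_eq[OF rel_down]
    by (simp_all add: C_simps HComp_class VComp_class)
  have "xpath us \<in> endos ZX" if "us \<in> lists (XObj S)" for us
    using that by (simp add: endos_def is_path_xpath del: in_lists_conv_set)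
  then show "Ws \<subseteq> endos ZX" by blast
  show "(ZX, [], ZX) \<in> Ws" by (auto simp: xpath_def intro: exI[of _ "[]"])
  fix p q assume "p \<in> Ws" "q \<in> Ws"
  then obtain us vs where "p = xpath us" "q = xpath vs" "us \<in> lists (XObj S)" "vs \<in> lists (XObj S)"
    by blast
  then show "path_comp p q \<in> Ws" by (auto simp: xpath_def intro!: exI[of _ "us @ vs"])
qed simp_all

lemma syntactic_lax_eq: "syntactic_lax S = adj.T"
  by (simp add: syntactic_lax_def Let_def syntactic_two_cat_def)

lemma syntactic_lax: "lax_monoidal (syntactic_lax S)"
  unfolding syntactic_lax_eq by (rule adj.presented_lax)

end

section \<open>Interpreting the syntactic 2-category in a lax monoidal functor\<close>

text \<open>This is a signature morphism from \<open>S\<close> into the underlying signature of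
  \<open>T\<close>, unpacked and with the types of \<open>T\<close> left free, so that codomains
  over the universe and syntactic codomains are treated alike.\<close>

locale interpretation_data = signature S + lax_functor T
  for S :: "'u fsig" and T :: "('xo, 'xm, 'ao, 'am) lax" +
  fixes h :: "'u \<Rightarrow> 'ao" and k :: "'u \<Rightarrow> 'xo"
    and pl ib ob :: "'u list \<Rightarrow> 'u list \<Rightarrow> 'u \<Rightarrow> 'am" and fb :: "'u list \<Rightarrow> 'u list \<Rightarrow> 'u \<Rightarrow> 'xm"
  assumes h: "u \<in> AObj S \<Longrightarrow> h u \<in> Obj (Target T)"
    and k: "u \<in> XObj S \<Longrightarrow> k u \<in> Obj (Source T)"
    and pl: "e \<in> Plain S us vs \<Longrightarrow> pl us vs e \<in> hom (Target T)
      (tens (Target T) (map h us)) (tens (Target T) (map h vs))"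
    and fb: "e \<in> FBox S us vs \<Longrightarrow> fb us vs e \<in> hom (Source T)
      (tens (Source T) (map k us)) (tens (Source T) (map k vs))"
    and ib: "e \<in> InBox S us vs \<Longrightarrow> ib us vs e \<in> hom (Target T)
      (tens (Target T) (map h us)) (FO (Fun T) (tens (Source T) (map k vs)))"
    and ob: "e \<in> OutBox S us vs \<Longrightarrow> ob us vs e \<in> hom (Target T)
      (FO (Fun T) (tens (Source T) (map k us))) (tens (Target T) (map h vs))"
begin

abbreviation tenA (infixr "\<otimes>" 70) where "a \<otimes> b \<equiv> TenO (Target T) a b"
abbreviation tenA' (infixr "\<boxtimes>" 70) where "a \<boxtimes> b \<equiv> TenA (Target T) a b"
abbreviation tenX (infixr "\<odot>" 70) where "a \<odot> b \<equiv> TenO (Source T) a b"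
abbreviation tenX' (infixr "\<boxdot>" 70) where "a \<boxdot> b \<equiv> TenA (Source T) a b"
abbreviation seqA (infixl "\<Zsemi>" 65) where "f \<Zsemi> g \<equiv> f ;;\<^bsub>Target T\<^esub> g"
abbreviation idA where "idA \<equiv> Idn (Target T)"
abbreviation idX where "idX \<equiv> Idn (Source T)"
abbreviation unitA where "unitA \<equiv> Unit (Target T)"
abbreviation unitX where "unitX \<equiv> Unit (Source T)"
abbreviation Fo where "Fo \<equiv> FO (Fun T)"
abbreviation Fm where "Fm \<equiv> FM (Fun T)"

text \<open>A path from \<open>ZA\<close> is summarised by the tensor product \<open>a\<close> of everything up to the last
  closed box together with the content \<open>x\<close> of the open box (the unit if no box is open); dually
  for paths to \<open>ZA\<close>.\<close>

fun lstep :: "'u gen1 \<Rightarrow> 'ao \<times> 'xo \<Rightarrow> 'ao \<times> 'xo" where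
  "lstep (GA b) (a, x) = (a \<otimes> h b, unitX)"
| "lstep (GX y) (a, x) = (a, x \<odot> k y)"
| "lstep Up (a, x) = (a, unitX)"
| "lstep Down (a, x) = (a \<otimes> Fo x, unitX)"

fun rstep :: "'u gen1 \<Rightarrow> 'xo \<times> 'ao \<Rightarrow> 'xo \<times> 'ao" where
  "rstep (GA b) (x, a) = (unitX, h b \<otimes> a)"
| "rstep (GX y) (x, a) = (k y \<odot> x, a)"
| "rstep Up (x, a) = (unitX, Fo x \<otimes> a)"
| "rstep Down (x, a) = (unitX, a)"

definition lact :: "'u syn1 \<Rightarrow> 'ao \<times> 'xo \<Rightarrow> 'ao \<times> 'xo" where
  "lact p = fold lstep (fst (snd p))"

definition ract :: "'u syn1 \<Rightarrow> 'xo \<times> 'ao \<Rightarrow> 'xo \<times> 'ao" where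
  "ract p = foldr rstep (fst (snd p))"

text \<open>The object denoted by a closed path that has been cut at a 0-cell. A cut at
  \<open>ZX\<close> goes through a box, whose two half contents are tensored before the functor is
  applied.\<close>

fun join :: "cell0 \<Rightarrow> 'ao \<times> 'xo \<Rightarrow> 'xo \<times> 'ao \<Rightarrow> 'ao" where
  "join ZA (a, x) (x', a') = a \<otimes> a'"
| "join ZX (a, x) (x', a') = a \<otimes> Fo (x \<odot> x') \<otimes> a'"

text \<open>No box is open at \<open>ZA\<close>; requiring the content to be the unit there makes
  the summary of a path canonical and lets contexts be compared by equality.\<close>

fun lok :: "cell0 \<Rightarrow> 'ao \<times> 'xo \<Rightarrow> bool" where
  "lok c (a, x) \<longleftrightarrow> a \<in> Obj (Target T) \<and> x \<in> Obj (Source T) \<and> (c = ZA \<longrightarrow> x = unitX)"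

fun rok :: "cell0 \<Rightarrow> 'xo \<times> 'ao \<Rightarrow> bool" where
  "rok c (x, a) \<longleftrightarrow> a \<in> Obj (Target T) \<and> x \<in> Obj (Source T) \<and> (c = ZA \<longrightarrow> x = unitX)"

text \<open>The arguments \<open>x\<close> and \<open>x'\<close> are the contents, to the left and
  to the right of the generator, of the box around it. Only the two kinds of generators based at
  \<open>ZX\<close> see them.\<close>

fun core :: "'u gen2 \<Rightarrow> 'xo \<Rightarrow> 'xo \<Rightarrow> 'am" where
  "core Eta x x' = eps T"
| "core Counit x x' = mu T x x'"
| "core (PlainG us vs e) x x' = pl us vs e"
| "core (FBoxG us vs e) x x' = Fm (idX x \<boxdot> fb us vs e \<boxdot> idX x')"
| "core (InG us vs e) x x' = ib us vs e"
| "core (OutG us vs e) x x' = ob us vs e"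

text \<open>In a horizontal composite the left factor acts first; that the order does not matter is the
  lemma \<open>slides\<close> below.\<close>

primrec sem :: "(cell0, 'u gen1, 'u gen2) tm \<Rightarrow> 'ao \<times> 'xo \<Rightarrow> 'xo \<times> 'ao \<Rightarrow> 'am" where
  "sem (IdT p) l r = idA (join (path_dom p) l (ract p r))"
| "sem (GenT g) l r = idA (fst l) \<boxtimes> core g (snd l) (fst r) \<boxtimes> idA (snd r)"
| "sem (VT s t) l r = sem s l r \<Zsemi> sem t l r"
| "sem (HT s t) l r = sem s l (ract (tdom P t) r) \<Zsemi> sem t (lact (tcod P s) l) r"

lemma act_simps [simp]:
  "lact (path_comp p q) l = lact q (lact p l)" "ract (path_comp p q) r = ract p (ract q r)"
  "lact (c, [], d) l = l" "ract (c, [], d) r = r"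
  "lact (c, g # gs, d) l = lact (c, gs, d) (lstep g l)"
  "ract (c, g # gs, d) r = rstep g (ract (c, gs, d) r)"
  "lact (c, gs @ hs, d) l = lact (c, hs, d) (lact (c, gs, d) l)"
  "ract (c, gs @ hs, d) r = ract (c, gs, d) (ract (c, hs, d) r)"
  by (simp_all add: lact_def ract_def path_comp_def)

lemmas obj_simps = A.ten_simps X.ten_simps F.map_obj h k

lemma steps_ok:
  assumes "path_from P c [g] d"
  shows "lok c l \<Longrightarrow> lok d (lstep g l)" "rok d r \<Longrightarrow> rok c (rstep g r)"
  using assms by (cases g; cases l; cases r; auto simp: P_simps obj_simps)+

text \<open>One generator crosses the cut. For \<open>GA\<close> and \<open>GX\<close> this is
  associativity of the tensor product; for \<open>Up\<close> and \<open>Down\<close> the unit law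
  absorbs the empty half of the box.\<close>

lemma step_join:
  assumes "path_from P c [g] d" "lok c l" "rok d r"
  shows "join d (lstep g l) r = join c l (rstep g r)"
  using assms by (cases g; cases l; cases r) (auto simp: P_simps obj_simps)

lemma path_from_Cons: "path_from P c (g # gs) d \<Longrightarrow>
    path_from P c [g] (gen1_cod g) \<and> path_from P (gen1_cod g) gs d"
  by (auto simp: P_simps(3,4) Gens0_P)

text \<open>The actions ignore the ends recorded in a path, so the ends \<open>ZA\<close> in these
  statements are placeholders; the actual ends are those in \<open>path_from\<close>.\<close>

lemma path_acts_ok:
  "path_from P c gs d \<Longrightarrow> lok c l \<Longrightarrow> lok d (lact (ZA, gs, ZA) l)"
  "path_from P c gs d \<Longrightarrow> rok d r \<Longrightarrow> rok c (ract (ZA, gs, ZA) r)"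
proof (induction gs arbitrary: c l)
  case (Cons g gs)
  {
    case 1
    note p = path_from_Cons[OF 1(1)]
    show ?case using Cons.IH(1)[OF conjunct2[OF p] steps_ok(1)[OF conjunct1[OF p] 1(2)]] by simp
  next
    case 2
    note p = path_from_Cons[OF 2(1)]
    show ?case using steps_ok(2)[OF conjunct1[OF p] Cons.IH(2)[OF conjunct2[OF p] 2(2)]] by simp
  }
qed simp_all

lemma path_join:
  "path_from P c gs d \<Longrightarrow> lok c l \<Longrightarrow> rok d r \<Longrightarrow>
    join d (lact (ZA, gs, ZA) l) r = join c l (ract (ZA, gs, ZA) r)"
proof (induction gs arbitrary: c l)
  case (Cons g gs)
  note p = path_from_Cons[OF Cons.prems(1)]
  have "join d (lact (ZA, g # gs, ZA) l) r = join (gen1_cod g) (lstep g l) (ract (ZA, gs, ZA) r)"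
    using Cons.IH[OF conjunct2[OF p] steps_ok(1)[OF conjunct1[OF p] Cons.prems(2)] Cons.prems(3)]
    by simp
  also have "\<dots> = join c l (ract (ZA, g # gs, ZA) r)"
    using step_join[OF conjunct1[OF p] Cons.prems(2) path_acts_ok(2)[OF conjunct2[OF p] Cons.prems(3)]]
    by simp
  finally show ?case .
qed simp

lemma act_ok:
  "is_path P p \<Longrightarrow> lok (path_dom p) l \<Longrightarrow> lok (path_cod p) (lact p l)"
  "is_path P p \<Longrightarrow> rok (path_cod p) r \<Longrightarrow> rok (path_dom p) (ract p r)"
  using path_acts_ok by (cases p; auto simp: is_path_def lact_def ract_def)+

lemma join_act:
  "is_path P p \<Longrightarrow> lok (path_dom p) l \<Longrightarrow> rok (path_cod p) r \<Longrightarrow>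
    join (path_cod p) (lact p l) r = join (path_dom p) l (ract p r)"
  using path_join by (cases p; auto simp: is_path_def lact_def ract_def)

lemma join_obj: "lok c l \<Longrightarrow> rok c r \<Longrightarrow> join c l r \<in> Obj (Target T)"
  by (cases c; cases l; cases r) (auto simp: obj_simps)

lemma map_objs:
  "us \<in> lists (AObj S) \<Longrightarrow> map h us \<in> lists (Obj (Target T))"
  "us \<in> lists (XObj S) \<Longrightarrow> map k us \<in> lists (Obj (Source T))"
  by (auto simp: h k)

lemma act_GA:
  "us \<in> lists (AObj S) \<Longrightarrow> lok ZA (a, x) \<Longrightarrow>
    lact (c, map GA us, d) (a, x) = (a \<otimes> tens (Target T) (map h us), unitX)"
  "us \<in> lists (AObj S) \<Longrightarrow> rok ZA (x, a) \<Longrightarrow>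
    ract (c, map GA us, d) (x, a) = (unitX, tens (Target T) (map h us) \<otimes> a)"
  by (induction us arbitrary: a x) (auto simp: obj_simps map_objs simp flip: in_lists_conv_set)

lemma act_GX:
  "us \<in> lists (XObj S) \<Longrightarrow> lok ZX (a, x) \<Longrightarrow>
    lact (c, map GX us, d) (a, x) = (a, x \<odot> tens (Source T) (map k us))"
  "us \<in> lists (XObj S) \<Longrightarrow> rok ZX (x, a) \<Longrightarrow>
    ract (c, map GX us, d) (x, a) = (tens (Source T) (map k us) \<odot> x, a)"
  by (induction us arbitrary: a x) (auto simp: obj_simps map_objs simp flip: in_lists_conv_set)

fun cdom :: "'u gen2 \<Rightarrow> 'xo \<Rightarrow> 'xo \<Rightarrow> 'ao" where
  "cdom Eta x x' = unitA"
| "cdom Counit x x' = Fo x \<otimes> Fo x'"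
| "cdom (PlainG us vs e) x x' = tens (Target T) (map h us)"
| "cdom (FBoxG us vs e) x x' = Fo (x \<odot> tens (Source T) (map k us) \<odot> x')"
| "cdom (InG us vs e) x x' = tens (Target T) (map h us)"
| "cdom (OutG us vs e) x x' = Fo (tens (Source T) (map k us))"

fun ccod :: "'u gen2 \<Rightarrow> 'xo \<Rightarrow> 'xo \<Rightarrow> 'ao" where
  "ccod Eta x x' = Fo unitX"
| "ccod Counit x x' = Fo (x \<odot> x')"
| "ccod (PlainG us vs e) x x' = tens (Target T) (map h vs)"
| "ccod (FBoxG us vs e) x x' = Fo (x \<odot> tens (Source T) (map k vs) \<odot> x')"
| "ccod (InG us vs e) x x' = Fo (tens (Source T) (map k vs))"
| "ccod (OutG us vs e) x x' = tens (Target T) (map h vs)"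

lemma core_hom:
  assumes "g \<in> Gens2 P" "x \<in> Obj (Source T)" "x' \<in> Obj (Source T)"
  shows "core g x x' \<in> hom (Target T) (cdom g x x') (ccod g x x')"
proof (cases g)
  case (FBoxG us vs e)
  then have "fb us vs e \<in> hom (Source T) (tens (Source T) (map k us)) (tens (Source T) (map k vs))"
    using assms(1) by (simp add: Gens2_P fb)
  then show ?thesis
    using assms(2,3) FBoxG by (auto intro!: F.map_hom X.ten_hom X.id_hom)
qed (use assms eps_hom mu_hom pl ib ob in \<open>auto simp: Gens2_P\<close>)

lemma gen_lists:
  assumes "g \<in> Gens2 P"
  shows "case g of Eta \<Rightarrow> True | Counit \<Rightarrow> True
    | PlainG us vs e \<Rightarrow> us \<in> lists (AObj S) \<and> vs \<in> lists (AObj S)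
    | FBoxG us vs e \<Rightarrow> us \<in> lists (XObj S) \<and> vs \<in> lists (XObj S)
    | InG us vs e \<Rightarrow> us \<in> lists (AObj S) \<and> vs \<in> lists (XObj S)
    | OutG us vs e \<Rightarrow> us \<in> lists (XObj S) \<and> vs \<in> lists (AObj S)"
  using assms fsig_listsD[OF fsig] by (cases g) (auto simp: Gens2_P simp del: in_lists_conv_set)

text \<open>A closed context contributes one object on either side, and between them stand the ends
  of \<open>core\<close>. At \<open>Counit\<close> the domain closes the box and opens a new one,
  hence two values of the functor, which the codomain merges into one.\<close>

lemma gen_join:
  assumes g: "g \<in> Gens2 P" and l: "lok (path_dom (gen2_dom g)) l" and r: "rok (path_cod (gen2_dom g)) r"
  shows "join (path_dom (gen2_dom g)) l (ract (gen2_dom g) r) = fst l \<otimes> cdom g (snd l) (fst r) \<otimes> snd r"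
    "join (path_dom (gen2_dom g)) l (ract (gen2_cod g) r) = fst l \<otimes> ccod g (snd l) (fst r) \<otimes> snd r"
  using l r gen_lists[OF g]
  by (cases g; cases l; cases r; auto simp: obj_simps act_GA act_GX map_objs
      apath_def xpath_def boxpath_def simp del: in_lists_conv_set)+

lemma sem_hom:
  assumes "wf_tm P t" "lok (path_dom (tdom P t)) l" "rok (path_cod (tdom P t)) r"
  shows "sem t l r \<in> hom (Target T) (join (path_dom (tdom P t)) l (ract (tdom P t) r))
    (join (path_dom (tdom P t)) l (ract (tcod P t) r))"
  using assms
proof (induction t arbitrary: l r)
  case (IdT p)
  then show ?case by (auto intro!: A.id_hom join_obj act_ok)
next
  case (GenT g)
  obtain a x x' a' where "l = (a, x)" "r = (x', a')" by (cases l; cases r)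
  with GenT show ?case
    by (auto simp: P_simps gen_join intro!: A.ten_hom A.id_hom core_hom)
next
  case (VT s t)
  then have e: "tcod P s = tdom P t" "path_dom (tdom P s) = path_dom (tdom P t)"
    "path_cod (tdom P s) = path_cod (tdom P t)"
    using wf_path[of s] wf_path[of t] by auto
  show ?case
    using A.comp_hom[OF VT.IH(1)[of l r, unfolded e] VT.IH(2)[of l r]] VT.prems e by simp
next
  case (HT s t)
  let ?r = "ract (tdom P t) r" and ?l = "lact (tcod P s) l"
  note s = wf_path[of s] and t = wf_path[of t]
  have r: "rok (path_cod (tdom P s)) ?r" and l: "lok (path_dom (tdom P t)) ?l"
    using HT.prems s t act_ok(2)[of "tdom P t" r] act_ok(1)[of "tcod P s" l] by auto
  have 1: "sem s l ?r \<in> hom (Target T) (join (path_dom (tdom P s)) l (ract (tdom P s) ?r))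
      (join (path_dom (tdom P s)) l (ract (tcod P s) ?r))"
    using HT.prems r by (intro HT.IH) auto
  have 2: "sem t ?l r \<in> hom (Target T) (join (path_dom (tdom P t)) ?l ?r)
      (join (path_dom (tdom P t)) ?l (ract (tcod P t) r))"
    using HT.prems l by (intro HT.IH) auto
  \<comment> \<open>The ends of the second factor are computed at a cut behind \<open>s\<close>;
    moving the codomain of \<open>s\<close> across that cut makes the two factors
    composable.\<close>
  have "join (path_dom (tdom P t)) ?l r' = join (path_dom (tdom P s)) l (ract (tcod P s) r')"
    if "rok (path_dom (tdom P t)) r'" for r'
    using HT.prems s that join_act[of "tcod P s" l r'] by auto
  moreover have "rok (path_dom (tdom P t)) ?r" "rok (path_dom (tdom P t)) (ract (tcod P t) r)"
    using HT.prems t act_ok(2)[of "tdom P t" r] act_ok(2)[of "tcod P t" r] by auto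
  ultimately show ?case using 1 2 by (auto intro: A.comp_hom)
qed

end

section \<open>Sliding 2-cells at disjoint positions past each other\<close>

context interpretation_data
begin

abbreviation lsh where "lsh b l \<equiv> (b \<otimes> fst l, snd l)"
abbreviation rsh where "rsh r b \<equiv> (fst r, snd r \<otimes> b)"

lemma step_sh:
  assumes "path_from P c [g] d" "b \<in> Obj (Target T)"
  shows "lok c l \<Longrightarrow> lstep g (lsh b l) = lsh b (lstep g l)"
    "rok d r \<Longrightarrow> rstep g (rsh r b) = rsh (rstep g r) b"
  using assms by (cases g; cases l; cases r; auto simp: P_simps obj_simps)+

lemma path_sh:
  assumes b: "b \<in> Obj (Target T)"
  shows "path_from P c gs d \<Longrightarrow> lok c l \<Longrightarrow> lact (ZA, gs, ZA) (lsh b l) = lsh b (lact (ZA, gs, ZA) l)"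
    "path_from P c gs d \<Longrightarrow> rok d r \<Longrightarrow> ract (ZA, gs, ZA) (rsh r b) = rsh (ract (ZA, gs, ZA) r) b"
proof (induction gs arbitrary: c l)
  case (Cons g gs)
  {
    case 1
    note p = path_from_Cons[OF 1(1)]
    show ?case
      using Cons.IH(1)[OF conjunct2[OF p] steps_ok(1)[OF conjunct1[OF p] 1(2)]]
        step_sh(1)[OF conjunct1[OF p] b 1(2)] by simp
  next
    case 2
    note p = path_from_Cons[OF 2(1)]
    show ?case
      using Cons.IH(2)[OF conjunct2[OF p] 2(2)]
        step_sh(2)[OF conjunct1[OF p] b path_acts_ok(2)[OF conjunct2[OF p] 2(2)]] by simp
  }
qed simp_all

lemma act_sh:
  assumes "is_path P p" "b \<in> Obj (Target T)"
  shows "lok (path_dom p) l \<Longrightarrow> lact p (lsh b l) = lsh b (lact p l)"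
    "rok (path_cod p) r \<Longrightarrow> ract p (rsh r b) = rsh (ract p r) b"
  using path_sh[OF assms(2)] assms(1) by (cases p; auto simp: is_path_def lact_def ract_def)+

lemma join_sh:
  assumes "lok c l" "rok c r" "b \<in> Obj (Target T)"
  shows "join c (lsh b l) r = b \<otimes> join c l r" "join c l (rsh r b) = join c l r \<otimes> b"
  using assms by (cases c; cases l; cases r; auto simp: obj_simps)+

text \<open>With a path \<open>q\<close> to the left of \<open>t\<close>, the ends are expressed at
  the left end of \<open>q\<close>. Taking all joins at one common cut makes 2-cells at different
  positions composable without rewriting.\<close>

lemma sem_hom_after:
  assumes t: "wf_tm P t" and q: "is_path P q" "path_cod q = path_dom (tdom P t)"
    and l: "lok (path_dom q) l" and r: "rok (path_cod (tdom P t)) r"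
  shows "sem t (lact q l) r \<in> hom (Target T) (join (path_dom q) l (ract q (ract (tdom P t) r)))
    (join (path_dom q) l (ract q (ract (tcod P t) r)))"
proof -
  have "rok (path_cod q) (ract (tdom P t) r)" "rok (path_cod q) (ract (tcod P t) r)"
    using act_ok(2)[of "tdom P t" r] act_ok(2)[of "tcod P t" r] wf_path[OF t] r q by auto
  then show ?thesis
    using sem_hom[OF t _ r, of "lact q l"] act_ok(1)[OF q(1) l] join_act[OF q(1) l] q(2) by simp
qed

lemma HT_homs:
  assumes "wf_tm P (HT s t)" "lok (path_dom (tdom P s)) l" "rok (path_cod (tdom P t)) r"
  shows "sem s l (ract (tdom P t) r) \<in> hom (Target T)
      (join (path_dom (tdom P s)) l (ract (tdom P s) (ract (tdom P t) r)))
      (join (path_dom (tdom P s)) l (ract (tcod P s) (ract (tdom P t) r)))"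
    "sem t (lact (tcod P s) l) r \<in> hom (Target T)
      (join (path_dom (tdom P s)) l (ract (tcod P s) (ract (tdom P t) r)))
      (join (path_dom (tdom P s)) l (ract (tcod P s) (ract (tcod P t) r)))"
    "lok (path_dom (tdom P t)) (lact (tcod P s) l)" "rok (path_cod (tdom P s)) (ract (tdom P t) r)"
proof -
  note s = wf_path[of s] and t = wf_path[of t]
  show r: "rok (path_cod (tdom P s)) (ract (tdom P t) r)"
    using act_ok(2)[of "tdom P t" r] assms t by auto
  show "lok (path_dom (tdom P t)) (lact (tcod P s) l)"
    using act_ok(1)[of "tcod P s" l] assms s by auto
  show "sem s l (ract (tdom P t) r) \<in> hom (Target T)
      (join (path_dom (tdom P s)) l (ract (tdom P s) (ract (tdom P t) r)))
      (join (path_dom (tdom P s)) l (ract (tcod P s) (ract (tdom P t) r)))"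
    using assms r by (intro sem_hom) auto
  show "sem t (lact (tcod P s) l) r \<in> hom (Target T)
      (join (path_dom (tdom P s)) l (ract (tcod P s) (ract (tdom P t) r)))
      (join (path_dom (tdom P s)) l (ract (tcod P s) (ract (tcod P t) r)))"
    using sem_hom_after[of t "tcod P s" l r] assms s by auto
qed

lemma VT_homs:
  assumes "wf_tm P (VT s t)" "lok (path_dom (tdom P s)) l" "rok (path_cod (tdom P s)) r"
  shows "sem s l r \<in> hom (Target T) (join (path_dom (tdom P s)) l (ract (tdom P s) r))
      (join (path_dom (tdom P s)) l (ract (tdom P t) r))"
    "sem t l r \<in> hom (Target T) (join (path_dom (tdom P s)) l (ract (tdom P t) r))
      (join (path_dom (tdom P s)) l (ract (tcod P t) r))"
    "lok (path_dom (tdom P t)) l" "rok (path_cod (tdom P t)) r"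
  using assms sem_hom[of s l r] sem_hom[of t l r] wf_path[of s] wf_path[of t] by auto

text \<open>The interpretation uses the outermost objects of a context only as identity tensor
  factors, so an object added at the far left splits off; \<open>sem_rsh\<close> is the mirror
  image.\<close>

lemma sem_lsh:
  assumes "wf_tm P t" "lok (path_dom (tdom P t)) l" "rok (path_cod (tdom P t)) r" "b \<in> Obj (Target T)"
  shows "sem t (lsh b l) r = idA b \<boxtimes> sem t l r"
  using assms
proof (induction t arbitrary: l r)
  case (IdT p)
  then show ?case
    using act_ok(2)[of p r] by (simp add: join_sh A.ten_id join_obj)
next
  case (GenT g)
  then have "fst l \<in> Obj (Target T)" "snd l \<in> Obj (Source T)" "fst r \<in> Obj (Source T)" "snd r \<in> Obj (Target T)"
    by (cases l; cases r; auto)+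
  moreover note core_hom[of g "snd l" "fst r", THEN homD(1)]
  ultimately show ?case using GenT by (simp add: A.ten_id[symmetric] A.arr_simps A.ten_simps)
next
  case (VT s t)
  note h = VT_homs[OF VT.prems(1), of l r]
  show ?case
    using VT h(1,2)[THEN homD(1)] h(1,2)[THEN homD(2)] h(1,2)[THEN homD(3)] h(3,4)
    by (simp add: A.ten_comp' A.arr_simps)
next
  case (HT s t)
  have p: "lok (path_dom (tdom P s)) l" "rok (path_cod (tdom P t)) r" "is_path P (tcod P s)"
    "path_dom (tcod P s) = path_dom (tdom P s)"
    using HT.prems wf_path[of s] by auto
  note h = HT_homs[OF HT.prems(1) p(1,2)]
  show ?case
    using HT h(1,2)[THEN homD(1)] h(1,2)[THEN homD(2)] h(1,2)[THEN homD(3)] h(3,4) p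
    by (simp add: A.ten_comp' A.arr_simps act_sh)
qed

lemma sem_rsh:
  assumes "wf_tm P t" "lok (path_dom (tdom P t)) l" "rok (path_cod (tdom P t)) r" "b \<in> Obj (Target T)"
  shows "sem t l (rsh r b) = sem t l r \<boxtimes> idA b"
  using assms
proof (induction t arbitrary: l r)
  case (IdT p)
  then show ?case
    using act_ok(2)[of p r] by (simp add: act_sh join_sh A.ten_id join_obj)
next
  case (GenT g)
  then have "fst l \<in> Obj (Target T)" "snd l \<in> Obj (Source T)" "fst r \<in> Obj (Source T)" "snd r \<in> Obj (Target T)"
    by (cases l; cases r; auto)+
  moreover note core_hom[of g "snd l" "fst r", THEN homD(1)]
  ultimately show ?case using GenT by (simp add: A.ten_id[symmetric] A.arr_simps A.ten_simps)
next
  case (VT s t)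
  note h = VT_homs[OF VT.prems(1), of l r]
  show ?case
    using VT h(1,2)[THEN homD(1)] h(1,2)[THEN homD(2)] h(1,2)[THEN homD(3)] h(3,4)
      wf_path[of s] wf_path[of t]
    by (simp add: A.ten_comp' A.arr_simps)
next
  case (HT s t)
  have p: "lok (path_dom (tdom P s)) l" "rok (path_cod (tdom P t)) r" "is_path P (tdom P t)"
    using HT.prems wf_path[of t] by auto
  note h = HT_homs[OF HT.prems(1) p(1,2)]
  show ?case
    using HT h(1,2)[THEN homD(1)] h(1,2)[THEN homD(2)] h(1,2)[THEN homD(3)] h(3,4) p
    by (simp add: A.ten_comp' A.arr_simps act_sh)
qed

text \<open>The path \<open>p\<close> between the two positions makes the induction over horizontal composites
  possible.\<close>

definition slides :: "(cell0, 'u gen1, 'u gen2) tm \<Rightarrow> (cell0, 'u gen1, 'u gen2) tm \<Rightarrow> 'u syn1 \<Rightarrow> bool" where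
  "slides s t p \<longleftrightarrow> (\<forall>l r. lok (path_dom (tdom P s)) l \<longrightarrow> rok (path_cod (tdom P t)) r \<longrightarrow>
     sem s l (ract p (ract (tdom P t) r)) \<Zsemi> sem t (lact p (lact (tcod P s) l)) r =
     sem t (lact p (lact (tdom P s) l)) r \<Zsemi> sem s l (ract p (ract (tcod P t) r)))"

text \<open>Cutting at \<open>ZA\<close> makes \<open>s\<close> and \<open>t\<close> separate tensor
  factors: each is evaluated in a context that is empty beyond the cut, and the other side enters as
  an identity by \<open>sem_rsh\<close> and \<open>sem_lsh\<close>.\<close>

lemma slides_through_A:
  assumes s: "wf_tm P s" and t: "wf_tm P t" and q: "is_path P q" "is_path P q'"
    and e: "path_cod (tdom P s) = path_dom q" "path_cod q = ZA" "path_dom q' = ZA"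
      "path_cod q' = path_dom (tdom P t)"
  shows "slides s t (path_comp q q')"
  unfolding slides_def
proof (intro allI impI)
  fix l r assume l: "lok (path_dom (tdom P s)) l" and r: "rok (path_cod (tdom P t)) r"
  \<comment> \<open>The empty contexts, to be placed at the cut.\<close>
  let ?e = "(unitX, unitA)" and ?e' = "(unitA, unitX)"
  have ok: "rok ZA ?e" "lok ZA ?e'" by (simp_all add: obj_simps)
  \<comment> \<open>\<open>B\<close> and \<open>B'\<close> are the values of everything to the right
    of the cut before and after \<open>t\<close> acts; \<open>D\<close> and \<open>D'\<close> are
    those of everything to its left before and after \<open>s\<close> acts.\<close>
  define B B' where "B = snd (ract q' (ract (tdom P t) r))" and "B' = snd (ract q' (ract (tcod P t) r))"
  define D D' where "D = fst (lact q (lact (tdom P s) l))" and "D' = fst (lact q (lact (tcod P s) l))"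
  have R: "rok ZA (ract q' (ract (tdom P t) r))" "rok ZA (ract q' (ract (tcod P t) r))"
    using act_ok(2)[OF q(2)] act_ok(2)[of "tdom P t" r] act_ok(2)[of "tcod P t" r] wf_path[OF t] r e by auto
  have L: "lok ZA (lact q (lact (tdom P s) l))" "lok ZA (lact q (lact (tcod P s) l))"
    using act_ok(1)[OF q(1)] act_ok(1)[of "tdom P s" l] act_ok(1)[of "tcod P s" l] wf_path[OF s] l e by auto
  have B: "ract q' (ract (tdom P t) r) = rsh ?e B" "B \<in> Obj (Target T)"
      "ract q' (ract (tcod P t) r) = rsh ?e B'" "B' \<in> Obj (Target T)"
    using R unfolding B_def B'_def by (metis rok.simps prod.collapse fst_conv snd_conv A.ten_obj_unit_left)+
  have D: "lact q (lact (tdom P s) l) = lsh D ?e'" "D \<in> Obj (Target T)"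
      "lact q (lact (tcod P s) l) = lsh D' ?e'" "D' \<in> Obj (Target T)"
    using L unfolding D_def D'_def by (metis lok.simps prod.collapse fst_conv snd_conv A.ten_obj_unit_right)+
  have se: "rok (path_cod (tdom P s)) (ract q ?e)" and te: "lok (path_dom (tdom P t)) (lact q' ?e')"
    using act_ok(2)[OF q(1), of ?e] act_ok(1)[OF q(2), of ?e'] ok e by simp_all
  let ?s = "sem s l (ract q ?e)" and ?t = "sem t (lact q' ?e') r"
  have s': "?s \<in> hom (Target T) D D'"
  proof -
    have "join (path_dom (tdom P s)) l (ract p (ract q ?e)) = fst (lact q (lact p l))"
      if "is_path P p" "path_dom p = path_dom (tdom P s)" "path_cod p = path_cod (tdom P s)" for p
    proof -
      have 1: "is_path P (path_comp p q)" using that q e by (auto intro: is_path_comp)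
      then have "lok ZA (lact q (lact p l))" using act_ok(1)[OF 1, of l] that e l by simp
      then have "join ZA (lact q (lact p l)) ?e = fst (lact q (lact p l))"
        by (cases "lact q (lact p l)") (auto simp: obj_simps)
      then show ?thesis using join_act[OF 1, of l ?e] that e l ok by simp
    qed
    then show ?thesis using sem_hom[OF s l se] wf_path[OF s] by (simp add: D_def D'_def)
  qed
  have t': "?t \<in> hom (Target T) B B'"
  proof -
    have "join ZA ?e' (ract q' (ract (tdom P t) r)) = B" "join ZA ?e' (ract q' (ract (tcod P t) r)) = B'"
      using B by (simp_all add: obj_simps)
    then show ?thesis using sem_hom_after[OF t q(2) e(4), of ?e' r] e ok r by simp
  qed
  have "sem s l (ract q (rsh ?e B)) = ?s \<boxtimes> idA B" "sem s l (ract q (rsh ?e B')) = ?s \<boxtimes> idA B'"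
    using act_sh(2)[OF q(1), of _ ?e] sem_rsh[OF s l se] B ok e by simp_all
  moreover have "sem t (lact q' (lsh D ?e')) r = idA D \<boxtimes> ?t" "sem t (lact q' (lsh D' ?e')) r = idA D' \<boxtimes> ?t"
    using act_sh(1)[OF q(2), of _ ?e'] sem_lsh[OF t te r] D ok e by simp_all
  ultimately show "sem s l (ract (path_comp q q') (ract (tdom P t) r)) \<Zsemi>
      sem t (lact (path_comp q q') (lact (tcod P s) l)) r =
     sem t (lact (path_comp q q') (lact (tdom P s) l)) r \<Zsemi>
      sem s l (ract (path_comp q q') (ract (tcod P t) r))"
    using A.slide_ten[OF s' t'] by (simp only: act_simps B(1,3) D(1,3))
qed

text \<open>\<open>J a b\<close> is the object denoted while the first position carries
  \<open>a\<close> and the second carries \<open>b\<close>; the four arrows are the sides of the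
  square that \<open>slides\<close> asserts to commute.\<close>

lemma slide_homs:
  assumes s: "wf_tm P s" and t: "wf_tm P t" and p: "is_path P p" "path_cod (tdom P s) = path_dom p"
      "path_cod p = path_dom (tdom P t)"
    and l: "lok (path_dom (tdom P s)) l" and r: "rok (path_cod (tdom P t)) r"
  defines "J \<equiv> \<lambda>a b. join (path_dom (tdom P s)) l (ract a (ract p (ract b r)))"
  shows "sem s l (ract p (ract (tdom P t) r)) \<in> hom (Target T)
      (J (tdom P s) (tdom P t)) (J (tcod P s) (tdom P t))"
    "sem s l (ract p (ract (tcod P t) r)) \<in> hom (Target T)
      (J (tdom P s) (tcod P t)) (J (tcod P s) (tcod P t))"
    "sem t (lact p (lact (tdom P s) l)) r \<in> hom (Target T)
      (J (tdom P s) (tdom P t)) (J (tdom P s) (tcod P t))"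
    "sem t (lact p (lact (tcod P s) l)) r \<in> hom (Target T)
      (J (tcod P s) (tdom P t)) (J (tcod P s) (tcod P t))"
proof -
  note ws = wf_path[OF s] and wt = wf_path[OF t]
  have "rok (path_dom p) (ract p (ract (tdom P t) r))" "rok (path_dom p) (ract p (ract (tcod P t) r))"
    using act_ok(2)[OF p(1)] act_ok(2)[of "tdom P t" r] act_ok(2)[of "tcod P t" r] wt r p by auto
  then show "sem s l (ract p (ract (tdom P t) r)) \<in> hom (Target T)
      (J (tdom P s) (tdom P t)) (J (tcod P s) (tdom P t))"
    "sem s l (ract p (ract (tcod P t) r)) \<in> hom (Target T)
      (J (tdom P s) (tcod P t)) (J (tcod P s) (tcod P t))"
    using sem_hom[OF s l] p unfolding J_def by auto
  have "is_path P (path_comp (tdom P s) p)" "is_path P (path_comp (tcod P s) p)"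
    using ws p by (auto intro: is_path_comp)
  then show "sem t (lact p (lact (tdom P s) l)) r \<in> hom (Target T)
      (J (tdom P s) (tdom P t)) (J (tdom P s) (tcod P t))"
    "sem t (lact p (lact (tcod P s) l)) r \<in> hom (Target T)
      (J (tcod P s) (tdom P t)) (J (tcod P s) (tcod P t))"
    using sem_hom_after[OF t, of "path_comp (tdom P s) p" l r]
      sem_hom_after[OF t, of "path_comp (tcod P s) p" l r] p ws l r unfolding J_def by auto
qed

lemma slides_IdT_left: "is_path P p \<Longrightarrow> wf_tm P (IdT q) \<Longrightarrow> wf_tm P t \<Longrightarrow>
    path_cod q = path_dom p \<Longrightarrow> path_cod p = path_dom (tdom P t) \<Longrightarrow> slides (IdT q) t p"
  unfolding slides_def
proof (intro allI impI)
  fix l r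
  assume p: "is_path P p" "wf_tm P (IdT q)" "wf_tm P t" "path_cod q = path_dom p"
    "path_cod p = path_dom (tdom P t)"
    and l: "lok (path_dom (tdom P (IdT q))) l" and r: "rok (path_cod (tdom P t)) r"
  note h = slide_homs[OF p(2,3,1) _ p(5) l r]
  show "sem (IdT q) l (ract p (ract (tdom P t) r)) \<Zsemi> sem t (lact p (lact (tcod P (IdT q)) l)) r =
     sem t (lact p (lact (tdom P (IdT q)) l)) r \<Zsemi> sem (IdT q) l (ract p (ract (tcod P t) r))"
    using A.id_left[OF h(3)] A.id_right[OF h(3)] p by simp
qed

lemma slides_IdT_right: "is_path P p \<Longrightarrow> wf_tm P (IdT q) \<Longrightarrow> wf_tm P s \<Longrightarrow>
    path_cod (tdom P s) = path_dom p \<Longrightarrow> path_cod p = path_dom q \<Longrightarrow> slides s (IdT q) p"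
  unfolding slides_def
proof (intro allI impI)
  fix l r
  assume p: "is_path P p" "wf_tm P (IdT q)" "wf_tm P s" "path_cod (tdom P s) = path_dom p"
    "path_cod p = path_dom q"
    and l: "lok (path_dom (tdom P s)) l" and r: "rok (path_cod (tdom P (IdT q))) r"
  note h = slide_homs[OF p(3,2,1) p(4) _ l r]
  have "join (path_dom q) (lact p (lact (tcod P s) l)) (ract q r) =
      join (path_dom (tdom P s)) l (ract (tcod P s) (ract p (ract q r)))"
    "join (path_dom q) (lact p (lact (tdom P s) l)) (ract q r) =
      join (path_dom (tdom P s)) l (ract (tdom P s) (ract p (ract q r)))"
    using join_act[of "path_comp (tcod P s) p" l "ract q r"] join_act[of "path_comp (tdom P s) p" l "ract q r"]
      p wf_path[OF p(3)] l r act_ok(2)[of q r] by (auto simp: is_path_comp)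
  then show "sem s l (ract p (ract (tdom P (IdT q)) r)) \<Zsemi> sem (IdT q) (lact p (lact (tcod P s) l)) r =
     sem (IdT q) (lact p (lact (tdom P s) l)) r \<Zsemi> sem s l (ract p (ract (tcod P (IdT q)) r))"
    using A.id_left[OF h(1)] A.id_right[OF h(1)] p by simp
qed

text \<open>The squares for \<open>s\<close> and \<open>s'\<close> are pasted along the side where
  \<open>t\<close> acts between them.\<close>

lemma slides_VT_left:
  assumes s: "wf_tm P (VT s s')" and t: "wf_tm P t" and p: "is_path P p" "path_cod (tdom P s) = path_dom p"
      "path_cod p = path_dom (tdom P t)"
    and 1: "slides s t p" and 2: "slides s' t p"
  shows "slides (VT s s') t p"
  unfolding slides_def
proof (intro allI impI)
  fix l r
  assume l: "lok (path_dom (tdom P (VT s s'))) l" and r: "rok (path_cod (tdom P t)) r"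
  have w: "wf_tm P s" "wf_tm P s'" "tcod P s = tdom P s'" "path_dom (tdom P s) = path_dom (tdom P s')"
    "path_cod (tdom P s) = path_cod (tdom P s')"
    using s wf_path[of s] wf_path[of s'] by auto
  have l': "lok (path_dom (tdom P s)) l" "lok (path_dom (tdom P s')) l" using l w by auto
  note h = slide_homs[OF w(1) t p l'(1) r, unfolded w(3,4)]
  note h' = slide_homs[OF w(2) t p(1) p(2)[unfolded w(5)] p(3) l'(2) r]
  let ?R = "ract p (ract (tdom P t) r)" and ?R' = "ract p (ract (tcod P t) r)"
  let ?L = "\<lambda>q. sem t (lact p (lact q l)) r"
  have "sem (VT s s') l ?R \<Zsemi> ?L (tcod P s') = sem s l ?R \<Zsemi> (sem s' l ?R \<Zsemi> ?L (tcod P s'))"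
    using A.comp_assoc[OF h(1) h'(1) h'(4)] w p by simp
  also have "\<dots> = sem s l ?R \<Zsemi> (?L (tcod P s) \<Zsemi> sem s' l ?R')"
    using 2 l' r w by (simp add: slides_def)
  also have "\<dots> = (sem s l ?R \<Zsemi> ?L (tcod P s)) \<Zsemi> sem s' l ?R'"
    using A.comp_assoc[OF h(1) h(4) h'(2)] w p by simp
  also have "\<dots> = (?L (tdom P s) \<Zsemi> sem s l ?R') \<Zsemi> sem s' l ?R'"
    using 1 l' r w by (simp add: slides_def)
  also have "\<dots> = ?L (tdom P s) \<Zsemi> sem (VT s s') l ?R'"
    using A.comp_assoc[OF h(3) h(2) h'(2)] w p by simp
  finally show "sem (VT s s') l ?R \<Zsemi> ?L (tcod P (VT s s')) =
      ?L (tdom P (VT s s')) \<Zsemi> sem (VT s s') l ?R'" by simp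
qed

lemma slides_VT_right:
  assumes s: "wf_tm P s" and t: "wf_tm P (VT t t')" and p: "is_path P p" "path_cod (tdom P s) = path_dom p"
      "path_cod p = path_dom (tdom P t)"
    and 1: "slides s t p" and 2: "slides s t' p"
  shows "slides s (VT t t') p"
  unfolding slides_def
proof (intro allI impI)
  fix l r
  assume l: "lok (path_dom (tdom P s)) l" and r: "rok (path_cod (tdom P (VT t t'))) r"
  have w: "wf_tm P t" "wf_tm P t'" "tcod P t = tdom P t'" "path_dom (tdom P t) = path_dom (tdom P t')"
    "path_cod (tdom P t) = path_cod (tdom P t')"
    using t wf_path[of t] wf_path[of t'] by auto
  have r': "rok (path_cod (tdom P t)) r" "rok (path_cod (tdom P t')) r" using r w by auto
  note h = slide_homs[OF s w(1) p l r'(1)]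
  note h' = slide_homs[OF s w(2) p(1,2) _ l r'(2)]
  let ?R = "\<lambda>q. sem s l (ract p (ract q r))"
  let ?L = "lact p (lact (tcod P s) l)" and ?L' = "lact p (lact (tdom P s) l)"
  have "?R (tdom P t) \<Zsemi> sem (VT t t') ?L r = (?R (tdom P t) \<Zsemi> sem t ?L r) \<Zsemi> sem t' ?L r"
    using A.comp_assoc[OF h(1) h(4) h'(4)[folded w(3)]] w p by simp
  also have "\<dots> = (sem t ?L' r \<Zsemi> ?R (tcod P t)) \<Zsemi> sem t' ?L r"
    using 1 l r' w by (simp add: slides_def)
  also have "\<dots> = sem t ?L' r \<Zsemi> (?R (tcod P t) \<Zsemi> sem t' ?L r)"
    using A.comp_assoc[OF h(3) h(2) h'(4)[folded w(3)]] w p by simp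
  also have "\<dots> = sem t ?L' r \<Zsemi> (sem t' ?L' r \<Zsemi> ?R (tcod P t'))"
    using 2 l r' w by (simp add: slides_def)
  also have "\<dots> = sem (VT t t') ?L' r \<Zsemi> ?R (tcod P t')"
    using A.comp_assoc[OF h(3) h'(3)[folded w(3)] h'(2)] w p by simp
  finally show "?R (tdom P (VT t t')) \<Zsemi> sem (VT t t') ?L r =
      sem (VT t t') ?L' r \<Zsemi> ?R (tcod P (VT t t'))" by simp
qed

text \<open>In the interpretation of \<open>HT s s'\<close> the left factor acts first, so while
  \<open>s\<close> slides past \<open>t\<close> the path between them still shows the domain of
  \<open>s'\<close>.\<close>

lemma slides_HT_left:
  assumes s: "wf_tm P (HT s s')" and t: "wf_tm P t" and p: "is_path P p" "path_cod (tdom P s') = path_dom p"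
      "path_cod p = path_dom (tdom P t)"
    and 1: "slides s t (path_comp (tdom P s') p)" and 2: "slides s' t p"
  shows "slides (HT s s') t p"
  unfolding slides_def
proof (intro allI impI)
  fix l r
  assume "lok (path_dom (tdom P (HT s s'))) l" and r: "rok (path_cod (tdom P t)) r"
  then have l: "lok (path_dom (tdom P s)) l" by simp
  have w: "wf_tm P s" "wf_tm P s'" "path_cod (tdom P s) = path_dom (tdom P s')" using s by auto
  note ws = wf_path[OF w(1)] and ws' = wf_path[OF w(2)] and wt = wf_path[OF t]
  have q: "is_path P (path_comp (tdom P s') p)" using ws' p by (auto intro: is_path_comp)
  note h = slide_homs[OF w(1) t q _ _ l r]
  have l': "lok (path_dom (tdom P s')) (lact (tcod P s) l)" using act_ok(1)[of "tcod P s" l] ws l w by auto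
  let ?R = "ract p (ract (tdom P t) r)" and ?R' = "ract p (ract (tcod P t) r)"
  let ?L = "\<lambda>q q'. sem t (lact p (lact q' (lact q l))) r"
  let ?s = "\<lambda>R. sem s l (ract (tdom P s') R)" and ?s' = "\<lambda>R. sem s' (lact (tcod P s) l) R"
  have R: "rok (path_cod (tdom P s')) ?R" "rok (path_cod (tdom P s')) ?R'"
    using act_ok(2)[OF p(1)] act_ok(2)[of "tdom P t" r] act_ok(2)[of "tcod P t" r] wt r p by auto
  note g = HT_homs[OF s l R(1)] and g' = HT_homs[OF s l R(2)]
  have "is_path P (path_comp (tcod P s) (path_comp (tcod P s') p))"
    "is_path P (path_comp (tcod P s) (path_comp (tdom P s') p))"
    using ws ws' w p by (auto intro!: is_path_comp)
  then have k: "?L (tcod P s) (tcod P s') \<in> hom (Target T)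
        (join (path_dom (tdom P s)) l (ract (tcod P s) (ract (tcod P s') ?R)))
        (join (path_dom (tdom P s)) l (ract (tcod P s) (ract (tcod P s') ?R')))"
    "?L (tcod P s) (tdom P s') \<in> hom (Target T)
        (join (path_dom (tdom P s)) l (ract (tcod P s) (ract (tdom P s') ?R)))
        (join (path_dom (tdom P s)) l (ract (tcod P s) (ract (tdom P s') ?R')))"
    using sem_hom_after[OF t, of "path_comp (tcod P s) (path_comp (tcod P s') p)" l r]
      sem_hom_after[OF t, of "path_comp (tcod P s) (path_comp (tdom P s') p)" l r] ws l p r by auto
  have "(?s ?R \<Zsemi> ?s' ?R) \<Zsemi> ?L (tcod P s) (tcod P s') = ?s ?R \<Zsemi> (?s' ?R \<Zsemi> ?L (tcod P s) (tcod P s'))"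
    using A.comp_assoc[OF g(1,2) k(1)] .
  also have "\<dots> = ?s ?R \<Zsemi> (?L (tcod P s) (tdom P s') \<Zsemi> ?s' ?R')"
    using 2 l' r by (simp add: slides_def)
  also have "\<dots> = (?s ?R \<Zsemi> ?L (tcod P s) (tdom P s')) \<Zsemi> ?s' ?R'"
    using A.comp_assoc[OF g(1) k(2) g'(2)] by simp
  also have "\<dots> = (?L (tdom P s) (tdom P s') \<Zsemi> ?s ?R') \<Zsemi> ?s' ?R'"
    using 1 l r by (simp add: slides_def)
  also have "\<dots> = ?L (tdom P s) (tdom P s') \<Zsemi> (?s ?R' \<Zsemi> ?s' ?R')"
    using A.comp_assoc[OF h(3) _ g'(2)] g'(1) w p by simp
  finally show "sem (HT s s') l ?R \<Zsemi> sem t (lact p (lact (tcod P (HT s s')) l)) r =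
      sem t (lact p (lact (tdom P (HT s s')) l)) r \<Zsemi> sem (HT s s') l ?R'" by simp
qed

text \<open>Here \<open>t'\<close> acts after \<open>t\<close>, so the path between \<open>s\<close>
  and \<open>t'\<close> already shows the codomain of \<open>t\<close>.\<close>

lemma slides_HT_right:
  assumes s: "wf_tm P s" and t: "wf_tm P (HT t t')" and p: "is_path P p" "path_cod (tdom P s) = path_dom p"
      "path_cod p = path_dom (tdom P t)"
    and 1: "slides s t p" and 2: "slides s t' (path_comp p (tcod P t))"
  shows "slides s (HT t t') p"
  unfolding slides_def
proof (intro allI impI)
  fix l r
  assume l: "lok (path_dom (tdom P s)) l" and "rok (path_cod (tdom P (HT t t'))) r"
  then have r: "rok (path_cod (tdom P t')) r" by simp
  have w: "wf_tm P t" "wf_tm P t'" "path_cod (tdom P t) = path_dom (tdom P t')" using t by auto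
  note wt = wf_path[OF w(1)] and wt' = wf_path[OF w(2)] and ws = wf_path[OF s]
  have q: "is_path P (path_comp p (tcod P t))" using wt p by (auto intro: is_path_comp)
  have r': "rok (path_cod (tdom P t)) (ract (tdom P t') r)"
    using act_ok(2)[of "tdom P t'" r] wt' r w by auto
  have r'': "rok (path_cod (tdom P t)) (ract (tcod P t') r)"
    using act_ok(2)[of "tcod P t'" r] wt' r w by auto
  note h = slide_homs[OF s w(1) p l r'] and h'' = slide_homs[OF s w(1) p l r'']
  note h' = slide_homs[OF s w(2) q _ _ l r]
  let ?L = "lact p (lact (tcod P s) l)" and ?L' = "lact p (lact (tdom P s) l)"
  let ?R = "\<lambda>q q'. sem s l (ract p (ract q (ract q' r)))"
  let ?t = "\<lambda>L. sem t L (ract (tdom P t') r)" and ?t' = "\<lambda>L. sem t' (lact (tcod P t) L) r"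
  have h1: "?R (tcod P t) (tdom P t') \<Zsemi> ?t' ?L = ?t' ?L' \<Zsemi> ?R (tcod P t) (tcod P t')"
    using 2 l r by (simp add: slides_def)
  have h2: "?R (tdom P t) (tdom P t') \<Zsemi> ?t ?L = ?t ?L' \<Zsemi> ?R (tcod P t) (tdom P t')"
    using 1 l r' by (simp add: slides_def)
  have k: "?t' ?L \<in> hom (Target T)
      (join (path_dom (tdom P s)) l (ract (tcod P s) (ract p (ract (tcod P t) (ract (tdom P t') r)))))
      (join (path_dom (tdom P s)) l (ract (tcod P s) (ract p (ract (tcod P t) (ract (tcod P t') r)))))"
    "?t' ?L' \<in> hom (Target T)
      (join (path_dom (tdom P s)) l (ract (tdom P s) (ract p (ract (tcod P t) (ract (tdom P t') r)))))
      (join (path_dom (tdom P s)) l (ract (tdom P s) (ract p (ract (tcod P t) (ract (tcod P t') r)))))"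
    using h'(3,4) p w wt by simp_all
  have "?R (tdom P t) (tdom P t') \<Zsemi> (?t ?L \<Zsemi> ?t' ?L) = (?t ?L' \<Zsemi> ?R (tcod P t) (tdom P t')) \<Zsemi> ?t' ?L"
    using A.comp_assoc[OF h(1) h(4) k(1)] h2 by simp
  also have "\<dots> = ?t ?L' \<Zsemi> (?t' ?L' \<Zsemi> ?R (tcod P t) (tcod P t'))"
    using A.comp_assoc[OF h(3) h(2) k(1)] h1 by simp
  also have "\<dots> = (?t ?L' \<Zsemi> ?t' ?L') \<Zsemi> ?R (tcod P t) (tcod P t')"
    using A.comp_assoc[OF h(3) k(2) h''(2)] by simp
  finally show "sem s l (ract p (ract (tdom P (HT t t')) r)) \<Zsemi> sem (HT t t') ?L r =
      sem (HT t t') ?L' r \<Zsemi> sem s l (ract p (ract (tcod P (HT t t')) r))" by simp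
qed

lemma tensor_between:
  assumes "a \<in> Obj (Target T)" "b \<in> Obj (Target T)" "f \<in> hom (Target T) c d" "g \<in> hom (Target T) d e"
  shows "(idA a \<boxtimes> f \<boxtimes> idA b) \<Zsemi> (idA a \<boxtimes> g \<boxtimes> idA b) = idA a \<boxtimes> (f \<Zsemi> g) \<boxtimes> idA b"
  using assms(1,2) homD[OF assms(3)] homD[OF assms(4)]
  by (simp add: A.ten_comp' A.arr_simps A.ten_arr)

lemma F_comp:
  assumes "f \<in> Arr (Source T)" "g \<in> Arr (Source T)" "Cod (Source T) f = Dom (Source T) g"
  shows "Fm f \<Zsemi> Fm g = Fm (f ;;\<^bsub>Source T\<^esub> g)"
  using assms by (intro F.map_comp[symmetric]) (auto simp: hom_def)

lemma mu_arr:
  assumes "x \<in> Obj (Source T)" "y \<in> Obj (Source T)"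
  shows "mu T x y \<in> Arr (Target T)" "Dom (Target T) (mu T x y) = Fo x \<otimes> Fo y"
    "Cod (Target T) (mu T x y) = Fo (x \<odot> y)"
  using homD[OF mu_hom[OF assms]] by auto

text \<open>No 0-cell \<open>ZA\<close> separates the two generators, so they act in the same box.\<close>

lemma slides_in_box:
  assumes g: "g \<in> Gens2 P" "path_cod (gen2_dom g) = ZX" and g': "g' \<in> Gens2 P" "path_dom (gen2_dom g') = ZX"
    and ys: "ys \<in> lists (XObj S)"
  shows "slides (GenT g) (GenT g') (xpath ys)"
  unfolding slides_def
proof (intro allI impI)
  fix l r
  assume l: "lok (path_dom (tdom P (GenT g))) l" and r: "rok (path_cod (tdom P (GenT g'))) r"
  obtain a x x' a' where lr: "l = (a, x)" "r = (x', a')" by (cases l; cases r)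
  \<comment> \<open>The content of the box between the two generators; \<open>x\<close> and
    \<open>x'\<close> are the contents outside of them, and \<open>a\<close> and \<open>a'\<close>
    lie outside the box.\<close>
  define y where "y = tens (Source T) (map k ys)"
  have d: "path_dom (gen2_dom g) = ZX" "path_cod (gen2_dom g') = ZX"
    using g g' by (cases g; cases g'; simp)+
  have o: "a \<in> Obj (Target T)" "x \<in> Obj (Source T)" "x' \<in> Obj (Source T)" "a' \<in> Obj (Target T)"
    "y \<in> Obj (Source T)"
    using l r lr map_objs(2)[OF ys] by (auto simp: y_def X.tens_obj P_simps)
  have acts: "lact (xpath ys) (b, z) = (b, z \<odot> y)" "ract (xpath ys) (z, b) = (y \<odot> z, b)"
    if "b \<in> Obj (Target T)" "z \<in> Obj (Source T)" for b z
    using that ys by (simp_all add: xpath_def act_GX y_def)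
  have f: "us \<in> lists (XObj S) \<and> vs \<in> lists (XObj S) \<and> fb us vs e \<in> Arr (Source T) \<and>
      Dom (Source T) (fb us vs e) = tens (Source T) (map k us) \<and>
      Cod (Source T) (fb us vs e) = tens (Source T) (map k vs) \<and>
      tens (Source T) (map k us) \<in> Obj (Source T) \<and> tens (Source T) (map k vs) \<in> Obj (Source T)"
    if "e \<in> FBox S us vs" for us vs e
    using fb[OF that] fsig_listsD(2)[OF fsig that] map_objs(2) by (auto simp: hom_def X.tens_obj)
  note simps = X.arr_simps A.arr_simps X.ten_simps A.ten_simps F.map_simps o
  show "sem (GenT g) l (ract (xpath ys) (ract (tdom P (GenT g')) r)) \<Zsemi>
      sem (GenT g') (lact (xpath ys) (lact (tcod P (GenT g)) l)) r =
     sem (GenT g') (lact (xpath ys) (lact (tdom P (GenT g)) l)) r \<Zsemi>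
      sem (GenT g) l (ract (xpath ys) (ract (tcod P (GenT g')) r))"
  proof (cases g; cases g')
    fix us vs e us' vs' e'
    assume gg: "g = FBoxG us vs e" "g' = FBoxG us' vs' e'"
    then have e: "e \<in> FBox S us vs" "e' \<in> FBox S us' vs'" using g g' by (auto simp: Gens2_P)
    note f = f[OF e(1)] f[OF e(2)]
    show ?thesis
      using f unfolding gg lr
      by (simp add: P_simps xpath_def[of us] xpath_def[of vs] xpath_def[of us'] xpath_def[of vs'] act_GX acts
          A.ten_comp' X.ten_comp' F_comp simps X.ten_id[symmetric] del: in_lists_conv_set)
  next
    fix us vs e
    assume gg: "g = FBoxG us vs e" "g' = Counit"
    then have e: "e \<in> FBox S us vs" using g by (auto simp: Gens2_P)
    note f = f[OF e(1)]
    let ?f = "idX x \<boxdot> fb us vs e \<boxdot> idX y"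
    let ?D = "x \<odot> tens (Source T) (map k us) \<odot> y" and ?C = "x \<odot> tens (Source T) (map k vs) \<odot> y"
    have F: "?f \<in> hom (Source T) ?D ?C" using f by (intro homI) (simp_all add: simps)
    \<comment> \<open>Naturality of \<open>mu\<close> with an identity as second argument; the next
      step tensors the square with the objects outside the box.\<close>
    have "(Fm ?f \<boxtimes> idA (Fo x')) \<Zsemi> mu T ?C x' = mu T ?D x' \<Zsemi> Fm (?f \<boxdot> idX x')"
      using mu_natural[OF F X.id_hom[OF o(3)]] by (simp add: simps)
    then have "(idA a \<boxtimes> (Fm ?f \<boxtimes> idA (Fo x')) \<boxtimes> idA a') \<Zsemi> (idA a \<boxtimes> mu T ?C x' \<boxtimes> idA a') =
        (idA a \<boxtimes> mu T ?D x' \<boxtimes> idA a') \<Zsemi> (idA a \<boxtimes> Fm (?f \<boxdot> idX x') \<boxtimes> idA a')"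
      using tensor_between[OF o(1,4) A.ten_hom[OF F.map_hom[OF F] A.id_hom[OF F.map_obj[OF o(3)]]] mu_hom]
        tensor_between[OF o(1,4) mu_hom F.map_hom[OF X.ten_hom[OF F X.id_hom[OF o(3)]]]]
        X.hom_obj[OF F] o by simp
    then show ?thesis
      using f unfolding gg lr
      by (simp add: P_simps xpath_def[of us] xpath_def[of vs] act_GX acts
          simps X.ten_id[symmetric] A.ten_id[symmetric] del: in_lists_conv_set)
  next
    fix us vs e
    assume gg: "g = Counit" "g' = FBoxG us vs e"
    then have e: "e \<in> FBox S us vs" using g' by (auto simp: Gens2_P)
    note f = f[OF e(1)]
    let ?f = "idX y \<boxdot> fb us vs e \<boxdot> idX x'"
    let ?D = "y \<odot> tens (Source T) (map k us) \<odot> x'" and ?C = "y \<odot> tens (Source T) (map k vs) \<odot> x'"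
    have F: "?f \<in> hom (Source T) ?D ?C" using f by (intro homI) (simp_all add: simps)
    have "(idA (Fo x) \<boxtimes> Fm ?f) \<Zsemi> mu T x ?C = mu T x ?D \<Zsemi> Fm (idX x \<boxdot> ?f)"
      using mu_natural[OF X.id_hom[OF o(2)] F] by (simp add: simps)
    then have "(idA a \<boxtimes> (idA (Fo x) \<boxtimes> Fm ?f) \<boxtimes> idA a') \<Zsemi> (idA a \<boxtimes> mu T x ?C \<boxtimes> idA a') =
        (idA a \<boxtimes> mu T x ?D \<boxtimes> idA a') \<Zsemi> (idA a \<boxtimes> Fm (idX x \<boxdot> ?f) \<boxtimes> idA a')"
      using tensor_between[OF o(1,4) A.ten_hom[OF A.id_hom[OF F.map_obj[OF o(2)]] F.map_hom[OF F]] mu_hom]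
        tensor_between[OF o(1,4) mu_hom F.map_hom[OF X.ten_hom[OF X.id_hom[OF o(2)] F]]]
        X.hom_obj[OF F] o by simp
    then show ?thesis
      using f unfolding gg lr
      by (simp add: P_simps xpath_def[of us] xpath_def[of vs] act_GX acts
          simps X.ten_id[symmetric] A.ten_id[symmetric] del: in_lists_conv_set)
  next
    assume gg: "g = Counit" "g' = Counit"
    \<comment> \<open>Two counits close and reopen the box twice, which leaves three adjacent boxes
      with contents \<open>x\<close>, \<open>y\<close> and \<open>x'\<close> to be merged in either
      order.\<close>
    have "(mu T x y \<boxtimes> idA (Fo x')) \<Zsemi> mu T (x \<odot> y) x' = (idA (Fo x) \<boxtimes> mu T y x') \<Zsemi> mu T x (y \<odot> x')"
      using mu_assoc o by simp
    then have "(idA a \<boxtimes> (mu T x y \<boxtimes> idA (Fo x')) \<boxtimes> idA a') \<Zsemi> (idA a \<boxtimes> mu T (x \<odot> y) x' \<boxtimes> idA a') =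
        (idA a \<boxtimes> (idA (Fo x) \<boxtimes> mu T y x') \<boxtimes> idA a') \<Zsemi> (idA a \<boxtimes> mu T x (y \<odot> x') \<boxtimes> idA a')"
      using tensor_between[OF o(1,4) A.ten_hom[OF mu_hom[OF o(2,5)] A.id_hom[OF F.map_obj[OF o(3)]]] mu_hom]
        tensor_between[OF o(1,4) A.ten_hom[OF A.id_hom[OF F.map_obj[OF o(2)]] mu_hom[OF o(5,3)]] mu_hom]
        X.ten_obj X.ten_obj_assoc o by simp
    then show ?thesis
      unfolding gg lr
      by (simp add: P_simps acts simps mu_arr A.ten_id[symmetric])
  qed (use g g' in simp_all)
qed

text \<open>If the path between the generators meets \<open>ZA\<close>, it is cut there: at its
  start if it starts at \<open>ZA\<close>, otherwise behind its first \<open>Down\<close>. If it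
  never meets \<open>ZA\<close>, it consists of box content only.\<close>

lemma slides_gen:
  assumes g: "g \<in> Gens2 P" "g' \<in> Gens2 P"
    and p: "is_path P p" "path_cod (gen2_dom g) = path_dom p" "path_cod p = path_dom (gen2_dom g')"
  shows "slides (GenT g) (GenT g') p"
proof -
  have w: "wf_tm P (GenT g)" "wf_tm P (GenT g')" using g by auto
  have z: "is_path P (ZA, [], ZA)" by (rule is_path_empty[OF Gens0_P])
  obtain c gs d where pe: "p = (c, gs, d)" by (cases p)
  show ?thesis
  proof (cases c)
    case ZA
    then show ?thesis
      using slides_through_A[OF w z p(1)] p(2,3) pe path_comp_unit(1)[of p ZA] by (simp add: P_simps)
  next
    case ZX
    with p pe have "path_from P ZX gs d" by (simp add: is_path_def)
    then obtain xs where xs: "xs \<in> lists (XObj S)" and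
      "(d = ZX \<and> gs = map GX xs) \<or> (\<exists>gs'. gs = map GX xs @ Down # gs' \<and> path_from P ZA gs' d)"
      using path_from_ZX_cases by blast
    then consider "p = xpath xs" | gs' where "p = path_comp (path_comp (xpath xs) down_path) (ZA, gs', d)"
        "path_from P ZA gs' d"
      using pe ZX by (auto simp: xpath_def)
    then show ?thesis
    proof cases
      case 1
      then show ?thesis using slides_in_box[OF g(1) _ g(2) _ xs] p by simp
    next
      case 2
      have "is_path P (path_comp (xpath xs) down_path)"
        by (intro is_path_comp is_path_xpath is_path_down xs) simp
      then show ?thesis
        using slides_through_A[OF w _ _, of "path_comp (xpath xs) down_path" "(ZA, gs', d)"] 2 p pe ZX
        by (simp add: P_simps is_path_def)
    qed
  qed
qed

lemma slides_gen_left: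
  assumes g: "g \<in> Gens2 P" and t: "wf_tm P t"
    and p: "is_path P p" "path_cod (gen2_dom g) = path_dom p" "path_cod p = path_dom (tdom P t)"
  shows "slides (GenT g) t p"
  using t p
proof (induction t arbitrary: p)
  case (IdT q)
  then show ?case using g by (intro slides_IdT_right) (auto simp: P_simps)
next
  case (GenT g')
  then show ?case using slides_gen[OF g] by (simp add: P_simps)
next
  case (VT t t')
  then have "slides (GenT g) t p" "slides (GenT g) t' p"
    using wf_path[of t] wf_path[of t'] by auto
  then show ?case using VT.prems g by (intro slides_VT_right) (auto simp: P_simps)
next
  case (HT t t')
  have 1: "is_path P (path_comp p (tcod P t))" "path_cod (path_comp p (tcod P t)) = path_dom (tdom P t')"
    using HT.prems wf_path[of t] by (auto intro: is_path_comp)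
  have "slides (GenT g) t p" "slides (GenT g) t' (path_comp p (tcod P t))"
    using HT.prems 1 by (auto intro!: HT.IH)
  then show ?case using HT.prems g by (intro slides_HT_right) (auto simp: P_simps)
qed

text \<open>Sliding for arbitrary terms comes from two successive inductions:
  \<open>slides_gen_left\<close> decomposes the right term against a generator, and this one
  decomposes the left term.\<close>

lemma slides:
  assumes s: "wf_tm P s" and t: "wf_tm P t"
    and p: "is_path P p" "path_cod (tdom P s) = path_dom p" "path_cod p = path_dom (tdom P t)"
  shows "slides s t p"
  using s p
proof (induction s arbitrary: p)
  case (IdT q)
  then show ?case using t by (intro slides_IdT_left) auto
next
  case (GenT g)
  then show ?case using slides_gen_left[OF _ t] by (simp add: P_simps)
next
  case (VT s s')
  have "path_cod (tdom P s) = path_cod (tdom P s')"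
    using VT.prems wf_path[of s] wf_path[of s'] by auto
  then show ?case using VT t by (intro slides_VT_left) auto
next
  case (HT s s')
  have 1: "is_path P (path_comp (tdom P s') p)"
    using HT.prems wf_path[of s'] by (auto intro: is_path_comp)
  have "slides s t (path_comp (tdom P s') p)" "slides s' t p"
    using HT.prems 1 by (auto intro!: HT.IH)
  then show ?case using HT.prems t by (intro slides_HT_left) auto
qed

section \<open>Soundness of the interpretation\<close>

lemma sem_up:
  assumes "lok ZA l" "rok ZX r"
  shows "sem (VT (HT (GenT Eta) (IdT up_path)) (HT (IdT up_path) (GenT Counit))) l r = sem (IdT up_path) l r"
proof -
  obtain a x' a' where lr: "l = (a, unitX)" "r = (x', a')" and o: "a \<in> Obj (Target T)" "x' \<in> Obj (Source T)"
    "a' \<in> Obj (Target T)" using assms by (cases l; cases r; simp)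
  have e: "eps T \<in> Arr (Target T)" "Dom (Target T) (eps T) = unitA" "Cod (Target T) (eps T) = Fo unitX"
    using homD[OF eps_hom] by auto
  note simps = X.arr_simps A.arr_simps X.ten_simps A.ten_simps F.map_simps o e mu_arr
  \<comment> \<open>The context supplies the content \<open>x'\<close> of the box opened by
    \<open>Up\<close>; the unit puts an empty box in front of it and the counit merges the
    two.\<close>
  have "(idA a \<boxtimes> (eps T \<boxtimes> idA (Fo x')) \<boxtimes> idA a') \<Zsemi> (idA a \<boxtimes> mu T unitX x' \<boxtimes> idA a') =
      idA a \<boxtimes> idA (Fo x') \<boxtimes> idA a'"
    using tensor_between[OF o(1,3) A.ten_hom[OF eps_hom A.id_hom[OF F.map_obj[OF o(2)]]] mu_hom[OF X.unit_obj o(2), unfolded]]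
      mu_unit(1)[OF o(2)] o by simp
  then have "(idA a \<boxtimes> eps T \<boxtimes> idA (Fo x' \<otimes> a')) \<Zsemi> (idA a \<boxtimes> mu T unitX x' \<boxtimes> idA a') =
      idA (a \<otimes> Fo x' \<otimes> a')"
    by (simp add: A.ten_id[symmetric] simps)
  then show ?thesis
    unfolding lr by (simp add: P_simps simps)
qed

lemma sem_down:
  assumes "lok ZX l" "rok ZA r"
  shows "sem (VT (HT (IdT down_path) (GenT Eta)) (HT (GenT Counit) (IdT down_path))) l r = sem (IdT down_path) l r"
proof -
  obtain a x a' where lr: "l = (a, x)" "r = (unitX, a')" and o: "a \<in> Obj (Target T)" "x \<in> Obj (Source T)"
    "a' \<in> Obj (Target T)" using assms by (cases l; cases r; simp)
  have e: "eps T \<in> Arr (Target T)" "Dom (Target T) (eps T) = unitA" "Cod (Target T) (eps T) = Fo unitX"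
    using homD[OF eps_hom] by auto
  note simps = X.arr_simps A.arr_simps X.ten_simps A.ten_simps F.map_simps o e mu_arr
  have "(idA a \<boxtimes> (idA (Fo x) \<boxtimes> eps T) \<boxtimes> idA a') \<Zsemi> (idA a \<boxtimes> mu T x unitX \<boxtimes> idA a') =
      idA a \<boxtimes> idA (Fo x) \<boxtimes> idA a'"
    using tensor_between[OF o(1,3) A.ten_hom[OF A.id_hom[OF F.map_obj[OF o(2)]] eps_hom] mu_hom[OF o(2) X.unit_obj]]
      mu_unit(2)[OF o(2)] o by simp
  then have "(idA (a \<otimes> Fo x) \<boxtimes> eps T \<boxtimes> idA a') \<Zsemi> (idA a \<boxtimes> mu T x unitX \<boxtimes> idA a') =
      idA (a \<otimes> Fo x \<otimes> a')"
    by (simp add: A.ten_id[symmetric] simps)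
  then show ?thesis
    unfolding lr by (simp add: P_simps simps)
qed

lemma sem_sound:
  assumes "tm_eq P s t" "lok (path_dom (tdom P s)) l" "rok (path_cod (tdom P s)) r"
  shows "sem s l r = sem t l r"
  using assms
proof (induction arbitrary: l r rule: tm_eq.induct)
  case (sym s t)
  then show ?case using tm_eq_wf[OF sym.hyps] by simp
next
  case (trans s t u)
  then show ?case using tm_eq_wf[OF trans.hyps(1)] by simp
next
  case (vcong s s' t t')
  then show ?case using VT_homs[OF vcong.hyps(3)] by simp
next
  case (hcong s s' t t')
  then show ?case
    using HT_homs[OF hcong.hyps(3), of l r] tm_eq_wf[OF hcong.hyps(1)] tm_eq_wf[OF hcong.hyps(2)] by simp
next
  case (vid_left t)
  then show ?case using A.id_left[OF sem_hom[OF vid_left.hyps]] by simp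
next
  case (vid_right t)
  then show ?case using A.id_right[OF sem_hom[OF vid_right.hyps]] wf_path[OF vid_right.hyps] by simp
next
  case (vassoc s t u)
  then have w: "wf_tm P (VT s t)" "wf_tm P (VT t u)" by auto
  have e: "path_dom (tdom P s) = path_dom (tdom P t)" "path_cod (tdom P s) = path_cod (tdom P t)"
    using w(1) wf_path[of s] wf_path[of t] by auto
  have l: "lok (path_dom (tdom P s)) l" "rok (path_cod (tdom P s)) r" using vassoc.prems by auto
  note v = VT_homs(2)[OF w(2) l[unfolded e], folded e]
  show ?case
    using A.comp_assoc[OF VT_homs(1,2)[OF w(1) l]] v vassoc.hyps by simp
next
  case (hid_left t c)
  then show ?case using A.id_left[OF sem_hom[OF hid_left.hyps(1)]] by simp
next
  case (hid_right t d)
  then show ?case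
    using A.id_right[OF sem_hom[OF hid_right.hyps(1)]] wf_path[OF hid_right.hyps(1)]
      join_act[of "tcod P t" l r] by simp
next
  case (hassoc s t u)
  then have w: "wf_tm P s" "wf_tm P t" "wf_tm P u" "path_cod (tdom P s) = path_dom (tdom P t)"
    "path_cod (tdom P t) = path_dom (tdom P u)"
    by auto
  note ws = wf_path[OF w(1)] and wt = wf_path[OF w(2)] and wu = wf_path[OF w(3)]
  have l: "lok (path_dom (tdom P s)) l" and r: "rok (path_cod (tdom P u)) r"
    using hassoc.prems by auto
  have ru: "rok (path_cod (tdom P t)) (ract (tdom P u) r)" using act_ok(2)[of "tdom P u" r] wu w r by simp
  have st: "wf_tm P (HT s t)" using w by simp
  have p: "is_path P (path_comp (tcod P s) (tcod P t))" using ws wt w by (auto intro: is_path_comp)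
  note h1 = HT_homs[OF st l ru]
  have h2: "sem u (lact (tcod P t) (lact (tcod P s) l)) r \<in> hom (Target T)
     (join (path_dom (tdom P s)) l (ract (tcod P s) (ract (tcod P t) (ract (tdom P u) r))))
     (join (path_dom (tdom P s)) l (ract (tcod P s) (ract (tcod P t) (ract (tcod P u) r))))"
    using sem_hom_after[OF w(3) p, of l r] w ws wt l r by simp
  show ?case using A.comp_assoc[OF h1(1,2) h2] by simp
next
  case (hid_comp p q)
  then have "join (path_dom q) (lact p l) (ract q r) = join (path_dom p) l (ract p (ract q r))"
    using join_act[of p l "ract q r"] act_ok(2)[of q r] by auto
  moreover have "join (path_dom p) l (ract p (ract q r)) \<in> Obj (Target T)"
    using hid_comp act_ok(2)[of q r] act_ok(2)[of p "ract q r"] by (auto intro!: join_obj)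
  ultimately show ?case by (simp add: A.arr_simps)
next
  case (interchange s t s' t')
  then have w: "wf_tm P (VT s t)" "wf_tm P (VT s' t')" "wf_tm P s" "wf_tm P t" "wf_tm P s'" "wf_tm P t'"
    "tcod P s = tdom P t" "tcod P s' = tdom P t'" "path_cod (tdom P s) = path_dom (tdom P s')"
    by auto
  note ws = wf_path[OF w(3)] and wt = wf_path[OF w(4)] and ws' = wf_path[OF w(5)] and wt' = wf_path[OF w(6)]
  have l: "lok (path_dom (tdom P s)) l" and r: "rok (path_cod (tdom P s')) r"
    using interchange.prems by auto
  let ?p = "(path_cod (tdom P s), [], path_cod (tdom P s))"
  \<comment> \<open>Expanded into four factors, the two sides of the interchange law differ only in
    the order of the middle ones, \<open>t\<close> and \<open>s'\<close>. Their positions are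
    adjacent, hence the empty path.\<close>
  have "slides t s' ?p"
    using w ws wt by (intro slides is_path_empty Gens0_P) auto
  then have sl: "sem t l (ract (tdom P s') r) \<Zsemi> sem s' (lact (tcod P t) l) r =
      sem s' (lact (tcod P s) l) r \<Zsemi> sem t l (ract (tcod P s') r)"
    using l r ws wt w by (simp add: slides_def)
  have r': "rok (path_cod (tdom P s)) (ract (tdom P s') r)" "rok (path_cod (tdom P s)) (ract (tdom P t') r)"
    using act_ok(2)[of "tdom P s'" r] act_ok(2)[of "tdom P t'" r] ws' wt' w r by auto
  note v = VT_homs(1,2)[OF w(1) l r'(1)]
  have v': "sem t l (ract (tdom P t') r) \<in> hom (Target T)
      (join (path_dom (tdom P s)) l (ract (tdom P t) (ract (tdom P t') r)))
      (join (path_dom (tdom P s)) l (ract (tcod P t) (ract (tdom P t') r)))"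
    using VT_homs(2)[OF w(1) l r'(2)] .
  have u: "sem s' (lact q l) r \<in> hom (Target T)
      (join (path_dom (tdom P s)) l (ract q (ract (tdom P s') r)))
      (join (path_dom (tdom P s)) l (ract q (ract (tcod P s') r)))"
    "sem t' (lact q l) r \<in> hom (Target T)
      (join (path_dom (tdom P s)) l (ract q (ract (tdom P t') r)))
      (join (path_dom (tdom P s)) l (ract q (ract (tcod P t') r)))"
    if "q = tcod P s \<or> q = tcod P t" for q
    using that sem_hom_after[OF w(5), of q l r] sem_hom_after[OF w(6), of q l r] w ws wt ws' wt' l r by auto
  let ?s = "sem s l (ract (tdom P s') r)" and ?t = "sem t l (ract (tdom P s') r)"
    and ?u = "sem s' (lact (tcod P t) l) r" and ?v = "sem t' (lact (tcod P t) l) r"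
    and ?u' = "sem s' (lact (tcod P s) l) r" and ?t' = "sem t l (ract (tdom P t') r)"
  have "(?s \<Zsemi> ?t) \<Zsemi> (?u \<Zsemi> ?v) = ?s \<Zsemi> ((?t \<Zsemi> ?u) \<Zsemi> ?v)"
    using A.comp_assoc[OF v(1,2) A.comp_hom[OF u(1)[of "tcod P t"] u(2)[of "tcod P t", folded w(8)]]]
      A.comp_assoc[OF v(2) u(1)[of "tcod P t"] u(2)[of "tcod P t", folded w(8)]] by simp
  also have "?t \<Zsemi> ?u = ?u' \<Zsemi> ?t'" using sl w by simp
  also have "?s \<Zsemi> ((?u' \<Zsemi> ?t') \<Zsemi> ?v) = (?s \<Zsemi> ?u') \<Zsemi> (?t' \<Zsemi> ?v)"
  proof -
    let ?J = "\<lambda>q q'. join (path_dom (tdom P s)) l (ract q (ract q' r))"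
    have 1: "?s \<in> hom (Target T) (?J (tdom P s) (tdom P s')) (?J (tdom P t) (tdom P s'))"
      using v(1) .
    have 2: "?u' \<in> hom (Target T) (?J (tdom P t) (tdom P s')) (?J (tdom P t) (tdom P t'))"
      using u(1)[of "tcod P s"] w(7,8) by simp
    have 3: "?t' \<in> hom (Target T) (?J (tdom P t) (tdom P t')) (?J (tcod P t) (tdom P t'))"
      using v' .
    have 4: "?v \<in> hom (Target T) (?J (tcod P t) (tdom P t')) (?J (tcod P t) (tcod P t'))"
      using u(2)[of "tcod P t"] by simp
    show ?thesis
      using A.comp_assoc[OF 1 2 A.comp_hom[OF 3 4]] A.comp_assoc[OF 2 3 4] by simp
  qed
  finally show ?case using w by simp
next
  case (relation s t)
  then consider "s = VT (HT (GenT Eta) (IdT up_path)) (HT (IdT up_path) (GenT Counit))" "t = IdT up_path"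
    | "s = VT (HT (IdT down_path) (GenT Eta)) (HT (GenT Counit) (IdT down_path))" "t = IdT down_path"
    by (auto simp: P_simps)
  then show ?case
    using relation.prems by cases (auto simp: P_simps simp del: sem.simps intro!: sem_up sem_down)
qed simp

end

section \<open>2-cells between composites of box objects, and functors defined on terms\<close>

context signature
begin

lemma Ws_iff: "p \<in> Ws \<longleftrightarrow> (\<exists>us \<in> lists (XObj S). p = xpath us)"
  by auto

text \<open>Generators \<open>GX\<close> never leave \<open>ZX\<close>, so a composite of them can
  be split only at \<open>ZX\<close>, into two such composites.\<close>

lemma Ws_compD:
  assumes "is_path P p" "is_path P q" "path_cod p = path_dom q" "path_comp p q \<in> Ws"
  shows "p \<in> Ws" "q \<in> Ws"
proof -
  obtain c gs d hs e where pq: "p = (c, gs, d)" "q = (d, hs, e)"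
    using assms(3) by (cases p; cases q) auto
  with assms(4) obtain us where us: "us \<in> lists (XObj S)" "c = ZX" "e = ZX" "gs @ hs = map GX us"
    by (auto simp: xpath_def)
  then obtain us1 us2 where u: "us = us1 @ us2" "gs = map GX us1" "hs = map GX us2"
    by (metis append_eq_map_conv)
  have "path_from P ZX (map GX us1) d" using assms(1) pq u us by (simp add: is_path_def)
  then have "d = ZX" using u us by (induction us1 arbitrary: gs us) (auto simp: P_simps)
  then show "p \<in> Ws" "q \<in> Ws" using pq u us unfolding Ws_iff xpath_def by auto
qed

lemma gen_Ws: "g \<in> Gens2 P \<Longrightarrow> gen2_dom g \<in> Ws \<longleftrightarrow> (\<exists>us vs e. g = FBoxG us vs e \<and> e \<in> FBox S us vs)"
proof (cases g)
  case (FBoxG us vs e)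
  moreover assume "g \<in> Gens2 P"
  ultimately have e: "e \<in> FBox S us vs" by (simp add: Gens2_P)
  then have "xpath us \<in> Ws" using fsig_listsD(2)[OF fsig e] by blast
  then show ?thesis using FBoxG e by simp
qed (auto simp: Gens2_P xpath_def apath_def boxpath_def Cons_eq_map_conv)

text \<open>Only functor box edges can occur in a term whose domain is a composite of generators \<open>X\<close>:
  every other generator has the 0-cell \<open>ZA\<close> in its domain.\<close>

lemma Ws_tcod: "wf_tm P t \<Longrightarrow> tdom P t \<in> Ws \<Longrightarrow> tcod P t \<in> Ws"
proof (induction t)
  case (GenT g)
  then obtain us vs e where g: "g = FBoxG us vs e" "e \<in> FBox S us vs" using gen_Ws by (auto simp: P_simps)
  then have "xpath vs \<in> Ws" using fsig_listsD(2)[OF fsig] by blast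
  then show ?case using g by (simp add: P_simps)
next
  case (HT s t)
  have "tdom P s \<in> Ws" "tdom P t \<in> Ws"
    using HT.prems wf_path[of s] wf_path[of t] Ws_compD[of "tdom P s" "tdom P t"] by auto
  then show ?case using HT adj.Ws(3) by auto
qed auto

lemma Ws_HT:
  assumes "wf_tm P (HT s t)" "tdom P (HT s t) \<in> Ws"
  shows "tdom P s \<in> Ws" "tdom P t \<in> Ws"
  using assms wf_path[of s] wf_path[of t] Ws_compD[of "tdom P s" "tdom P t"] by auto

lemma up_down_Ws: "up_path \<notin> Ws" "down_path \<notin> Ws"
  by (auto simp: xpath_def)

lemma source_simps:
  "Obj (Source (syntactic_lax S)) = Ws" "Idn (Source (syntactic_lax S)) = Id2 C"
  "Cmp (Source (syntactic_lax S)) = VComp C" "Unit (Source (syntactic_lax S)) = (ZX, [], ZX)"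
  "TenO (Source (syntactic_lax S)) = path_comp" "TenA (Source (syntactic_lax S)) = HComp C"
  by (simp_all add: syntactic_lax_eq adj.T_simps(1) full_monoidal_subcategory_simps endo_simps)

lemma target_simps:
  "Obj (Target (syntactic_lax S)) = endos ZA" "Idn (Target (syntactic_lax S)) = Id2 C"
  "Cmp (Target (syntactic_lax S)) = VComp C" "Unit (Target (syntactic_lax S)) = (ZA, [], ZA)"
  "TenO (Target (syntactic_lax S)) = path_comp" "TenA (Target (syntactic_lax S)) = HComp C"
  by (simp_all add: syntactic_lax_eq adj.T_simps(2) endo_simps)

lemma fun_simps:
  "FO (Fun (syntactic_lax S)) W = path_comp up_path (path_comp W down_path)"
  "FM (Fun (syntactic_lax S)) m = HComp C (HComp C (Id2 C up_path) m) (Id2 C down_path)"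
  "eps (syntactic_lax S) = tm_class P (GenT Eta)"
  "mu (syntactic_lax S) W V =
    HComp C (HComp C (Id2 C (path_comp up_path W)) (tm_class P (GenT Counit))) (Id2 C (path_comp V down_path))"
  by (simp_all only: syntactic_lax_eq adj.T_simps)

text \<open>The full subcategory requires both ends to lie in \<open>Ws\<close>, but by
  \<open>Ws_tcod\<close> the domain decides. Statements about terms then need a condition on one end
  only.\<close>

lemma source_hom: "m \<in> hom (Source (syntactic_lax S)) p q \<longleftrightarrow>
    (\<exists>t. wf_tm P t \<and> tdom P t = p \<and> tcod P t = q \<and> p \<in> Ws \<and> m = tm_class P t)"
proof -
  have "m \<in> hom (Source (syntactic_lax S)) p q \<longleftrightarrow> cell m p q \<and> p \<in> Ws \<and> q \<in> Ws"
    unfolding syntactic_lax_eq by (rule adj.source_hom)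
  then show ?thesis unfolding cell_def using Ws_tcod by blast
qed

lemma target_hom: "m \<in> hom (Target (syntactic_lax S)) p q \<longleftrightarrow>
    (\<exists>t. wf_tm P t \<and> tdom P t = p \<and> tcod P t = q \<and> p \<in> endos ZA \<and> m = tm_class P t)"
proof -
  have "m \<in> hom (Target (syntactic_lax S)) p q \<longleftrightarrow> cell m p q \<and> p \<in> endos ZA \<and> q \<in> endos ZA"
    unfolding syntactic_lax_eq adj.T_simps by (rule endo_hom)
  then show ?thesis unfolding cell_def endos_def using wf_path by fastforce
qed

lemma source_Arr: "m \<in> Arr (Source (syntactic_lax S)) \<longleftrightarrow> (\<exists>t. wf_tm P t \<and> tdom P t \<in> Ws \<and> m = tm_class P t)"
proof -
  have "m \<in> Arr (Source (syntactic_lax S)) \<longleftrightarrow> (\<exists>p q. m \<in> hom (Source (syntactic_lax S)) p q)"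
    by (simp add: hom_def)
  then show ?thesis by (auto simp: source_hom)
qed

lemma target_Arr: "m \<in> Arr (Target (syntactic_lax S)) \<longleftrightarrow> (\<exists>t. wf_tm P t \<and> tdom P t \<in> endos ZA \<and> m = tm_class P t)"
proof -
  have "m \<in> Arr (Target (syntactic_lax S)) \<longleftrightarrow> (\<exists>p q. m \<in> hom (Target (syntactic_lax S)) p q)"
    by (simp add: hom_def)
  then show ?thesis by (auto simp: target_hom)
qed

lemma Ws_endos: "p \<in> Ws \<Longrightarrow> is_path P p \<and> path_dom p = ZX \<and> path_cod p = ZX"
  using adj.WsD by blast

lemma endosD: "p \<in> endos c \<Longrightarrow> is_path P p \<and> path_dom p = c \<and> path_cod p = c"
  by (simp add: endos_def)

lemma endos_tcod: "wf_tm P t \<Longrightarrow> tdom P t \<in> endos c \<Longrightarrow> tcod P t \<in> endos c"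
  using wf_path[of t] by (simp add: endos_def)

lemma endos_comp: "p \<in> endos c \<Longrightarrow> q \<in> endos c \<Longrightarrow> path_comp p q \<in> endos c"
  by (auto simp: endos_def intro: is_path_comp)

text \<open>A function \<open>fm\<close> on terms that is compatible with the term constructors
  yields a monoidal functor on classes; soundness is hidden in the assumption on \<open>FM\<close>.
  It serves both categories, for the interpretation as well as for relabelling.\<close>

lemma class_functor:
  assumes M: "monoidal_category M" and N: "monoidal_category N"
    and M_simps: "Obj M = W" "Idn M = Id2 C" "Cmp M = VComp C" "Unit M = (c, [], c)"
      "TenO M = path_comp" "TenA M = HComp C"
    and M_hom: "\<And>m p q. m \<in> hom M p q \<longleftrightarrow>
      (\<exists>t. wf_tm P t \<and> tdom P t = p \<and> tcod P t = q \<and> p \<in> W \<and> m = tm_class P t)"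
    and W: "W \<subseteq> endos c"
    and FO: "\<And>p. p \<in> W \<Longrightarrow> FO F p = fo p"
    and FM: "\<And>t. wf_tm P t \<Longrightarrow> tdom P t \<in> W \<Longrightarrow> FM F (tm_class P t) = fm t"
    and fm_hom: "\<And>t. wf_tm P t \<Longrightarrow> tdom P t \<in> W \<Longrightarrow> fm t \<in> hom N (fo (tdom P t)) (fo (tcod P t))"
    and fm_id: "\<And>p. p \<in> W \<Longrightarrow> fm (IdT p) = Idn N (fo p)"
    and fm_VT: "\<And>s t. wf_tm P (VT s t) \<Longrightarrow> tdom P s \<in> W \<Longrightarrow> fm (VT s t) = fm s ;;\<^bsub>N\<^esub> fm t"
    and fm_HT: "\<And>s t. wf_tm P (HT s t) \<Longrightarrow> tdom P s \<in> W \<Longrightarrow> tdom P t \<in> W \<Longrightarrow>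
      fm (HT s t) = TenA N (fm s) (fm t)"
    and fo_unit: "fo (c, [], c) = Unit N"
    and fo_comp: "\<And>p q. p \<in> W \<Longrightarrow> q \<in> W \<Longrightarrow> fo (path_comp p q) = TenO N (fo p) (fo q)"
  shows "monoidal_functor M N F"
proof -
  interpret M: monoidal_category M by (rule M)
  interpret N: monoidal_category N by (rule N)
  have W_path: "is_path P p \<and> path_dom p = c \<and> path_cod p = c" if "p \<in> W" for p
    using endosD[OF subsetD[OF W that]] .
  have W_comp: "path_comp p q \<in> W" if "p \<in> W" "q \<in> W" for p q
    using M.ten_obj[of p q] that by (simp add: M_simps)
  have fo_obj: "fo p \<in> Obj N" if "p \<in> W" for p
  proof -
    have "wf_tm P (IdT p)" "tdom P (IdT p) \<in> W" using W_path[OF that] that by simp_all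
    from N.hom_obj(1)[OF fm_hom[OF this]] show ?thesis by simp
  qed
  show ?thesis
  proof unfold_locales
    fix p assume "p \<in> Obj M"
    then have p: "p \<in> W" by (simp add: M_simps)
    then show "FO F p \<in> Obj N" by (simp add: FO fo_obj)
    have "wf_tm P (IdT p)" using W_path[OF p] by simp
    then show "FM F (Idn M p) = Idn N (FO F p)"
      using p by (simp add: M_simps C_simps FM FO fm_id)
    fix q assume "q \<in> Obj M"
    then show "FO F (TenO M p q) = TenO N (FO F p) (FO F q)"
      using p by (simp add: M_simps FO fo_comp W_comp)
  next
    fix m p q assume m: "m \<in> hom M p q"
    from iffD1[OF M_hom this] obtain t
      where "wf_tm P t" "tdom P t = p" "tcod P t = q" "p \<in> W" "m = tm_class P t" by blast
    moreover have "q \<in> W" using M.hom_obj(2)[OF m] by (simp add: M_simps)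
    ultimately show "FM F m \<in> hom N (FO F p) (FO F q)"
      using fm_hom[of t] by (simp add: FM FO)
  next
    fix m n p q r assume m: "m \<in> hom M p q" and n: "n \<in> hom M q r"
    obtain s where s: "wf_tm P s" "tdom P s = p" "tcod P s = q" "p \<in> W" "m = tm_class P s"
      using iffD1[OF M_hom m] by blast
    obtain t where t: "wf_tm P t" "tdom P t = q" "tcod P t = r" "q \<in> W" "n = tm_class P t"
      using iffD1[OF M_hom n] by blast
    then show "FM F (m ;;\<^bsub>M\<^esub> n) = FM F m ;;\<^bsub>N\<^esub> FM F n"
      using s by (simp add: M_simps VComp_class FM fm_VT)
  next
    fix m n assume m: "m \<in> Arr M" and n: "n \<in> Arr M"
    obtain s where s: "wf_tm P s" "tdom P s \<in> W" "m = tm_class P s"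
      using iffD1[OF M_hom M.arr_hom[OF m]] by metis
    obtain t where t: "wf_tm P t" "tdom P t \<in> W" "n = tm_class P t"
      using iffD1[OF M_hom M.arr_hom[OF n]] by metis
    have "wf_tm P (HT s t)" using s t W_path[OF s(2)] W_path[OF t(2)] by simp
    then show "FM F (TenA M m n) = TenA N (FM F m) (FM F n)"
      using s t W_comp[OF s(2) t(2)] by (simp add: M_simps HComp_class FM fm_HT)
  next
    show "FO F (Unit M) = Unit N"
      using M.unit_obj by (simp add: M_simps FO fo_unit)
  qed
qed

lemma source_target_monoidal:
  "monoidal_category (Source (syntactic_lax S))" "monoidal_category (Target (syntactic_lax S))"
proof -
  interpret lax_functor "syntactic_lax S" by unfold_locales (rule syntactic_lax)
  show "monoidal_category (Source (syntactic_lax S))" "monoidal_category (Target (syntactic_lax S))"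
    by (rule X.monoidal_category_axioms A.monoidal_category_axioms)+
qed

lemmas source_functor = class_functor[OF source_target_monoidal(1) _ source_simps source_hom adj.Ws(1)]

lemmas target_functor =
  class_functor[OF source_target_monoidal(2) _ target_simps target_hom subset_refl]

end

section \<open>The induced morphism of lax monoidal functors\<close>

context interpretation_data
begin

definition xval :: "'u syn1 \<Rightarrow> 'xo" where
  "xval p = fst (ract p (unitX, unitA))"

definition aval :: "'u syn1 \<Rightarrow> 'ao" where
  "aval p = fst (lact p (unitA, unitX))"

text \<open>The value of \<open>xsem\<close> is meaningful only on terms with domain in \<open>Ws\<close>.\<close>

primrec xsem :: "(cell0, 'u gen1, 'u gen2) tm \<Rightarrow> 'xm" where
  "xsem (IdT p) = idX (xval p)"
| "xsem (GenT g) = (case g of FBoxG us vs e \<Rightarrow> fb us vs e)"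
| "xsem (VT s t) = xsem s ;;\<^bsub>Source T\<^esub> xsem t"
| "xsem (HT s t) = xsem s \<boxdot> xsem t"

abbreviation asem where "asem t \<equiv> sem t (unitA, unitX) (unitX, unitA)"

lemma xval_xpath: "us \<in> lists (XObj S) \<Longrightarrow> xval (xpath us) = tens (Source T) (map k us)"
  by (simp add: xval_def xpath_def act_GX obj_simps map_objs)

lemma act_Ws:
  assumes "p \<in> Ws" "a \<in> Obj (Target T)" "x \<in> Obj (Source T)"
  shows "lact p (a, x) = (a, x \<odot> xval p)" "ract p (x, a) = (xval p \<odot> x, a)"
proof -
  obtain us where us: "us \<in> lists (XObj S)" "p = xpath us" using assms(1) by blast
  show "lact p (a, x) = (a, x \<odot> xval p)" "ract p (x, a) = (xval p \<odot> x, a)"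
    unfolding us(2) xval_xpath[OF us(1)] using us(1) assms(2,3) by (simp_all add: xpath_def act_GX)
qed

lemma xval_obj: "p \<in> Ws \<Longrightarrow> xval p \<in> Obj (Source T)"
  unfolding Ws_iff using xval_xpath X.tens_obj map_objs(2) by metis

lemma xval_comp: "p \<in> Ws \<Longrightarrow> q \<in> Ws \<Longrightarrow> xval (path_comp p q) = xval p \<odot> xval q"
  using act_Ws(2)[of p] act_Ws(2)[of q] by (simp add: xval_def[of "path_comp p q"] obj_simps xval_obj)

lemma xval_empty: "xval (ZX, [], ZX) = unitX"
  by (simp add: xval_def)

lemma xsem_hom: "wf_tm P t \<Longrightarrow> tdom P t \<in> Ws \<Longrightarrow> xsem t \<in> hom (Source T) (xval (tdom P t)) (xval (tcod P t))"
proof (induction t)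
  case (IdT p)
  then show ?case by (simp add: X.id_hom xval_obj)
next
  case (GenT g)
  then obtain us vs e where g: "g = FBoxG us vs e" "e \<in> FBox S us vs" using gen_Ws by (auto simp: P_simps)
  then show ?case using fb[OF g(2)] fsig_listsD(2)[OF fsig g(2)] by (simp add: P_simps xval_xpath del: in_lists_conv_set)
next
  case (VT s t)
  then have "tdom P t \<in> Ws" using Ws_tcod[of s] by auto
  with VT show ?case by (auto intro: X.comp_hom)
next
  case (HT s t)
  note w = Ws_HT[OF HT.prems]
  then have "tcod P s \<in> Ws" "tcod P t \<in> Ws" using HT.prems Ws_tcod by auto
  with HT w show ?case by (auto simp: xval_comp intro: X.ten_hom)
qed

lemma xsem_arr:
  assumes "wf_tm P t" "tdom P t \<in> Ws"
  shows "xsem t \<in> Arr (Source T)" "Dom (Source T) (xsem t) = xval (tdom P t)"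
    "Cod (Source T) (xsem t) = xval (tcod P t)"
  using homD[OF xsem_hom[OF assms]] by auto

text \<open>Derivable equations are between parallel terms, so a derivation starting in
  \<open>Ws\<close> stays there and never uses a snake equation, whose domain is
  \<open>up_path\<close> or \<open>down_path\<close>. Interchange holds directly in the source
  category, without any sliding.\<close>

lemma xsem_sound: "tm_eq P s t \<Longrightarrow> tdom P s \<in> Ws \<Longrightarrow> xsem s = xsem t"
proof (induction rule: tm_eq.induct)
  case (sym s t)
  then show ?case using tm_eq_wf[OF sym.hyps] by simp
next
  case (trans s t u)
  then show ?case using tm_eq_wf[OF trans.hyps(1)] by simp
next
  case (vcong s s' t t')
  then have "tdom P t \<in> Ws" using Ws_tcod[of s] by auto
  with vcong show ?case by simp
next
  case (hcong s s' t t')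
  then show ?case using Ws_HT[OF hcong.hyps(3)] by simp
next
  case (vid_left t)
  then show ?case by (simp add: X.arr_simps xsem_arr)
next
  case (vid_right t)
  then show ?case by (simp add: X.arr_simps xsem_arr)
next
  case (vassoc s t u)
  then have "tdom P s \<in> Ws" "tdom P t \<in> Ws" "tdom P u \<in> Ws" using Ws_tcod[of s] Ws_tcod[of t] by auto
  moreover have "wf_tm P s" "wf_tm P t" "wf_tm P u" "tcod P s = tdom P t" "tcod P t = tdom P u"
    using vassoc.hyps by auto
  ultimately show ?case using X.comp_assoc[OF xsem_hom[of s] _ xsem_hom[of u]] xsem_hom[of t] by simp
next
  case (hid_left t c)
  have "tdom P t \<in> Ws" using hid_left by (simp add: path_comp_unit)
  moreover from this have "c = ZX" using hid_left(2) Ws_endos by blast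
  ultimately show ?case using hid_left by (simp add: X.ten_simps xsem_arr xval_empty)
next
  case (hid_right t c)
  have "tdom P t \<in> Ws" using hid_right by (simp add: path_comp_unit)
  moreover from this have "c = ZX" using hid_right(2) Ws_endos by blast
  ultimately show ?case using hid_right by (simp add: X.ten_simps xsem_arr xval_empty)
next
  case (hassoc s t u)
  then have "wf_tm P (HT s t)" "tdom P (HT s t) \<in> Ws" "tdom P u \<in> Ws"
    using Ws_HT[of "HT s t" u] by auto
  then have "tdom P s \<in> Ws" "tdom P t \<in> Ws" "tdom P u \<in> Ws" using Ws_HT[of s t] by auto
  then show ?case using hassoc.hyps by (simp add: X.ten_simps xsem_arr)
next
  case (hid_comp p q)
  then have "p \<in> Ws" "q \<in> Ws" using Ws_HT[of "IdT p" "IdT q"] by auto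
  then show ?case by (simp add: xval_comp X.ten_id xval_obj)
next
  case (interchange s t s' t')
  then have "tdom P s \<in> Ws" "tdom P s' \<in> Ws" using Ws_HT[of "VT s t" "VT s' t'"] by auto
  moreover from this have "tdom P t \<in> Ws" "tdom P t' \<in> Ws"
    using interchange.hyps Ws_tcod[of s] Ws_tcod[of s'] by auto
  ultimately show ?case using interchange.hyps by (simp add: X.ten_comp' xsem_arr)
next
  case (relation s t)
  then show ?case using up_down_Ws by (auto simp: P_simps)
qed simp

text \<open>Such a term acts within a single box, so its value in context is the functor applied to
  its value in the source category, whiskered with the contents \<open>x\<close> and
  \<open>x'\<close> of that box. This relates the two components of \<open>mor\<close>.\<close>

lemma sem_xsem:
  assumes "wf_tm P t" "tdom P t \<in> Ws" "a \<in> Obj (Target T)" "x \<in> Obj (Source T)" "x' \<in> Obj (Source T)"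
    "a' \<in> Obj (Target T)"
  shows "sem t (a, x) (x', a') = idA a \<boxtimes> Fm (idX x \<boxdot> xsem t \<boxdot> idX x') \<boxtimes> idA a'"
  using assms
proof (induction t arbitrary: x x')
  case (IdT p)
  then have "path_dom p = ZX" using Ws_endos by auto
  with IdT show ?case
    by (simp add: act_Ws xval_obj obj_simps A.ten_id X.ten_id F.map_id[symmetric])
      (simp add: A.ten_id X.ten_id obj_simps xval_obj F.map_id)
next
  case (GenT g)
  then obtain us vs e where g: "g = FBoxG us vs e" "e \<in> FBox S us vs" using gen_Ws by (auto simp: P_simps)
  then show ?case by simp
next
  case (VT s t)
  then have t: "tdom P t \<in> Ws" using Ws_tcod[of s] by auto
  with VT show ?case
    by (simp add: A.ten_comp' A.arr_simps A.ten_simps X.arr_simps X.ten_simps F.map_simps xsem_arr F_comp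
        X.ten_comp')
next
  case (HT s t)
  note w = Ws_HT[OF HT.prems(1,2)]
  then have w': "tcod P s \<in> Ws" "tcod P t \<in> Ws" using HT.prems Ws_tcod by auto
  show ?case
    using HT w w'
    by (simp add: act_Ws xval_obj obj_simps A.ten_comp' A.arr_simps A.ten_simps X.arr_simps X.ten_simps
        F.map_simps xsem_arr F_comp X.ten_comp' X.ten_id[symmetric])
qed

abbreviation e1 where "e1 \<equiv> (unitA, unitX)"
abbreviation e2 where "e2 \<equiv> (unitX, unitA)"

lemma e_ok: "lok c e1" "rok c e2"
  by (simp_all add: obj_simps)

text \<open>The left and the right action compute the same object: the join of empty contexts is
  invariant under moving the cut from one end of \<open>p\<close> to the other.\<close>

lemma act_endo:
  assumes "p \<in> endos ZA"
  shows "lact p e1 = (aval p, unitX)" "ract p e2 = (unitX, aval p)" "aval p \<in> Obj (Target T)"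
proof -
  note p = endosD[OF assms]
  have l: "lok ZA (lact p e1)" and r: "rok ZA (ract p e2)"
    using act_ok[of p] p e_ok by auto
  show 1: "lact p e1 = (aval p, unitX)" and 2: "aval p \<in> Obj (Target T)"
    using l unfolding aval_def by (cases "lact p e1"; simp)+
  have "snd (ract p e2) = aval p"
    using join_act[of p e1 e2] p e_ok r 1 2 by (cases "ract p e2") (simp add: obj_simps)
  then show "ract p e2 = (unitX, aval p)"
    using r by (cases "ract p e2") simp
qed

lemma act_endo':
  assumes "p \<in> endos ZA" "a \<in> Obj (Target T)"
  shows "lact p (a, unitX) = (a \<otimes> aval p, unitX)" "ract p (unitX, a) = (unitX, aval p \<otimes> a)"
  using act_sh[of p a] act_endo[OF assms(1)] endosD[OF assms(1)] assms(2) e_ok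
  by (fastforce simp: obj_simps)+

lemma join_endo: "p \<in> endos ZA \<Longrightarrow> join ZA e1 (ract p e2) = aval p"
  using act_endo[of p] by (simp add: obj_simps)

lemma asem_hom:
  assumes "wf_tm P t" "tdom P t \<in> endos ZA"
  shows "asem t \<in> hom (Target T) (aval (tdom P t)) (aval (tcod P t))"
proof -
  have "tcod P t \<in> endos ZA" using wf_path[OF assms(1)] assms(2) by (simp add: endos_def)
  then show ?thesis
    using sem_hom[OF assms(1) e_ok] endosD[OF assms(2)] join_endo assms(2) by simp
qed

lemma aval_comp: "p \<in> endos ZA \<Longrightarrow> q \<in> endos ZA \<Longrightarrow> aval (path_comp p q) = aval p \<otimes> aval q"
  using act_endo[of p] act_endo'[of q "aval p"] by (simp add: aval_def[of "path_comp p q"])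

text \<open>Across \<open>ZA\<close> each factor sees the other as an outer identity, so the
  sequential reading of a horizontal composite becomes a tensor product by interchange.\<close>

lemma asem_HT:
  assumes "wf_tm P s" "wf_tm P t" "tdom P s \<in> endos ZA" "tdom P t \<in> endos ZA"
  shows "asem (HT s t) = asem s \<boxtimes> asem t"
proof -
  note s = endosD[OF assms(3)] and t = endosD[OF assms(4)]
  note s' = endos_tcod[OF assms(1,3)] and t' = endos_tcod[OF assms(2,4)]
  note hs = asem_hom[OF assms(1,3)] and ht = asem_hom[OF assms(2,4)]
  have "sem s e1 (ract (tdom P t) e2) = asem s \<boxtimes> idA (aval (tdom P t))"
    using sem_rsh[OF assms(1), of e1 e2 "aval (tdom P t)"] act_endo[OF assms(4)] s e_ok
    by (simp add: obj_simps)
  moreover have "sem t (lact (tcod P s) e1) e2 = idA (aval (tcod P s)) \<boxtimes> asem t"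
    using sem_lsh[OF assms(2), of e1 e2 "aval (tcod P s)"] act_endo[OF s'] t e_ok
    by (simp add: obj_simps)
  ultimately show ?thesis
    using homD[OF hs] homD[OF ht] act_endo(3)[OF s'] act_endo(3)[OF assms(4)]
    by (simp add: A.ten_comp' A.arr_simps)
qed

definition mor :: "(('u syn1, 'u syn2, 'u syn1, 'u syn2, 'xo, 'xm, 'ao, 'am) lax_mor)" where
  "mor = \<lparr>LDom = syntactic_lax S, LCod = T,
    LH = \<lparr>FO = restrict xval (Obj (Source (syntactic_lax S))),
      FM = restrict (\<lambda>m. xsem (rep m)) (Arr (Source (syntactic_lax S)))\<rparr>,
    LK = \<lparr>FO = restrict aval (Obj (Target (syntactic_lax S))),
      FM = restrict (\<lambda>m. asem (rep m)) (Arr (Target (syntactic_lax S)))\<rparr>\<rparr>"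

lemma mor_ends: "LDom mor = syntactic_lax S" "LCod mor = T"
  by (simp_all add: mor_def)

lemma mor_H:
  "p \<in> Ws \<Longrightarrow> FO (LH mor) p = xval p"
  "wf_tm P t \<Longrightarrow> tdom P t \<in> Ws \<Longrightarrow> FM (LH mor) (tm_class P t) = xsem t"
proof -
  assume t: "wf_tm P t" "tdom P t \<in> Ws"
  then have "tm_class P t \<in> Arr (Source (syntactic_lax S))" unfolding source_Arr by blast
  then show "FM (LH mor) (tm_class P t) = xsem t"
    using xsem_sound[OF rep_class[OF t(1)] t(2)] by (simp add: mor_def)
qed (simp add: mor_def source_simps)

lemma mor_K:
  "p \<in> endos ZA \<Longrightarrow> FO (LK mor) p = aval p"
  "wf_tm P t \<Longrightarrow> tdom P t \<in> endos ZA \<Longrightarrow> FM (LK mor) (tm_class P t) = asem t"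
proof -
  assume t: "wf_tm P t" "tdom P t \<in> endos ZA"
  then have "tm_class P t \<in> Arr (Target (syntactic_lax S))" unfolding target_Arr by blast
  then show "FM (LK mor) (tm_class P t) = asem t"
    using sem_sound[OF rep_class[OF t(1)] e_ok] by (simp add: mor_def)
qed (simp add: mor_def target_simps)

lemma mor_H_functor: "monoidal_functor (Source (syntactic_lax S)) (Source T) (LH mor)"
  by (rule source_functor[where fo = xval and fm = xsem, OF X.monoidal_category_axioms mor_H xsem_hom])
    (auto simp: xval_empty xval_comp simp del: mem_Collect_eq)

lemma mor_K_functor: "monoidal_functor (Target (syntactic_lax S)) (Target T) (LK mor)"
proof (rule target_functor[where fo = aval and fm = asem, OF A.monoidal_category_axioms mor_K asem_hom])
  show "asem (IdT p) = idA (aval p)" if "p \<in> endos ZA" for p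
    using endosD[OF that] join_endo[OF that] by simp
qed (simp_all add: asem_HT aval_comp aval_def[of "(ZA, [], ZA)"] del: sem.simps(4))

lemma box_endos: "p \<in> Ws \<Longrightarrow> path_comp up_path (path_comp p down_path) \<in> endos ZA"
  using Ws_endos[of p] is_path_up is_path_down by (auto simp: endos_def intro!: is_path_comp)

lemma aval_box: "p \<in> Ws \<Longrightarrow> aval (path_comp up_path (path_comp p down_path)) = Fo (xval p)"
  using Ws_endos[of p] by (simp add: aval_def act_Ws obj_simps xval_obj)

lemma mor_is_lax_mor: "is_lax_mor mor"
proof -
  have 1: "FM (LK mor) (FM (Fun (syntactic_lax S)) m) = Fm (FM (LH mor) m)"
    if m: "m \<in> Arr (Source (syntactic_lax S))" for m
  proof -
    obtain t where t: "wf_tm P t" "tdom P t \<in> Ws" "m = tm_class P t" using m source_Arr by auto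
    \<comment> \<open>A term for the boxed 2-cell. In the empty context \<open>up_path\<close> and
      \<open>down_path\<close> surround \<open>t\<close> by a box without further content, so
      \<open>sem_xsem\<close> applies with units.\<close>
    let ?t = "HT (HT (IdT up_path) t) (IdT down_path)"
    have w: "wf_tm P ?t" using t Ws_endos[OF t(2)] is_path_up is_path_down by simp
    have t': "tcod P t \<in> Ws" using Ws_tcod t by blast
    have "FM (Fun (syntactic_lax S)) m = tm_class P ?t"
      using w t by (simp add: fun_simps C_simps HComp_class)
    moreover have "asem ?t = Fm (xsem t)"
      using sem_xsem[OF t(1,2), of unitA unitX unitX unitA] xsem_arr[OF t(1,2)] t' Ws_endos[OF t(2)]
      by (simp add: act_Ws[OF t(2)] act_Ws[OF t'] xval_obj[OF t(2)] xval_obj[OF t'] obj_simps F.map_simps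
          A.arr_simps X.arr_simps del: mem_Collect_eq)
    ultimately show ?thesis
      using mor_K(2)[OF w] box_endos[OF t(2)] t mor_H(2)[OF t(1,2)] by (simp add: path_comp_assoc)
  qed
  have 2: "FM (LK mor) (mu (syntactic_lax S) p q) = mu T (FO (LH mor) p) (FO (LH mor) q)"
    if p: "p \<in> Ws" and q: "q \<in> Ws" for p q
  proof -
    \<comment> \<open>A term for the multiplication: the counit lies in a box with content
      \<open>p\<close> before it and \<open>q\<close> behind it, and \<open>core\<close> turns
      exactly this into \<open>mu\<close>.\<close>
    let ?t = "HT (HT (IdT (path_comp up_path p)) (GenT Counit)) (IdT (path_comp q down_path))"
    have w: "wf_tm P ?t"
      using Ws_endos[OF p] Ws_endos[OF q] is_path_up is_path_down
      by (auto simp: P_simps Gens2_P intro!: is_path_comp)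
    have e: "tdom P ?t \<in> endos ZA"
      using endos_comp[OF box_endos[OF p] box_endos[OF q]] by (simp add: P_simps path_comp_assoc)
        (simp add: path_comp_def)
    have "mu (syntactic_lax S) p q = tm_class P ?t"
      using w by (simp add: fun_simps C_simps HComp_class)
    moreover have "asem ?t = mu T (xval p) (xval q)"
      using Ws_endos[OF p] Ws_endos[OF q] p q
      by (simp add: P_simps act_Ws[OF p] act_Ws[OF q] xval_obj[OF p] xval_obj[OF q] obj_simps mu_arr A.arr_simps
          del: mem_Collect_eq)
    ultimately show ?thesis
      using mor_K(2)[OF w e] by (simp only: mor_H(1)[OF p] mor_H(1)[OF q])
  qed
  have 3: "FM (LK mor) (eps (syntactic_lax S)) = eps T"
  proof -
    have "wf_tm P (GenT Eta)" "tdom P (GenT Eta) \<in> endos ZA"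
      by (auto simp: Gens2_P P_simps endos_def is_path_def)
    then show ?thesis
      using homD[OF eps_hom] mor_K(2)[of "GenT Eta"] by (simp add: fun_simps A.ten_simps)
  qed
  have 4: "FO (LK mor) (FO (Fun (syntactic_lax S)) p) = Fo (FO (LH mor) p)" if "p \<in> Ws" for p
    using box_endos[OF that] aval_box[OF that] mor_K(1) mor_H(1)[OF that] by (simp only: fun_simps(1))
  have 5: "functor_extensional (Source (syntactic_lax S)) (LH mor)"
    "functor_extensional (Target (syntactic_lax S)) (LK mor)"
    by (simp_all add: mor_def functor_extensional_def)
  show ?thesis
    unfolding is_lax_mor_def Let_def mor_ends source_simps
    by (intro conjI ballI syntactic_lax lax mor_H_functor mor_K_functor 1 2 3 4 5)
qed

end

section \<open>Uniqueness of morphisms out of the syntactic lax functor\<close>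

locale lax_from_syntactic = signature S + lax_morphism m
  for S :: "'u fsig" and m :: "('u syn1, 'u syn2, 'u syn1, 'u syn2, 'xo, 'xm, 'ao, 'am) lax_mor" +
  assumes dom: "LDom m = syntactic_lax S"
begin

text \<open>The restrictions make the data equal for any two morphisms that agree on the generators.\<close>

definition h where "h = restrict (\<lambda>u. FO (LK m) (apath [u])) (AObj S)"
definition k where "k = restrict (\<lambda>u. FO (LH m) (xpath [u])) (XObj S)"
definition pl where
  "pl us vs = restrict (\<lambda>e. FM (LK m) (tm_class P (GenT (PlainG us vs e)))) (Plain S us vs)"
definition fb where
  "fb us vs = restrict (\<lambda>e. FM (LH m) (tm_class P (GenT (FBoxG us vs e)))) (FBox S us vs)"
definition ib where
  "ib us vs = restrict (\<lambda>e. FM (LK m) (tm_class P (GenT (InG us vs e)))) (InBox S us vs)"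
definition ob where
  "ob us vs = restrict (\<lambda>e. FM (LK m) (tm_class P (GenT (OutG us vs e)))) (OutBox S us vs)"

lemma apath_endos: "us \<in> lists (AObj S) \<Longrightarrow> apath us \<in> endos ZA"
  by (simp add: endos_def is_path_apath del: in_lists_conv_set)

lemma xpath_Ws: "us \<in> lists (XObj S) \<Longrightarrow> xpath us \<in> Ws"
  by blast

lemma boxpath_endos: "us \<in> lists (XObj S) \<Longrightarrow> boxpath us \<in> endos ZA"
  by (simp add: endos_def is_path_boxpath del: in_lists_conv_set)

lemma K_unit: "FO (LK m) (ZA, [], ZA) = Unit (Target (LCod m))"
  using K.map_unit by (simp add: dom target_simps)

lemma H_unit: "FO (LH m) (ZX, [], ZX) = Unit (Source (LCod m))"
  using H.map_unit by (simp add: dom source_simps)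

lemma K_path_comp: "p \<in> endos ZA \<Longrightarrow> q \<in> endos ZA \<Longrightarrow>
    FO (LK m) (path_comp p q) = TenO (Target (LCod m)) (FO (LK m) p) (FO (LK m) q)"
  using K.map_ten_obj[of p q] by (simp add: dom target_simps)

lemma H_path_comp: "p \<in> Ws \<Longrightarrow> q \<in> Ws \<Longrightarrow>
    FO (LH m) (path_comp p q) = TenO (Source (LCod m)) (FO (LH m) p) (FO (LH m) q)"
  using H.map_ten_obj[of p q] by (simp only: dom source_simps)

lemma K_obj: "p \<in> endos ZA \<Longrightarrow> FO (LK m) p \<in> Obj (Target (LCod m))"
  using K.map_obj[of p] by (simp add: dom target_simps)

lemma H_obj: "p \<in> Ws \<Longrightarrow> FO (LH m) p \<in> Obj (Source (LCod m))"
  using H.map_obj[of p] by (simp only: dom source_simps)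

lemma K_hom: "wf_tm P t \<Longrightarrow> tdom P t \<in> endos ZA \<Longrightarrow>
    FM (LK m) (tm_class P t) \<in> hom (Target (LCod m)) (FO (LK m) (tdom P t)) (FO (LK m) (tcod P t))"
  by (rule K.map_hom, unfold dom target_hom) blast

lemma H_hom: "wf_tm P t \<Longrightarrow> tdom P t \<in> Ws \<Longrightarrow>
    FM (LH m) (tm_class P t) \<in> hom (Source (LCod m)) (FO (LH m) (tdom P t)) (FO (LH m) (tcod P t))"
  by (rule H.map_hom, unfold dom source_hom) blast

lemma K_box: "us \<in> lists (XObj S) \<Longrightarrow> FO (LK m) (boxpath us) = FO (Fun (LCod m)) (FO (LH m) (xpath us))"
  unfolding boxpath_eq using fun_obj[of "xpath us"] xpath_Ws[of us] by (simp only: dom source_simps fun_simps)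

lemma K_apath: "us \<in> lists (AObj S) \<Longrightarrow> FO (LK m) (apath us) = tens (Target (LCod m)) (map h us)"
proof (induction us)
  case Nil
  then show ?case by (simp add: apath_def K_unit)
next
  case (Cons u us)
  have "apath (u # us) = path_comp (apath [u]) (apath us)" by (simp add: apath_def)
  then show ?case
    using Cons K_path_comp[OF apath_endos[of "[u]"] apath_endos[of us]] by (simp add: h_def)
qed

lemma H_xpath: "us \<in> lists (XObj S) \<Longrightarrow> FO (LH m) (xpath us) = tens (Source (LCod m)) (map k us)"
proof (induction us)
  case Nil
  then show ?case by (simp add: xpath_def H_unit)
next
  case (Cons u us)
  have "xpath (u # us) = path_comp (xpath [u]) (xpath us)" by (simp add: xpath_def)
  then show ?case
    using Cons H_path_comp[OF xpath_Ws[of "[u]"] xpath_Ws[of us]] by (simp add: k_def)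
qed

text \<open>The values of \<open>m\<close> on generators determine a morphism \<open>I.mor\<close>;
  the remaining task is to show that it is \<open>m\<close> itself.\<close>

sublocale I: interpretation_data S "LCod m" h k pl ib ob fb
proof unfold_locales
  show "h u \<in> Obj (Target (LCod m))" if "u \<in> AObj S" for u
    using K_obj[OF apath_endos[of "[u]"]] that by (simp add: h_def)
  show "k u \<in> Obj (Source (LCod m))" if "u \<in> XObj S" for u
    using H_obj[OF xpath_Ws[of "[u]"]] that by (simp add: k_def)
  fix us vs e
  {
    assume e: "e \<in> Plain S us vs"
    note l = fsig_listsD(1)[OF fsig e]
    have "wf_tm P (GenT (PlainG us vs e))" using e by (simp add: Gens2_P)
    from K_hom[OF this] show "pl us vs e \<in> hom (Target (LCod m))
        (tens (Target (LCod m)) (map h us)) (tens (Target (LCod m)) (map h vs))"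
      using l e by (simp add: P_simps pl_def apath_endos K_apath del: in_lists_conv_set)
  next
    assume e: "e \<in> FBox S us vs"
    note l = fsig_listsD(2)[OF fsig e]
    have "wf_tm P (GenT (FBoxG us vs e))" using e by (simp add: Gens2_P)
    from H_hom[OF this] show "fb us vs e \<in> hom (Source (LCod m))
        (tens (Source (LCod m)) (map k us)) (tens (Source (LCod m)) (map k vs))"
      using l e xpath_Ws[of us] by (simp add: P_simps fb_def H_xpath del: in_lists_conv_set)
  next
    assume e: "e \<in> InBox S us vs"
    note l = fsig_listsD(3)[OF fsig e]
    have "wf_tm P (GenT (InG us vs e))" using e by (simp add: Gens2_P)
    from K_hom[OF this] show "ib us vs e \<in> hom (Target (LCod m))
        (tens (Target (LCod m)) (map h us)) (FO (Fun (LCod m)) (tens (Source (LCod m)) (map k vs)))"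
      using l e by (simp add: P_simps ib_def apath_endos K_apath K_box H_xpath del: in_lists_conv_set)
  next
    assume e: "e \<in> OutBox S us vs"
    note l = fsig_listsD(4)[OF fsig e]
    have "wf_tm P (GenT (OutG us vs e))" using e by (simp add: Gens2_P)
    from K_hom[OF this] show "ob us vs e \<in> hom (Target (LCod m))
        (FO (Fun (LCod m)) (tens (Source (LCod m)) (map k us))) (tens (Target (LCod m)) (map h vs))"
      using l e by (simp add: P_simps ob_def boxpath_endos K_apath K_box H_xpath del: in_lists_conv_set)
  }
qed

lemma H_xval: "p \<in> Ws \<Longrightarrow> FO (LH m) p = I.xval p"
  unfolding Ws_iff using H_xpath I.xval_xpath by metis

lemma H_xsem: "wf_tm P t \<Longrightarrow> tdom P t \<in> Ws \<Longrightarrow> FM (LH m) (tm_class P t) = I.xsem t"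
proof (induction t)
  case (IdT p)
  then show ?case
    using H.map_id[of p] H_xval[of p] by (simp only: dom source_simps C_simps tdom.simps I.xsem.simps)
next
  case (GenT g)
  then obtain us vs e where g: "g = FBoxG us vs e" "e \<in> FBox S us vs" using gen_Ws by (auto simp: P_simps)
  show ?case unfolding g(1) I.xsem.simps gen2.case using g(2) by (simp add: fb_def)
next
  case (VT s t)
  then have d: "wf_tm P s" "wf_tm P t" "tdom P s \<in> Ws" "tdom P t \<in> Ws" "tcod P s = tdom P t"
    using Ws_tcod[of s] by auto
  have "tm_class P s \<in> hom (Source (LDom m)) (tdom P s) (tdom P t)"
    "tm_class P t \<in> hom (Source (LDom m)) (tdom P t) (tcod P t)"
    unfolding dom source_hom using d by blast+
  from H.map_comp[OF this] show ?case
    using VComp_class[OF VT.prems(1)] VT.IH d by (simp add: dom source_simps)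
next
  case (HT s t)
  note w = Ws_HT[OF HT.prems]
  have d: "wf_tm P s" "wf_tm P t" using HT.prems by auto
  have "tm_class P s \<in> Arr (Source (LDom m))" "tm_class P t \<in> Arr (Source (LDom m))"
    unfolding dom source_Arr using d w by blast+
  from H.map_ten[OF this] show ?case
    using HComp_class[OF HT.prems(1)] HT.IH d w by (simp add: dom source_simps)
qed

text \<open>The functor \<open>LK m\<close> respects composition only of endo-paths of
  \<open>ZA\<close>, so a path that starts inside a box has no value. In that case the statement
  puts \<open>Up\<close> and an arbitrary initial content \<open>ys\<close> in front, and
  \<open>ys\<close> serves as an accumulator for the induction.\<close>

lemma K_path_from:
  "path_from P c gs ZA \<Longrightarrow> case c of
     ZA \<Rightarrow> FO (LK m) (ZA, gs, ZA) = snd (I.ract (ZA, gs, ZA) I.e2)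
   | ZX \<Rightarrow> \<forall>ys \<in> lists (XObj S). FO (LK m) (ZA, Up # map GX ys @ gs, ZA) =
       TenO (Target (LCod m)) (FO (Fun (LCod m)) (TenO (Source (LCod m)) (tens (Source (LCod m)) (map k ys))
         (fst (I.ract (ZA, gs, ZA) I.e2)))) (snd (I.ract (ZA, gs, ZA) I.e2))"
proof (induction gs arbitrary: c)
  case Nil
  then show ?case by (simp add: K_unit)
next
  case (Cons g gs)
  note p = I.path_from_Cons[OF Cons.prems]
  note IH = Cons.IH[OF conjunct2[OF p]]
  have r: "I.rok (gen1_cod g) (I.ract (ZA, gs, ZA) I.e2)"
    using I.path_acts_ok(2)[OF conjunct2[OF p] I.e_ok(2)] .
  obtain x a where xa: "I.ract (ZA, gs, ZA) I.e2 = (x, a)" by (cases "I.ract (ZA, gs, ZA) I.e2")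
  have o: "x \<in> Obj (Source (LCod m))" "a \<in> Obj (Target (LCod m))" using r xa by auto
  show ?case
  proof (cases g)
    case (GA u)
    then have u: "u \<in> AObj S" "c = ZA" "path_from P ZA gs ZA" using Cons.prems by (auto simp: P_simps)
    have "(ZA, gs, ZA) \<in> endos ZA" "apath [u] \<in> endos ZA"
      using u apath_endos[of "[u]"] by (auto simp: endos_def is_path_def)
    moreover have "h u = FO (LK m) (ZA, [GA u], ZA)" using u by (simp add: h_def apath_def)
    ultimately show ?thesis
      using K_path_comp[of "apath [u]" "(ZA, gs, ZA)"] IH GA u xa by (simp add: apath_def)
  next
    case (GX u)
    then have u: "u \<in> XObj S" "c = ZX" "path_from P ZX gs ZA" using Cons.prems by (auto simp: P_simps)
    show ?thesis
      unfolding u(2) cell0.case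
    proof
      fix ys assume ys: "ys \<in> lists (XObj S)"
      \<comment> \<open>The box object \<open>u\<close> moves into the accumulated content.\<close>
      then have "ys @ [u] \<in> lists (XObj S)" using u by auto
      with IH GX have "FO (LK m) (ZA, Up # map GX (ys @ [u]) @ gs, ZA) =
         TenO (Target (LCod m)) (FO (Fun (LCod m)) (TenO (Source (LCod m))
           (tens (Source (LCod m)) (map k (ys @ [u]))) x)) a"
        using xa by (simp del: map_append in_lists_conv_set)
      moreover have "tens (Source (LCod m)) (map k (ys @ [u])) =
          TenO (Source (LCod m)) (tens (Source (LCod m)) (map k ys)) (k u)"
        using C.X.tens_append[of "map k ys" "[k u]"] I.map_objs(2)[OF ys] I.k[OF u(1)]
        by (simp add: C.X.ten_obj_unit_right)
      ultimately show "FO (LK m) (ZA, Up # map GX ys @ g # gs, ZA) =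
         TenO (Target (LCod m)) (FO (Fun (LCod m)) (TenO (Source (LCod m))
           (tens (Source (LCod m)) (map k ys)) (fst (I.ract (ZA, g # gs, ZA) I.e2))))
           (snd (I.ract (ZA, g # gs, ZA) I.e2))"
        using GX xa o I.k[OF u(1)] C.X.tens_obj[OF I.map_objs(2)[OF ys]]
        by (simp add: C.X.ten_obj_assoc)
    qed
  next
    case Up
    then have u: "c = ZA" "path_from P ZX gs ZA" using Cons.prems by (auto simp: P_simps)
    \<comment> \<open>A newly opened box has empty content, so the induction hypothesis is used at
      the empty list.\<close>
    then show ?thesis
      using IH Up xa o bspec[of "lists (XObj S)" _ "[]"] by (auto simp: C.X.ten_obj_unit_left dest: bspec[of _ _ "[]"])
  next
    case Down
    then have u: "c = ZX" "path_from P ZA gs ZA" using Cons.prems by (auto simp: P_simps)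
    show ?thesis
      unfolding u(1) cell0.case
    proof
      fix ys assume ys: "ys \<in> lists (XObj S)"
      \<comment> \<open>With \<open>Down\<close> the accumulated box is complete; it splits off as
        an endo-path whose value is given by \<open>K_box\<close>.\<close>
      have "(ZA, gs, ZA) \<in> endos ZA" using u by (auto simp: endos_def is_path_def)
      from K_path_comp[OF boxpath_endos[OF ys] this]
      show "FO (LK m) (ZA, Up # map GX ys @ g # gs, ZA) =
         TenO (Target (LCod m)) (FO (Fun (LCod m)) (TenO (Source (LCod m))
           (tens (Source (LCod m)) (map k ys)) (fst (I.ract (ZA, g # gs, ZA) I.e2))))
           (snd (I.ract (ZA, g # gs, ZA) I.e2))"
        using Down IH xa o ys C.X.tens_obj[OF I.map_objs(2)[OF ys]] K_box[OF ys] H_xpath[OF ys]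
        by (simp add: boxpath_def C.X.ten_obj_unit_right)
    qed
  qed
qed

lemma K_aval: "p \<in> endos ZA \<Longrightarrow> FO (LK m) p = I.aval p"
proof -
  assume p: "p \<in> endos ZA"
  then obtain gs where "p = (ZA, gs, ZA)" "path_from P ZA gs ZA"
    by (cases p) (auto simp: endos_def is_path_def)
  then show ?thesis using K_path_from[of ZA gs] I.act_endo(2)[OF p] by simp
qed

definition whisker :: "'u syn1 \<Rightarrow> 'u syn2 \<Rightarrow> 'u syn1 \<Rightarrow> 'u syn2" where
  "whisker L \<alpha> R = HComp C (Id2 C L) (HComp C \<alpha> (Id2 C R))"

abbreviation fits :: "'u syn1 \<Rightarrow> 'u syn1 \<Rightarrow> 'u syn1 \<Rightarrow> bool" where
  "fits L p R \<equiv> is_path P L \<and> is_path P R \<and> path_dom L = ZA \<and> path_cod R = ZA \<and>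
    path_cod L = path_dom p \<and> path_cod p = path_dom R"

lemma whisker_cell:
  assumes "cell \<alpha> p q" "fits L p R"
  shows "cell (whisker L \<alpha> R) (path_comp L (path_comp p R)) (path_comp L (path_comp q R))"
  unfolding whisker_def using assms by (intro hcomp_cell id_cell) auto

lemma K_VComp:
  assumes "cell \<alpha> p q" "cell \<beta> q r" "p \<in> endos ZA"
  shows "FM (LK m) (VComp C \<alpha> \<beta>) = FM (LK m) \<alpha> ;;\<^bsub>Target (LCod m)\<^esub> FM (LK m) \<beta>"
proof -
  have "q \<in> endos ZA" using assms cell_path[OF assms(1)] by (simp add: endos_def)
  then have "\<alpha> \<in> hom (Target (LDom m)) p q" "\<beta> \<in> hom (Target (LDom m)) q r"
    unfolding dom target_hom using assms unfolding cell_def by blast+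
  from K.map_comp[OF this] show ?thesis by (simp add: dom target_simps)
qed

lemma K_HComp:
  assumes "cell \<alpha> p q" "cell \<beta> p' q'" "p \<in> endos ZA" "p' \<in> endos ZA"
  shows "FM (LK m) (HComp C \<alpha> \<beta>) = TenA (Target (LCod m)) (FM (LK m) \<alpha>) (FM (LK m) \<beta>)"
proof -
  have "\<alpha> \<in> Arr (Target (LDom m))" "\<beta> \<in> Arr (Target (LDom m))"
    unfolding dom target_Arr using assms unfolding cell_def by blast+
  from K.map_ten[OF this] show ?thesis by (simp add: dom target_simps)
qed

lemma K_Id2: "p \<in> endos ZA \<Longrightarrow> FM (LK m) (Id2 C p) = Idn (Target (LCod m)) (I.aval p)"
  using K.map_id[of p] by (simp add: dom target_simps K_aval)

lemma endo_in: "is_path P p \<Longrightarrow> path_dom p = c \<Longrightarrow> path_cod p = c \<Longrightarrow> p \<in> endos c"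
  by (simp add: endos_def)

lemma K_whisker_endo:
  assumes "cell \<alpha> p q" "p \<in> endos ZA" "L \<in> endos ZA" "R \<in> endos ZA"
  shows "FM (LK m) (whisker L \<alpha> R) = TenA (Target (LCod m)) (Idn (Target (LCod m)) (I.aval L))
    (TenA (Target (LCod m)) (FM (LK m) \<alpha>) (Idn (Target (LCod m)) (I.aval R)))"
proof -
  note p = endosD[OF assms(2)] and L = endosD[OF assms(3)] and R = endosD[OF assms(4)]
  have "cell (HComp C \<alpha> (Id2 C R)) (path_comp p R) (path_comp q R)"
    using p R by (intro hcomp_cell assms(1) id_cell) auto
  moreover have "path_comp p R \<in> endos ZA" using p R by (intro endo_in is_path_comp) auto
  ultimately show ?thesis
    unfolding whisker_def using K_HComp[OF id_cell _ assms(3)] K_HComp[OF assms(1) id_cell assms(2,4)] L R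
      K_Id2 assms by simp
qed

lemma whisker_VComp:
  assumes "cell \<alpha> p q" "cell \<beta> q r" "fits L p R"
  shows "whisker L (VComp C \<alpha> \<beta>) R = VComp C (whisker L \<alpha> R) (whisker L \<beta> R)"
proof -
  have i: "cell (Id2 C L) L L" "cell (Id2 C R) R R" using assms(3) by (auto intro: id_cell)
  note q = cell_path[OF assms(1)]
  have h: "cell (HComp C \<alpha> (Id2 C R)) (path_comp p R) (path_comp q R)"
    "cell (HComp C \<beta> (Id2 C R)) (path_comp q R) (path_comp r R)"
    using assms q by (auto intro!: hcomp_cell i)
  have "HComp C (VComp C \<alpha> \<beta>) (VComp C (Id2 C R) (Id2 C R)) =
      VComp C (HComp C \<alpha> (Id2 C R)) (HComp C \<beta> (Id2 C R))"
    using assms by (intro interchange[OF assms(1,2) i(2) i(2)]) simp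
  moreover have "HComp C (VComp C (Id2 C L) (Id2 C L)) (VComp C (HComp C \<alpha> (Id2 C R)) (HComp C \<beta> (Id2 C R))) =
      VComp C (whisker L \<alpha> R) (whisker L \<beta> R)"
    unfolding whisker_def using assms by (intro interchange[OF i(1) i(1) h]) simp
  ultimately show ?thesis
    unfolding whisker_def by (simp add: vcomp_id_left[OF i(1)] vcomp_id_left[OF i(2)])
qed

text \<open>The left factor acts first, in accordance with the order chosen in \<open>sem\<close>,
  so that the recursion there matches this decomposition step by step.\<close>

lemma whisker_HComp:
  assumes a: "cell \<alpha> p q" and b: "cell \<beta> p' q'" and e: "path_cod p = path_dom p'"
    and f: "fits L (path_comp p p') R"
  shows "whisker L (HComp C \<alpha> \<beta>) R =
    VComp C (whisker L \<alpha> (path_comp p' R)) (whisker (path_comp L q) \<beta> R)"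
proof -
  note p = cell_path[OF a] and p' = cell_path[OF b]
  have i: "cell (Id2 C L) L L" "cell (Id2 C R) R R" "cell (Id2 C p') p' p'" "cell (Id2 C q) q q"
    using f p p' by (auto intro: id_cell)
  have 1: "HComp C (HComp C \<alpha> (Id2 C p')) (Id2 C R) = HComp C \<alpha> (Id2 C (path_comp p' R))"
    using hcomp_assoc[OF a i(3) i(2) e] f p' hcomp_id[of p' R] by simp
  have c: "cell (HComp C \<alpha> (Id2 C p')) (path_comp p p') (path_comp q p')"
    "cell (HComp C (Id2 C q) \<beta>) (path_comp q p') (path_comp q q')"
    using a b p e by (auto intro!: hcomp_cell i)
  have b': "cell (HComp C \<beta> (Id2 C R)) (path_comp p' R) (path_comp q' R)"
    using f by (intro hcomp_cell b i) auto
  have "HComp C (HComp C (Id2 C q) \<beta>) (Id2 C R) = HComp C (Id2 C q) (HComp C \<beta> (Id2 C R))"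
    using f p e by (intro hcomp_assoc[OF i(4) b i(2)]) auto
  then have 2: "whisker L (HComp C (Id2 C q) \<beta>) R = whisker (path_comp L q) \<beta> R"
    unfolding whisker_def using hcomp_assoc[OF i(1) i(4) b'] hcomp_id[of L q] f p e by simp
  have "HComp C \<alpha> \<beta> = VComp C (HComp C \<alpha> (Id2 C p')) (HComp C (Id2 C q) \<beta>)"
    using slide_left[OF a b e] by simp
  then show ?thesis
    using whisker_VComp[OF c, of L R] f 1 2 by (simp add: whisker_def)
qed

lemma path_to_ZX:
  assumes "is_path P L" "path_dom L = ZA" "path_cod L = ZX"
  obtains L' xs where "L = path_comp L' (path_comp up_path (xpath xs))" "xs \<in> lists (XObj S)" "L' \<in> endos ZA"
proof -
  obtain gs where L: "L = (ZA, gs, ZX)" "path_from P ZA gs ZX"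
    using assms by (cases L) (auto simp: is_path_def)
  obtain xs gs' where "xs \<in> lists (XObj S)" "gs = gs' @ Up # map GX xs" "path_from P ZA gs' ZA"
    using path_to_ZX_cases[OF L(2)] by auto
  then show ?thesis
    using that[of "(ZA, gs', ZA)" xs] L by (simp add: xpath_def endos_def is_path_def)
qed

lemma path_from_ZX:
  assumes "is_path P R" "path_dom R = ZX" "path_cod R = ZA"
  obtains R' xs where "R = path_comp (xpath xs) (path_comp down_path R')" "xs \<in> lists (XObj S)" "R' \<in> endos ZA"
proof -
  obtain gs where R: "R = (ZX, gs, ZA)" "path_from P ZX gs ZA"
    using assms by (cases R) (auto simp: is_path_def)
  obtain xs gs' where "xs \<in> lists (XObj S)" "gs = map GX xs @ Down # gs'" "path_from P ZA gs' ZA"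
    using path_from_ZX_cases[OF R(2)] by auto
  then show ?thesis
    using that[of xs "(ZA, gs', ZA)"] R by (simp add: xpath_def endos_def is_path_def)
qed

text \<open>Whiskering can be done in stages, which separates the part of a context inside the
  current box from the part outside.\<close>

lemma whisker_comp:
  assumes "cell \<alpha> p q" "is_path P L" "is_path P L'" "is_path P R" "is_path P R'"
    "path_cod L' = path_dom L" "path_cod L = path_dom p" "path_cod p = path_dom R" "path_cod R = path_dom R'"
  shows "whisker (path_comp L' L) \<alpha> (path_comp R R') = whisker L' (whisker L \<alpha> R) R'"
proof -
  have i: "cell (Id2 C L) L L" "cell (Id2 C L') L' L'" "cell (Id2 C R) R R" "cell (Id2 C R') R' R'"
    using assms by (auto intro: id_cell)
  have c: "cell (HComp C \<alpha> (Id2 C R)) (path_comp p R) (path_comp q R)"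
    using assms by (intro hcomp_cell i) auto
  have c': "cell (HComp C (HComp C \<alpha> (Id2 C R)) (Id2 C R')) (path_comp (path_comp p R) R') (path_comp (path_comp q R) R')"
    using assms by (intro hcomp_cell c i) auto
  have "HComp C (HComp C (Id2 C L) (HComp C \<alpha> (Id2 C R))) (Id2 C R') =
      HComp C (Id2 C L) (HComp C (HComp C \<alpha> (Id2 C R)) (Id2 C R'))"
    using assms by (intro hcomp_assoc[OF i(1) c i(4)]) auto
  moreover have "HComp C (Id2 C L') (HComp C (Id2 C L) (HComp C (HComp C \<alpha> (Id2 C R)) (Id2 C R'))) =
      HComp C (Id2 C (path_comp L' L)) (HComp C (HComp C \<alpha> (Id2 C R)) (Id2 C R'))"
    using assms by (simp add: hcomp_assoc[OF i(2,1) c', symmetric] hcomp_id)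
  moreover have "HComp C (HComp C \<alpha> (Id2 C R)) (Id2 C R') = HComp C \<alpha> (Id2 C (path_comp R R'))"
    using assms by (simp add: hcomp_assoc[OF _ i(3,4)] hcomp_id)
  ultimately show ?thesis by (simp add: whisker_def)
qed

text \<open>Preservation of \<open>eps\<close> and \<open>mu\<close> and compatibility with the
  functors enter here. A generator based at \<open>ZA\<close> is a tensor factor of its closed
  context; one based at \<open>ZX\<close> is accessible only together with the box around
  it.\<close>

lemma K_gen:
  assumes g: "g \<in> Gens2 P" and f: "fits L (gen2_dom g) R"
  shows "FM (LK m) (whisker L (tm_class P (GenT g)) R) = I.sem (GenT g) (I.lact L I.e1) (I.ract R I.e2)"
proof -
  have w: "wf_tm P (GenT g)" using g by simp
  have c: "cell (tm_class P (GenT g)) (gen2_dom g) (gen2_cod g)"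
    using cellI[OF w] by (simp add: P_simps)
  show ?thesis
  proof (cases "path_dom (gen2_dom g)")
    case ZA
    then have e: "gen2_dom g \<in> endos ZA" "path_cod (gen2_dom g) = ZA"
      using g wf_path[OF w] by (cases g; simp add: P_simps endos_def)+
    then have LR: "L \<in> endos ZA" "R \<in> endos ZA" using f ZA by (auto simp: endos_def)
    have "FM (LK m) (tm_class P (GenT g)) = I.core g x x'" for x x'
      using ZA map_eps g by (cases g) (simp_all add: dom fun_simps pl_def ib_def ob_def Gens2_P)
    then show ?thesis
      using K_whisker_endo[OF c e(1) LR] I.act_endo(1)[OF LR(1)] I.act_endo(2)[OF LR(2)] by simp
  next
    case ZX
    then have ex: "path_cod (gen2_dom g) = ZX" by (cases g) auto
    have fL: "is_path P L" "path_dom L = ZA" "path_cod L = ZX" and fR: "is_path P R" "path_dom R = ZX" "path_cod R = ZA"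
      using f ZX ex by auto
    obtain L' xs where L: "L = path_comp L' (path_comp up_path (xpath xs))" "xs \<in> lists (XObj S)" "L' \<in> endos ZA"
      by (rule path_to_ZX[OF fL])
    obtain R' ys where R: "R = path_comp (xpath ys) (path_comp down_path R')" "ys \<in> lists (XObj S)" "R' \<in> endos ZA"
      by (rule path_from_ZX[OF fR])
    note x = xpath_Ws[OF L(2)] and y = xpath_Ws[OF R(2)]
    note px = Ws_endos[OF x] and py = Ws_endos[OF y] and L' = endosD[OF L(3)] and R' = endosD[OF R(3)]
    have pu: "is_path P (path_comp up_path (xpath xs))" "is_path P (path_comp (xpath ys) down_path)"
      using px py is_path_up is_path_down by (auto intro: is_path_comp)
    have lact: "I.lact L I.e1 = (I.aval L', I.xval (xpath xs))" and ract: "I.ract R I.e2 = (I.xval (xpath ys), I.aval R')"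
      using I.act_endo[OF L(3)] I.act_endo[OF R(3)] I.act_Ws(1)[OF x] I.act_Ws(2)[OF y] I.xval_obj[OF x] I.xval_obj[OF y]
      unfolding L(1) R(1) by (simp_all add: C.X.ten_obj_unit_left C.X.ten_obj_unit_right C.X.unit_obj)
    \<comment> \<open>The generator with its surrounding box and nothing else: the smallest
      endo-cell of \<open>ZA\<close> that contains it.\<close>
    let ?b = "whisker (path_comp up_path (xpath xs)) (tm_class P (GenT g)) (path_comp (xpath ys) down_path)"
    let ?q = "path_comp (path_comp up_path (xpath xs)) (path_comp (gen2_dom g) (path_comp (xpath ys) down_path))"
    have split: "whisker L (tm_class P (GenT g)) R = whisker L' ?b R'"
      unfolding L(1) R(1) path_comp_assoc[symmetric, of "xpath ys"] using L' R' pu px py ZX ex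
      by (intro whisker_comp[OF c]) auto
    have b: "cell ?b ?q (path_comp (path_comp up_path (xpath xs)) (path_comp (gen2_cod g) (path_comp (xpath ys) down_path)))"
      using pu px py ZX ex by (intro whisker_cell[OF c]) auto
    have q: "?q \<in> endos ZA"
      using cell_path[OF b] px py by (intro endo_in) auto
    have "FM (LK m) ?b = I.core g (I.xval (xpath xs)) (I.xval (xpath ys))"
    proof (cases g)
      case Counit
      \<comment> \<open>Up to bracketing, a boxed counit is by definition a component of the
        syntactic \<open>mu\<close>.\<close>
      have "?b = mu (syntactic_lax S) (xpath xs) (xpath ys)"
        unfolding whisker_def fun_simps Counit[symmetric]
        by (rule hcomp_assoc[symmetric, OF id_cell[OF pu(1)] c id_cell[OF pu(2)]]) (use px py ZX ex in auto)
      then show ?thesis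
        using map_mu[of "xpath xs" "xpath ys"] x y H_xval[OF x] H_xval[OF y] Counit
        by (simp only: dom source_simps I.core.simps)
    next
      case (FBoxG us vs e)
      have e: "e \<in> FBox S us vs" using g FBoxG by (simp add: Gens2_P)
      have ug: "gen2_dom g \<in> Ws" using gen_Ws[OF g] FBoxG e by blast
      \<comment> \<open>Whiskering within the box first yields a cell of the source category, to
        which the box then applies the syntactic functor.\<close>
      have "?b = whisker up_path (whisker (xpath xs) (tm_class P (GenT g)) (xpath ys)) down_path"
        using px py ZX ex is_path_up is_path_down by (intro whisker_comp[OF c]) auto
      also have "\<dots> = FM (Fun (syntactic_lax S)) (whisker (xpath xs) (tm_class P (GenT g)) (xpath ys))"
      proof -
        have "cell (whisker (xpath xs) (tm_class P (GenT g)) (xpath ys))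
            (path_comp (xpath xs) (path_comp (gen2_dom g) (xpath ys)))
            (path_comp (xpath xs) (path_comp (gen2_cod g) (xpath ys)))"
          unfolding whisker_def using px py ZX ex by (intro hcomp_cell id_cell c) auto
        then show ?thesis
          unfolding whisker_def[of up_path] fun_simps
          by (intro hcomp_assoc[symmetric, OF id_cell[OF is_path_up] _ id_cell[OF is_path_down]]) (use px py in auto)
      qed
      finally have 1: "?b = FM (Fun (syntactic_lax S)) (whisker (xpath xs) (tm_class P (GenT g)) (xpath ys))" .
      let ?t = "HT (IdT (xpath xs)) (HT (GenT g) (IdT (xpath ys)))"
      have wt: "wf_tm P ?t" using g px py ZX ex by (simp add: P_simps)
      have dt: "tdom P ?t \<in> Ws" using adj.Ws(3)[OF x adj.Ws(3)[OF ug y]] by (simp only: tdom.simps P_simps)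
      have 2: "whisker (xpath xs) (tm_class P (GenT g)) (xpath ys) = tm_class P ?t"
        unfolding whisker_def C_simps using wt by (simp add: HComp_class)
      have "tm_class P ?t \<in> Arr (Source (syntactic_lax S))"
        unfolding source_Arr using wt dt by blast
      then have "FM (LK m) ?b = FM (Fun (LCod m)) (I.xsem ?t)"
        unfolding 1 2 using fun_arr H_xsem[OF wt dt] by (simp only: dom)
      then show ?thesis using FBoxG by simp
    qed (use ZX in auto)
    then show ?thesis
      unfolding split lact ract using K_whisker_endo[OF b q L(3) R(3)] by simp
  qed
qed

text \<open>In a closing context every term constructor becomes a vertical composite or a whiskered
  generator, and the functor \<open>LK m\<close> is known on these. Contexts must vary, since
  horizontal composites enlarge them.\<close>

lemma K_whisker:
  assumes "wf_tm P t" "fits L (tdom P t) R"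
  shows "FM (LK m) (whisker L (tm_class P t) R) = I.sem t (I.lact L I.e1) (I.ract R I.e2)"
  using assms
proof (induction t arbitrary: L R)
  case (IdT p)
  then have p: "is_path P p" "fits L p R" by auto
  have LpR: "path_comp L (path_comp p R) \<in> endos ZA"
    using p by (intro endo_in is_path_comp) auto
  have "whisker L (tm_class P (IdT p)) R = Id2 C (path_comp L (path_comp p R))"
    using p hcomp_id[of p R] hcomp_id[of L "path_comp p R"] by (simp add: whisker_def C_simps is_path_comp)
  moreover have "I.aval (path_comp L (path_comp p R)) = I.join (path_dom p) (I.lact L I.e1) (I.ract p (I.ract R I.e2))"
    using I.join_endo[OF LpR] I.join_act[of L I.e1 "I.ract p (I.ract R I.e2)"] p
      I.act_ok(2)[of p "I.ract R I.e2"] I.act_ok(2)[of R I.e2] I.e_ok by simp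
  ultimately show ?case using K_Id2[OF LpR] by simp
next
  case (GenT g)
  then show ?case using K_gen by (simp only: wf_tm.simps tdom.simps P_simps)
next
  case (VT s t)
  then have w: "wf_tm P s" "wf_tm P t" "tcod P s = tdom P t" "fits L (tdom P s) R" by auto
  have f: "fits L (tdom P t) R" using w wf_path[OF w(1)] by auto
  have c: "cell (tm_class P s) (tdom P s) (tdom P t)" "cell (tm_class P t) (tdom P t) (tcod P t)"
    using cellI[OF w(1)] cellI[OF w(2)] w(3) by auto
  have "path_comp L (path_comp (tdom P s) R) \<in> endos ZA"
    using w wf_path[OF w(1)] by (intro endo_in is_path_comp) auto
  from K_VComp[OF whisker_cell[OF c(1) w(4)] whisker_cell[OF c(2) f] this]
  show ?case
    using whisker_VComp[OF c w(4)] VComp_class[OF VT.prems(1)] VT.IH(1)[OF w(1,4)] VT.IH(2)[OF w(2) f] by simp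
next
  case (HT s t)
  then have w: "wf_tm P s" "wf_tm P t" "path_cod (tdom P s) = path_dom (tdom P t)"
    "fits L (path_comp (tdom P s) (tdom P t)) R" by auto
  note ps = wf_path[OF w(1)] and pt = wf_path[OF w(2)]
  have f: "fits L (tdom P s) (path_comp (tdom P t) R)" "fits (path_comp L (tcod P s)) (tdom P t) R"
    using w ps pt by (auto intro: is_path_comp)
  note c = cellI[OF w(1)] cellI[OF w(2)]
  have "path_comp L (path_comp (tdom P s) (path_comp (tdom P t) R)) \<in> endos ZA"
    using w ps pt by (intro endo_in is_path_comp) auto
  from K_VComp[OF whisker_cell[OF c(1) f(1)] _ this] whisker_cell[OF c(2) f(2)]
  show ?case
    using whisker_HComp[OF c w(3,4)] HComp_class[OF HT.prems(1)] HT.IH(1)[OF w(1) f(1)] HT.IH(2)[OF w(2) f(2)]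
    by (simp add: path_comp_assoc)
qed

lemma K_asem:
  assumes "wf_tm P t" "tdom P t \<in> endos ZA"
  shows "FM (LK m) (tm_class P t) = I.asem t"
proof -
  let ?e = "(ZA, [], ZA)"
  have "fits ?e (tdom P t) ?e" using endosD[OF assms(2)] by (simp add: is_path_empty Gens0_P)
  moreover have "whisker ?e (tm_class P t) ?e = tm_class P t"
    unfolding whisker_def using cellI[OF assms(1)] endosD[OF assms(2)]
    by (simp add: hcomp_id_left hcomp_id_right)
  ultimately show ?thesis using K_whisker[OF assms(1), of ?e ?e] by simp
qed

lemma eq_mor: "m = I.mor"
proof (rule lax_mor_eqI[OF mor I.mor_is_lax_mor])
  show "LDom m = LDom I.mor" "LCod m = LCod I.mor" by (simp_all add: I.mor_ends dom)
  show "FO (LH m) p = FO (LH I.mor) p" if "p \<in> Obj (Source (LDom m))" for p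
    using that H_xval I.mor_H(1) by (simp only: dom source_simps)
  show "FO (LK m) p = FO (LK I.mor) p" if "p \<in> Obj (Target (LDom m))" for p
    using that K_aval I.mor_K(1) by (simp only: dom target_simps)
  show "FM (LH m) f = FM (LH I.mor) f" if f: "f \<in> Arr (Source (LDom m))" for f
  proof -
    obtain t where t: "wf_tm P t" "tdom P t \<in> Ws" "f = tm_class P t"
      using f unfolding dom source_Arr by blast
    show ?thesis unfolding t(3) H_xsem[OF t(1,2)] I.mor_H(2)[OF t(1,2)] ..
  qed
  show "FM (LK m) f = FM (LK I.mor) f" if f: "f \<in> Arr (Target (LDom m))" for f
  proof -
    obtain t where t: "wf_tm P t" "tdom P t \<in> endos ZA" "f = tm_class P t"
      using f unfolding dom target_Arr by blast
    show ?thesis unfolding t(3) K_asem[OF t(1,2)] I.mor_K(2)[OF t(1,2)] ..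
  qed
qed

end

section \<open>Relabelling the generators\<close>

context fsig_morphism
begin

sublocale D: signature "SDom m"
  by unfold_locales (rule dom_cod)

sublocale C: signature "SCod m"
  by unfold_locales (rule dom_cod)

abbreviation relabel :: "(cell0, 'u gen1, 'u gen2) tm \<Rightarrow> (cell0, 'u gen1, 'u gen2) tm" where
  "relabel \<equiv> map_tm (\<lambda>c. c) (gen1_map m) (gen2_map m)"

lemma syn1_map_simps [simp]:
  "syn1_map m (c, gs, d) = (c, map (gen1_map m) gs, d)"
  "syn1_map m (path_comp p q) = path_comp (syn1_map m p) (syn1_map m q)"
  "path_dom (syn1_map m p) = path_dom p" "path_cod (syn1_map m p) = path_cod p"
  "map_prod (\<lambda>c. c) (map_prod (map (gen1_map m)) (\<lambda>c. c)) p = syn1_map m p"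
  by (simp_all add: syn1_map_def path_comp_def path_dom_def path_cod_def prod_eq_iff)

lemma syn1_map_paths:
  "syn1_map m (apath us) = apath (map (hobj m) us)" "syn1_map m (xpath us) = xpath (map (kobj m) us)"
  "syn1_map m (boxpath us) = boxpath (map (kobj m) us)"
  by (simp_all add: apath_def xpath_def boxpath_def)

lemma path_from_relabel: "path_from D.P c gs d \<Longrightarrow> path_from C.P c (map (gen1_map m) gs) d"
proof (induction gs arbitrary: c)
  case (Cons g gs)
  then show ?case
    by (cases g) (auto simp: D.P_simps C.P_simps hobj kobj)
qed (simp add: C.Gens0_P)

lemma is_path_relabel: "is_path D.P p \<Longrightarrow> is_path C.P (syn1_map m p)"
  by (cases p) (auto simp: is_path_def path_from_relabel)

lemma gen2_relabel:
  "g \<in> Gens2 D.P \<Longrightarrow> gen2_map m g \<in> Gens2 C.P"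
  "gen2_dom (gen2_map m g) = syn1_map m (gen2_dom g)"
  "gen2_cod (gen2_map m g) = syn1_map m (gen2_cod g)"
  by (cases g; simp add: D.Gens2_P C.Gens2_P hPlain hFBox hInBox hOutBox syn1_map_paths)+

lemma relabel_ends:
  "tdom C.P (relabel t) = syn1_map m (tdom D.P t)" "tcod C.P (relabel t) = syn1_map m (tcod D.P t)"
  by (induction t) (simp_all add: D.P_simps C.P_simps gen2_relabel)

lemma relabel_wf: "wf_tm D.P t \<Longrightarrow> wf_tm C.P (relabel t)"
  by (induction t) (simp_all add: is_path_relabel gen2_relabel relabel_ends)

text \<open>The congruence rules are schematic in the generators, and the two snake equations
  mention only \<open>Eta\<close>, \<open>Counit\<close>, \<open>Up\<close> and \<open>Down\<close>,
  which relabelling leaves fixed.\<close>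

lemma relabel_eq: "tm_eq D.P s t \<Longrightarrow> tm_eq C.P (relabel s) (relabel t)"
proof (induction rule: tm_eq.induct)
  case (refl t)
  then show ?case by (intro tm_eq.refl relabel_wf)
next
  case (sym s t)
  show ?case by (rule tm_eq.sym[OF sym.IH])
next
  case (trans s t u)
  show ?case by (rule tm_eq.trans[OF trans.IH])
next
  case (vcong s s' t t')
  then show ?case using relabel_wf[OF vcong.hyps(3)] by (simp add: tm_eq.vcong)
next
  case (hcong s s' t t')
  then show ?case using relabel_wf[OF hcong.hyps(3)] by (simp add: tm_eq.hcong)
next
  case (vid_left t)
  then show ?case using tm_eq.vid_left[OF relabel_wf] by (simp add: relabel_ends)
next
  case (vid_right t)
  then show ?case using tm_eq.vid_right[OF relabel_wf] by (simp add: relabel_ends)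
next
  case (vassoc s t u)
  then show ?case using tm_eq.vassoc[of C.P "relabel s" "relabel t" "relabel u"] relabel_wf[OF vassoc] by simp
next
  case (hid_left t c)
  then show ?case using tm_eq.hid_left[OF relabel_wf, of t c] by (simp add: relabel_ends)
next
  case (hid_right t d)
  then show ?case using tm_eq.hid_right[OF relabel_wf, of t d] by (simp add: relabel_ends)
next
  case (hassoc s t u)
  then show ?case using tm_eq.hassoc[of C.P "relabel s" "relabel t" "relabel u"] relabel_wf[OF hassoc] by simp
next
  case (hid_comp p q)
  then show ?case using tm_eq.hid_comp[of C.P "syn1_map m p" "syn1_map m q"] relabel_wf[OF hid_comp] by simp
next
  case (interchange s t s' t')
  then show ?case
    using tm_eq.interchange[of C.P "relabel s" "relabel t" "relabel s'" "relabel t'"] relabel_wf[OF interchange]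
    by simp
next
  case (relation s t)
  then show ?case using C.rel_up C.rel_down by (auto simp: D.P_simps)
qed

lemma syn2_map_class: "wf_tm D.P t \<Longrightarrow> syn2_map m (tm_class D.P t) = tm_class C.P (relabel t)"
  unfolding syn2_map_def by (rule C.tm_class_eq[OF tm_eq.sym[OF relabel_eq[OF D.rep_class]]])

lemma syn1_map_Ws: "p \<in> D.Ws \<Longrightarrow> syn1_map m p \<in> C.Ws"
proof -
  assume "p \<in> D.Ws"
  then obtain us where us: "us \<in> lists (XObj (SDom m))" "p = xpath us" by blast
  then have "map (kobj m) us \<in> lists (XObj (SCod m))" using kobj by auto
  then show ?thesis unfolding us(2) syn1_map_paths by blast
qed

lemma syn1_map_endos: "p \<in> D.endos c \<Longrightarrow> syn1_map m p \<in> C.endos c"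
  by (simp add: D.endos_def C.endos_def is_path_relabel)

lemma syn_simps:
  "LDom (syntactic_lax_mor m) = syntactic_lax (SDom m)" "LCod (syntactic_lax_mor m) = syntactic_lax (SCod m)"
  "LH (syntactic_lax_mor m) = syn_functor m (Source (syntactic_lax (SDom m)))"
  "LK (syntactic_lax_mor m) = syn_functor m (Target (syntactic_lax (SDom m)))"
  by (simp_all add: syntactic_lax_mor_def Let_def)

abbreviation "synH \<equiv> syn_functor m (Source (syntactic_lax (SDom m)))"
abbreviation "synK \<equiv> syn_functor m (Target (syntactic_lax (SDom m)))"

lemma syn_functor_simps:
  "p \<in> D.Ws \<Longrightarrow> FO synH p = syn1_map m p"
  "p \<in> D.endos ZA \<Longrightarrow> FO synK p = syn1_map m p"
  "wf_tm D.P t \<Longrightarrow> tdom D.P t \<in> D.Ws \<Longrightarrow> FM synH (tm_class D.P t) = tm_class C.P (relabel t)"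
  "wf_tm D.P t \<Longrightarrow> tdom D.P t \<in> D.endos ZA \<Longrightarrow> FM synK (tm_class D.P t) = tm_class C.P (relabel t)"
proof -
  assume t: "wf_tm D.P t"
  {
    assume "tdom D.P t \<in> D.Ws"
    then have "tm_class D.P t \<in> Arr (Source (syntactic_lax (SDom m)))" unfolding D.source_Arr using t by blast
    then show "FM synH (tm_class D.P t) = tm_class C.P (relabel t)"
      using t by (simp add: syn_functor_def syn2_map_class)
  next
    assume "tdom D.P t \<in> D.endos ZA"
    then have "tm_class D.P t \<in> Arr (Target (syntactic_lax (SDom m)))" unfolding D.target_Arr using t by blast
    then show "FM synK (tm_class D.P t) = tm_class C.P (relabel t)"
      using t by (simp add: syn_functor_def syn2_map_class)
  }
qed (simp_all add: syn_functor_def D.source_simps D.target_simps)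

lemma relabel_hom:
  "wf_tm D.P t \<Longrightarrow> tdom D.P t \<in> D.Ws \<Longrightarrow> tm_class C.P (relabel t) \<in>
    hom (Source (syntactic_lax (SCod m))) (syn1_map m (tdom D.P t)) (syn1_map m (tcod D.P t))"
  "wf_tm D.P t \<Longrightarrow> tdom D.P t \<in> D.endos ZA \<Longrightarrow> tm_class C.P (relabel t) \<in>
    hom (Target (syntactic_lax (SCod m))) (syn1_map m (tdom D.P t)) (syn1_map m (tcod D.P t))"
  unfolding C.source_hom C.target_hom
  using relabel_wf[of t] relabel_ends[of t] syn1_map_Ws[of "tdom D.P t"] syn1_map_endos[of "tdom D.P t" ZA]
  by blast+

lemma relabel_class:
  "is_path D.P p \<Longrightarrow> tm_class C.P (relabel (IdT p)) = Id2 C.C (syn1_map m p)"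
  "wf_tm D.P (VT s t) \<Longrightarrow> tm_class C.P (relabel (VT s t)) =
    VComp C.C (tm_class C.P (relabel s)) (tm_class C.P (relabel t))"
  "wf_tm D.P (HT s t) \<Longrightarrow> tm_class C.P (relabel (HT s t)) =
    HComp C.C (tm_class C.P (relabel s)) (tm_class C.P (relabel t))"
  using relabel_wf[of "VT s t"] relabel_wf[of "HT s t"]
  by (simp_all add: C.C_simps C.VComp_class C.HComp_class)

lemma synH_functor: "monoidal_functor (Source (syntactic_lax (SDom m))) (Source (syntactic_lax (SCod m))) synH"
  by (rule D.source_functor[where fo = "syn1_map m", OF C.source_target_monoidal(1)
          syn_functor_simps(1,3) relabel_hom(1)])
    (use D.Ws_endos in \<open>simp_all add: relabel_class C.source_simps del: mem_Collect_eq wf_tm.simps tm.map\<close>)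

lemma synK_functor: "monoidal_functor (Target (syntactic_lax (SDom m))) (Target (syntactic_lax (SCod m))) synK"
  by (rule D.target_functor[where fo = "syn1_map m", OF C.source_target_monoidal(2)
          syn_functor_simps(2,4) relabel_hom(2)])
    (use D.endosD in \<open>simp_all add: relabel_class C.target_simps del: wf_tm.simps tm.map\<close>)

lemma synK_box:
  assumes "f \<in> Arr (Source (syntactic_lax (SDom m)))"
  shows "FM synK (FM (Fun (syntactic_lax (SDom m))) f) = FM (Fun (syntactic_lax (SCod m))) (FM synH f)"
proof -
  obtain t where t: "wf_tm D.P t" "tdom D.P t \<in> D.Ws" "f = tm_class D.P t"
    using assms unfolding D.source_Arr by blast
  let ?t = "HT (HT (IdT up_path) t) (IdT down_path)"
  have w: "wf_tm D.P ?t" using t(1) D.Ws_endos[OF t(2)] D.is_path_up D.is_path_down by simp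
  have e: "tdom D.P ?t \<in> D.endos ZA"
    using D.wf_path[OF w] D.Ws_endos[OF t(2)] by (simp add: D.endos_def del: wf_tm.simps)
  have 1: "FM (Fun (syntactic_lax (SDom m))) f = tm_class D.P ?t"
    using w t(3) by (simp add: D.fun_simps D.C_simps D.HComp_class)
  have "FM (Fun (syntactic_lax (SCod m))) (FM synH f) = tm_class C.P (relabel ?t)"
    using relabel_wf[OF w] syn_functor_simps(3)[OF t(1,2)] t(3) by (simp add: C.fun_simps C.C_simps C.HComp_class)
  then show ?thesis unfolding 1 syn_functor_simps(4)[OF w e] ..
qed

lemma synK_mu:
  assumes p: "p \<in> D.Ws" and q: "q \<in> D.Ws"
  shows "FM synK (mu (syntactic_lax (SDom m)) p q) = mu (syntactic_lax (SCod m)) (FO synH p) (FO synH q)"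
proof -
  let ?t = "HT (HT (IdT (path_comp up_path p)) (GenT Counit)) (IdT (path_comp q down_path))"
  have w: "wf_tm D.P ?t"
    using D.Ws_endos[OF p] D.Ws_endos[OF q] D.is_path_up D.is_path_down
    by (auto simp: D.P_simps D.Gens2_P intro!: is_path_comp)
  have e: "tdom D.P ?t \<in> D.endos ZA"
    using D.wf_path[OF w] D.Ws_endos[OF p] D.Ws_endos[OF q] by (simp add: D.endos_def del: wf_tm.simps)
  have 1: "mu (syntactic_lax (SDom m)) p q = tm_class D.P ?t"
    using w by (simp add: D.fun_simps D.C_simps D.HComp_class)
  have "mu (syntactic_lax (SCod m)) (FO synH p) (FO synH q) = tm_class C.P (relabel ?t)"
    using relabel_wf[OF w] by (simp add: syn_functor_simps(1)[OF p] syn_functor_simps(1)[OF q]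
        C.fun_simps C.C_simps C.HComp_class)
  then show ?thesis unfolding 1 syn_functor_simps(4)[OF w e] ..
qed

lemma syntactic_lax_mor: "is_lax_mor (syntactic_lax_mor m)"
proof -
  have e: "FM synK (eps (syntactic_lax (SDom m))) = eps (syntactic_lax (SCod m))"
  proof -
    have "wf_tm D.P (GenT Eta)" "tdom D.P (GenT Eta) \<in> D.endos ZA"
      by (simp_all add: D.Gens2_P D.P_simps D.endos_def is_path_def)
    then show ?thesis using syn_functor_simps(4)[of "GenT Eta"] by (simp add: D.fun_simps C.fun_simps)
  qed
  have o: "FO synK (FO (Fun (syntactic_lax (SDom m))) p) = FO (Fun (syntactic_lax (SCod m))) (FO synH p)"
    if p: "p \<in> D.Ws" for p
  proof -
    have "path_comp up_path (path_comp p down_path) \<in> D.endos ZA"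
      using D.Ws_endos[OF p] D.is_path_up D.is_path_down by (auto simp: D.endos_def intro!: is_path_comp)
    from syn_functor_simps(2)[OF this] show ?thesis
      unfolding D.fun_simps C.fun_simps syn_functor_simps(1)[OF p] by simp
  qed
  have x: "functor_extensional (Source (syntactic_lax (SDom m))) synH"
    "functor_extensional (Target (syntactic_lax (SDom m))) synK"
    by (simp_all add: syn_functor_def functor_extensional_def)
  show ?thesis
    unfolding is_lax_mor_def Let_def syn_simps D.source_simps
    by (intro conjI ballI D.syntactic_lax C.syntactic_lax synH_functor synK_functor x o e synK_box synK_mu)
qed

end

section \<open>Transport along injections\<close>

definition transport_moncat :: "('o \<Rightarrow> 'p) \<Rightarrow> ('m \<Rightarrow> 'n) \<Rightarrow> ('o, 'm) moncat \<Rightarrow> ('p, 'n) moncat" where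
  "transport_moncat f g M =
    (let f' = inv_into (Obj M) f; g' = inv_into (Arr M) g in
     \<lparr>Obj = f ` Obj M, Arr = g ` Arr M, Dom = (\<lambda>m. f (Dom M (g' m))), Cod = (\<lambda>m. f (Cod M (g' m))),
      Idn = (\<lambda>a. g (Idn M (f' a))), Cmp = (\<lambda>m n. g (Cmp M (g' m) (g' n))), Unit = f (Unit M),
      TenO = (\<lambda>a b. f (TenO M (f' a) (f' b))), TenA = (\<lambda>m n. g (TenA M (g' m) (g' n)))\<rparr>)"

text \<open>Injectivity is required on the carriers alone, since a coding of classes by
  representatives is faithful only on actual classes.\<close>

locale transported = monoidal_category M
  for M :: "('o, 'm) moncat" and f :: "'o \<Rightarrow> 'p" and g :: "'m \<Rightarrow> 'n" +
  assumes inj_obj: "inj_on f (Obj M)" and inj_arr: "inj_on g (Arr M)"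
begin

abbreviation N where "N \<equiv> transport_moncat f g M"

definition fwd :: "('o, 'm, 'p, 'n) fct" where
  "fwd = \<lparr>FO = restrict f (Obj M), FM = restrict g (Arr M)\<rparr>"

definition bwd :: "('p, 'n, 'o, 'm) fct" where
  "bwd = \<lparr>FO = restrict (inv_into (Obj M) f) (Obj N), FM = restrict (inv_into (Arr M) g) (Arr N)\<rparr>"

lemma N_simps:
  "Obj N = f ` Obj M" "Arr N = g ` Arr M" "Unit N = f (Unit M)"
  "m \<in> Arr M \<Longrightarrow> Dom N (g m) = f (Dom M m)" "m \<in> Arr M \<Longrightarrow> Cod N (g m) = f (Cod M m)"
  "a \<in> Obj M \<Longrightarrow> Idn N (f a) = g (Idn M a)"
  "m \<in> Arr M \<Longrightarrow> n \<in> Arr M \<Longrightarrow> Cmp N (g m) (g n) = g (Cmp M m n)"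
  "a \<in> Obj M \<Longrightarrow> b \<in> Obj M \<Longrightarrow> TenO N (f a) (f b) = f (TenO M a b)"
  "m \<in> Arr M \<Longrightarrow> n \<in> Arr M \<Longrightarrow> TenA N (g m) (g n) = g (TenA M m n)"
  by (simp_all add: transport_moncat_def Let_def inv_into_f_f inj_obj inj_arr)

lemma f_eq: "a \<in> Obj M \<Longrightarrow> b \<in> Obj M \<Longrightarrow> f a = f b \<longleftrightarrow> a = b"
  using inj_obj by (auto simp: inj_on_def)

text \<open>Composability in the copy compares images of objects, and injectivity on objects brings
  it back to composability in \<open>M\<close>.\<close>

lemma f_match: "m \<in> Arr M \<Longrightarrow> n \<in> Arr M \<Longrightarrow> f (Cod M m) = f (Dom M n) \<Longrightarrow> Cod M m = Dom M n"
  using f_eq[OF cod_obj dom_obj] by blast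

lemma N_hom: "n \<in> hom N a b \<longleftrightarrow>
    (\<exists>m. m \<in> Arr M \<and> n = g m \<and> a = f (Dom M m) \<and> b = f (Cod M m))"
  by (auto simp: hom_def N_simps)

lemmas M_simps = arr_simps ten_simps

lemma N_monoidal: "monoidal_category N"
proof unfold_locales
  fix a b c m n
  assume "m \<in> hom N a b" "n \<in> hom N b c"
  then obtain m0 n0 where m: "m0 \<in> Arr M" "m = g m0" "a = f (Dom M m0)" "b = f (Cod M m0)"
    and n: "n0 \<in> Arr M" "n = g n0" "b = f (Dom M n0)" "c = f (Cod M n0)"
    by (auto simp: N_hom)
  then have e: "Cod M m0 = Dom M n0" by (intro f_match) simp_all
  then show "m ;;\<^bsub>N\<^esub> n \<in> hom N a c"
    using m n by (auto simp: N_hom N_simps M_simps intro!: exI[of _ "m0 ;;\<^bsub>M\<^esub> n0"])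
  fix k d assume "k \<in> hom N c d"
  then obtain k0 where k: "k0 \<in> Arr M" "k = g k0" "c = f (Dom M k0)" "d = f (Cod M k0)"
    by (auto simp: N_hom)
  then have "Cod M n0 = Dom M k0" using n by (intro f_match) simp_all
  with e m n k show "(m ;;\<^bsub>N\<^esub> n) ;;\<^bsub>N\<^esub> k = m ;;\<^bsub>N\<^esub> (n ;;\<^bsub>N\<^esub> k)"
    using comp_assoc[OF arr_hom[of m0] _ arr_hom[of k0]] arr_hom[of n0]
    by (simp add: N_simps M_simps)
next
  fix a b c m n a' b' c' m' n'
  assume "m \<in> hom N a b" "n \<in> hom N b c"
  then obtain m0 n0 where m: "m0 \<in> Arr M" "m = g m0" "a = f (Dom M m0)" "b = f (Cod M m0)"
    and n: "n0 \<in> Arr M" "n = g n0" "b = f (Dom M n0)" "c = f (Cod M n0)"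
    by (auto simp: N_hom)
  then have e: "Cod M m0 = Dom M n0" by (intro f_match) simp_all
  assume "m' \<in> hom N a' b'" "n' \<in> hom N b' c'"
  then obtain m1 n1 where m': "m1 \<in> Arr M" "m' = g m1" "a' = f (Dom M m1)" "b' = f (Cod M m1)"
    and n': "n1 \<in> Arr M" "n' = g n1" "b' = f (Dom M n1)" "c' = f (Cod M n1)"
    by (auto simp: N_hom)
  then have e': "Cod M m1 = Dom M n1" by (intro f_match) simp_all
  show "TenA N (m ;;\<^bsub>N\<^esub> n) (m' ;;\<^bsub>N\<^esub> n') = TenA N m m' ;;\<^bsub>N\<^esub> TenA N n n'"
    using m n m' n' e e' by (simp add: N_simps M_simps ten_comp')
next
  fix a b c d m n
  assume "m \<in> hom N a b" "n \<in> hom N c d"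
  then obtain m0 n0 where m: "m0 \<in> Arr M" "m = g m0" "a = f (Dom M m0)" "b = f (Cod M m0)"
    and n: "n0 \<in> Arr M" "n = g n0" "c = f (Dom M n0)" "d = f (Cod M n0)"
    by (auto simp: N_hom)
  then show "TenA N m n \<in> hom N (TenO N a c) (TenO N b d)"
    by (auto simp: N_hom N_simps M_simps intro!: exI[of _ "TenA M m0 n0"])
next
  fix a assume "a \<in> Obj N"
  then obtain a0 where "a0 \<in> Obj M" "a = f a0" by (auto simp: N_simps)
  then show "Idn N a \<in> hom N a a"
    by (auto simp: N_simps N_hom M_simps intro!: exI[of _ "Idn M a0"])
qed (auto simp: N_simps N_hom M_simps ten_id)

lemma fwd_functor: "monoidal_functor M N fwd"
proof -
  interpret N: monoidal_category N by (rule N_monoidal)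
  show ?thesis
    by unfold_locales
      (auto simp: fwd_def N_simps N_hom M_simps hom_def)
qed

lemma inv_f: "a \<in> Obj M \<Longrightarrow> inv_into (Obj M) f (f a) = a"
  and inv_g: "m \<in> Arr M \<Longrightarrow> inv_into (Arr M) g (g m) = m"
  by (simp_all add: inv_into_f_f inj_obj inj_arr)

lemma fwd_simps:
  "a \<in> Obj M \<Longrightarrow> FO fwd a = f a" "m \<in> Arr M \<Longrightarrow> FM fwd m = g m"
  by (simp_all add: fwd_def)

lemma bwd_simps:
  "a \<in> Obj M \<Longrightarrow> FO bwd (f a) = a" "m \<in> Arr M \<Longrightarrow> FM bwd (g m) = m"
  by (simp_all add: bwd_def N_simps inv_f inv_g)

lemma bwd_functor: "monoidal_functor N M bwd"
proof -
  interpret N: monoidal_category N by (rule N_monoidal)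
  show ?thesis
  proof unfold_locales
    fix a b c m n assume "m \<in> hom N a b" "n \<in> hom N b c"
    then obtain m0 n0 where m: "m0 \<in> Arr M" "m = g m0" "a = f (Dom M m0)" "b = f (Cod M m0)"
      and n: "n0 \<in> Arr M" "n = g n0" "b = f (Dom M n0)" "c = f (Cod M n0)"
      by (auto simp: N_hom)
    then have "Cod M m0 = Dom M n0" by (intro f_match) simp_all
    then show "FM bwd (m ;;\<^bsub>N\<^esub> n) = FM bwd m ;;\<^bsub>M\<^esub> FM bwd n"
      using m n by (simp add: N_simps bwd_simps M_simps)
  qed (auto simp: N_simps N_hom bwd_simps M_simps hom_def)
qed

end

definition transport_lax ::
  "('xo \<Rightarrow> 'yo) \<Rightarrow> ('xm \<Rightarrow> 'ym) \<Rightarrow> ('ao \<Rightarrow> 'bo) \<Rightarrow> ('am \<Rightarrow> 'bm) \<Rightarrow>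
    ('xo, 'xm, 'ao, 'am) lax \<Rightarrow> ('yo, 'ym, 'bo, 'bm) lax" where
  "transport_lax f g f' g' T =
    (let f1 = inv_into (Obj (Source T)) f; g1 = inv_into (Arr (Source T)) g in
     \<lparr>Source = transport_moncat f g (Source T), Target = transport_moncat f' g' (Target T),
      Fun = \<lparr>FO = (\<lambda>x. f' (FO (Fun T) (f1 x))), FM = (\<lambda>m. g' (FM (Fun T) (g1 m)))\<rparr>,
      eps = g' (eps T), mu = (\<lambda>x y. g' (mu T (f1 x) (f1 y)))\<rparr>)"

locale transported_lax = lax_functor T + tX: transported "Source T" f g + tA: transported "Target T" f' g'
  for T :: "('xo, 'xm, 'ao, 'am) lax" and f :: "'xo \<Rightarrow> 'yo" and g :: "'xm \<Rightarrow> 'ym"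
    and f' :: "'ao \<Rightarrow> 'bo" and g' :: "'am \<Rightarrow> 'bm"
begin

abbreviation U where "U \<equiv> transport_lax f g f' g' T"

lemma U_simps:
  "Source U = transport_moncat f g (Source T)" "Target U = transport_moncat f' g' (Target T)"
  "eps U = g' (eps T)"
  "x \<in> Obj (Source T) \<Longrightarrow> FO (Fun U) (f x) = f' (FO (Fun T) x)"
  "m \<in> Arr (Source T) \<Longrightarrow> FM (Fun U) (g m) = g' (FM (Fun T) m)"
  "x \<in> Obj (Source T) \<Longrightarrow> y \<in> Obj (Source T) \<Longrightarrow> mu U (f x) (f y) = g' (mu T x y)"
  by (simp_all add: transport_lax_def Let_def tX.inv_f tX.inv_g)

lemma mu_arr':
  assumes "x \<in> Obj (Source T)" "y \<in> Obj (Source T)"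
  shows "mu T x y \<in> Arr (Target T)"
    "Dom (Target T) (mu T x y) = TenO (Target T) (FO (Fun T) x) (FO (Fun T) y)"
    "Cod (Target T) (mu T x y) = FO (Fun T) (TenO (Source T) x y)"
  using homD[OF mu_hom[OF assms]] by auto

lemma eps_arr: "eps T \<in> Arr (Target T)" "Dom (Target T) (eps T) = Unit (Target T)"
    "Cod (Target T) (eps T) = FO (Fun T) (Unit (Source T))"
  using homD[OF eps_hom] by auto

lemmas T_simps = tX.N_simps tA.N_simps U_simps X.arr_simps A.arr_simps X.ten_simps A.ten_simps
  F.map_simps mu_arr' eps_arr

lemma U_lax: "lax_monoidal U"
proof -
  have X: "monoidal_category (Source U)" and A: "monoidal_category (Target U)"
    unfolding U_simps by (rule tX.N_monoidal tA.N_monoidal)+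
  interpret UX: monoidal_category "Source U" by (rule X)
  interpret UA: monoidal_category "Target U" by (rule A)
  have F: "is_functor (Source U) (Target U) (Fun U)"
  proof unfold_locales
    fix a b c m n assume "m \<in> hom (Source U) a b" "n \<in> hom (Source U) b c"
    then obtain m0 n0 where m: "m0 \<in> Arr (Source T)" "m = g m0" "b = f (Cod (Source T) m0)"
      and n: "n0 \<in> Arr (Source T)" "n = g n0" "b = f (Dom (Source T) n0)"
      by (auto simp: tX.N_hom U_simps)
    then have "Cod (Source T) m0 = Dom (Source T) n0" by (intro tX.f_match) simp_all
    then show "FM (Fun U) (m ;;\<^bsub>Source U\<^esub> n) = FM (Fun U) m ;;\<^bsub>Target U\<^esub> FM (Fun U) n"
      using m n F.map_comp[OF X.arr_hom[of m0] homI[of n0]] by (simp add: T_simps)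
  next
    fix a b m assume "m \<in> hom (Source U) a b"
    then obtain m0 where "m0 \<in> Arr (Source T)" "m = g m0" "a = f (Dom (Source T) m0)" "b = f (Cod (Source T) m0)"
      by (auto simp: tX.N_hom U_simps)
    then show "FM (Fun U) m \<in> hom (Target U) (FO (Fun U) a) (FO (Fun U) b)"
      by (intro homI) (simp_all add: T_simps)
  qed (auto simp: T_simps)
  have mn: "TenA (Target T) (FM (Fun T) m) (FM (Fun T) n) ;;\<^bsub>Target T\<^esub> mu T (Cod (Source T) m) (Cod (Source T) n) =
      mu T (Dom (Source T) m) (Dom (Source T) n) ;;\<^bsub>Target T\<^esub> FM (Fun T) (TenA (Source T) m n)"
    if "m \<in> Arr (Source T)" "n \<in> Arr (Source T)" for m n
    using mu_natural[OF X.arr_hom X.arr_hom, OF that] .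
  show ?thesis
    unfolding lax_monoidal_def Let_def
    using X A F mn mu_assoc mu_unit by (auto simp: T_simps intro!: homI)
qed

definition to_U :: "('xo, 'xm, 'ao, 'am, 'yo, 'ym, 'bo, 'bm) lax_mor" where
  "to_U = \<lparr>LDom = T, LCod = U, LH = tX.fwd, LK = tA.fwd\<rparr>"

definition from_U :: "('yo, 'ym, 'bo, 'bm, 'xo, 'xm, 'ao, 'am) lax_mor" where
  "from_U = \<lparr>LDom = U, LCod = T, LH = tX.bwd, LK = tA.bwd\<rparr>"

lemma to_U: "is_lax_mor to_U"
  using lax U_lax tX.fwd_functor tA.fwd_functor
  by (auto simp: is_lax_mor_def Let_def to_U_def tX.fwd_simps tA.fwd_simps T_simps functor_extensional_def)
    (auto simp: tX.fwd_def tA.fwd_def)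

lemma from_U: "is_lax_mor from_U"
  using lax U_lax tX.bwd_functor tA.bwd_functor
  by (auto simp: is_lax_mor_def Let_def from_U_def tX.bwd_simps tA.bwd_simps T_simps functor_extensional_def)
    (auto simp: tX.bwd_def tA.bwd_def tX.N_simps tA.N_simps)

lemma to_from_U: "lax_comp to_U from_U = lax_id T"
  by (rule lax_mor_eqI[OF lax_comp_mor[OF to_U from_U] lax_id_mor[OF lax]])
    (simp_all add: to_U_def from_U_def lax_comp_def lax_id_def comp_functor_simps id_functor_simps
      tX.fwd_simps tA.fwd_simps tX.bwd_simps tA.bwd_simps)

lemma from_to_U: "lax_comp from_U to_U = lax_id U"
  by (rule lax_mor_eqI[OF lax_comp_mor[OF from_U to_U] lax_id_mor[OF U_lax]])
    (auto simp: to_U_def from_U_def lax_comp_def lax_id_def comp_functor_simps id_functor_simps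
      tX.fwd_simps tA.fwd_simps tX.bwd_simps tA.bwd_simps T_simps)

lemma from_U_iso: "is_lax_iso from_U"
  unfolding is_lax_iso_def using to_U from_U to_from_U from_to_U
  by (auto simp: to_U_def from_U_def intro!: exI[of _ to_U])

end

section \<open>Coding terms in an infinite type\<close>

locale coding =
  fixes pair :: "'u \<times> 'u \<Rightarrow> 'u" and tag :: "nat \<Rightarrow> 'u"
  assumes inj_pair: "inj pair" and inj_tag: "inj tag"
begin

lemma code_eq [simp]: "pair x = pair y \<longleftrightarrow> x = y" "tag i = tag j \<longleftrightarrow> i = j"
  using inj_pair inj_tag by (auto simp: inj_eq)

text \<open>A value of \<open>pair\<close> may coincide with a tag. Where nullary and other
  constructors are mixed, the nullary ones are therefore coded as tagged pairs too, and constructors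
  are told apart by their first components.\<close>

primrec code_list :: "'u list \<Rightarrow> 'u" where
  "code_list [] = pair (tag 0, tag 0)"
| "code_list (x # xs) = pair (tag 1, pair (x, code_list xs))"

primrec code_cell0 :: "cell0 \<Rightarrow> 'u" where
  "code_cell0 ZA = tag 0"
| "code_cell0 ZX = tag 1"

primrec code_gen1 :: "'u gen1 \<Rightarrow> 'u" where
  "code_gen1 (GA a) = pair (tag 0, a)"
| "code_gen1 (GX a) = pair (tag 1, a)"
| "code_gen1 Up = pair (tag 2, tag 0)"
| "code_gen1 Down = pair (tag 3, tag 0)"

definition code_path :: "'u syn1 \<Rightarrow> 'u" where
  "code_path p = pair (code_cell0 (fst p),
    pair (code_list (map code_gen1 (fst (snd p))), code_cell0 (snd (snd p))))"

definition code_edge :: "'u list \<Rightarrow> 'u list \<Rightarrow> 'u \<Rightarrow> 'u" where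
  "code_edge us vs e = pair (code_list us, pair (code_list vs, e))"

primrec code_gen2 :: "'u gen2 \<Rightarrow> 'u" where
  "code_gen2 Eta = pair (tag 0, tag 0)"
| "code_gen2 Counit = pair (tag 1, tag 0)"
| "code_gen2 (PlainG us vs e) = pair (tag 2, code_edge us vs e)"
| "code_gen2 (FBoxG us vs e) = pair (tag 3, code_edge us vs e)"
| "code_gen2 (InG us vs e) = pair (tag 4, code_edge us vs e)"
| "code_gen2 (OutG us vs e) = pair (tag 5, code_edge us vs e)"

primrec code_tm :: "(cell0, 'u gen1, 'u gen2) tm \<Rightarrow> 'u" where
  "code_tm (IdT p) = pair (tag 0, code_path p)"
| "code_tm (GenT g) = pair (tag 1, code_gen2 g)"
| "code_tm (VT s t) = pair (tag 2, pair (code_tm s, code_tm t))"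
| "code_tm (HT s t) = pair (tag 3, pair (code_tm s, code_tm t))"

lemma code_list_eq [simp]: "code_list us = code_list vs \<longleftrightarrow> us = vs"
proof (induction us arbitrary: vs)
  case Nil
  show ?case by (cases vs) auto
next
  case (Cons u us)
  then show ?case by (cases vs) auto
qed

lemma code_cell0_eq [simp]: "code_cell0 c = code_cell0 d \<longleftrightarrow> c = d"
  by (cases c; cases d; simp)

lemma code_gen1_eq [simp]: "code_gen1 a = code_gen1 b \<longleftrightarrow> a = b"
  by (cases a; cases b; simp)

lemma code_gen2_eq [simp]: "code_gen2 g = code_gen2 g' \<longleftrightarrow> g = g'"
  by (cases g; cases g'; simp add: code_edge_def)

lemma code_path_eq [simp]: "code_path p = code_path q \<longleftrightarrow> p = q"
proof -
  have "inj code_gen1" by (rule injI) simp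
  then show ?thesis by (auto simp: code_path_def prod_eq_iff dest: map_injective)
qed

lemma code_tm_eq [simp]: "code_tm s = code_tm t \<longleftrightarrow> s = t"
proof (induction s arbitrary: t)
  case (VT s1 s2)
  then show ?case by (cases t) auto
next
  case (HT s1 s2)
  then show ?case by (cases t) auto
qed (case_tac t; simp)+

end

text \<open>An infinite set is equinumerous with its square, which gives the pairing, and contains a
  copy of the natural numbers, which gives the tags.\<close>

lemma coding_exists:
  assumes "infinite (UNIV :: 'u set)"
  shows "\<exists>(pair :: 'u \<times> 'u \<Rightarrow> 'u) tag. coding pair tag"
proof -
  have "\<exists>pair :: 'u \<times> 'u \<Rightarrow> 'u. bij_betw pair (UNIV \<times> UNIV) UNIV"
    using card_of_ordIso card_of_Times_same_infinite[OF assms] by blast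
  then obtain pair :: "'u \<times> 'u \<Rightarrow> 'u" where "bij_betw pair (UNIV \<times> UNIV) UNIV"
    by blast
  moreover obtain tag :: "nat \<Rightarrow> 'u" where "inj tag"
    using infinite_countable_subset[OF assms] by auto
  ultimately show ?thesis by (auto simp: coding_def bij_betw_def)
qed

section \<open>The adjunction\<close>

text \<open>Each of the two morphisms is the one induced by its own values on generators, and equal
  values induce equal morphisms.\<close>

lemma lax_from_syntactic_eqI:
  assumes m: "lax_from_syntactic S m" and m': "lax_from_syntactic S m'" and cod: "LCod m = LCod m'"
    and "\<And>u. u \<in> AObj S \<Longrightarrow> FO (LK m) (apath [u]) = FO (LK m') (apath [u])"
    and "\<And>u. u \<in> XObj S \<Longrightarrow> FO (LH m) (xpath [u]) = FO (LH m') (xpath [u])"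
    and "\<And>us vs e. e \<in> Plain S us vs \<Longrightarrow>
      FM (LK m) (tm_class (syntactic_presentation S) (GenT (PlainG us vs e))) =
      FM (LK m') (tm_class (syntactic_presentation S) (GenT (PlainG us vs e)))"
    and "\<And>us vs e. e \<in> FBox S us vs \<Longrightarrow>
      FM (LH m) (tm_class (syntactic_presentation S) (GenT (FBoxG us vs e))) =
      FM (LH m') (tm_class (syntactic_presentation S) (GenT (FBoxG us vs e)))"
    and "\<And>us vs e. e \<in> InBox S us vs \<Longrightarrow>
      FM (LK m) (tm_class (syntactic_presentation S) (GenT (InG us vs e))) =
      FM (LK m') (tm_class (syntactic_presentation S) (GenT (InG us vs e)))"
    and "\<And>us vs e. e \<in> OutBox S us vs \<Longrightarrow>
      FM (LK m) (tm_class (syntactic_presentation S) (GenT (OutG us vs e))) =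
      FM (LK m') (tm_class (syntactic_presentation S) (GenT (OutG us vs e)))"
  shows "m = m'"
proof -
  interpret m: lax_from_syntactic S m by (rule m)
  interpret m': lax_from_syntactic S m' by (rule m')
  have "m.h = m'.h" "m.k = m'.k" "m.pl = m'.pl" "m.fb = m'.fb" "m.ib = m'.ib" "m.ob = m'.ob"
    unfolding m.h_def m'.h_def m.k_def m'.k_def m.pl_def m'.pl_def m.fb_def m'.fb_def
      m.ib_def m'.ib_def m.ob_def m'.ob_def
    using assms(4-9) by (auto intro!: ext restrict_ext)
  then show ?thesis using m.eq_mor m'.eq_mor cod by simp
qed

definition transpose :: "'u fsig \<Rightarrow> ('u syn1, 'u syn2, 'u syn1, 'u syn2, 'u, 'u, 'u, 'u) lax_mor \<Rightarrow> 'u fsig_mor" where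
  "transpose S g = \<lparr>SDom = S, SCod = underlying_sig (LCod g),
    hobj = lax_from_syntactic.h S g, kobj = lax_from_syntactic.k S g,
    hPlain = lax_from_syntactic.pl S g, hFBox = lax_from_syntactic.fb S g,
    hInBox = lax_from_syntactic.ib S g, hOutBox = lax_from_syntactic.ob S g\<rparr>"

lemma (in lax_from_syntactic) gens_dom:
  "u \<in> AObj S \<Longrightarrow> apath [u] \<in> Obj (Target (LDom m))"
  "u \<in> XObj S \<Longrightarrow> xpath [u] \<in> Obj (Source (LDom m))"
  "e \<in> Plain S us vs \<Longrightarrow> tm_class P (GenT (PlainG us vs e)) \<in> Arr (Target (LDom m))"
  "e \<in> FBox S us vs \<Longrightarrow> tm_class P (GenT (FBoxG us vs e)) \<in> Arr (Source (LDom m))"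
  "e \<in> InBox S us vs \<Longrightarrow> tm_class P (GenT (InG us vs e)) \<in> Arr (Target (LDom m))"
  "e \<in> OutBox S us vs \<Longrightarrow> tm_class P (GenT (OutG us vs e)) \<in> Arr (Target (LDom m))"
proof -
  show "u \<in> AObj S \<Longrightarrow> apath [u] \<in> Obj (Target (LDom m))"
    unfolding dom target_simps by (rule apath_endos) simp
  show "u \<in> XObj S \<Longrightarrow> xpath [u] \<in> Obj (Source (LDom m))"
    unfolding dom source_simps by (rule xpath_Ws) simp
  {
    assume "e \<in> Plain S us vs"
    then have "wf_tm P (GenT (PlainG us vs e))" "tdom P (GenT (PlainG us vs e)) \<in> endos ZA"
      using fsig_listsD(1)[OF fsig] by (simp_all add: Gens2_P P_simps apath_endos del: in_lists_conv_set)
    then show "tm_class P (GenT (PlainG us vs e)) \<in> Arr (Target (LDom m))"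
      unfolding dom target_Arr by blast
  next
    assume e: "e \<in> FBox S us vs"
    then have "wf_tm P (GenT (FBoxG us vs e))" "tdom P (GenT (FBoxG us vs e)) \<in> Ws"
      using xpath_Ws[OF conjunct1[OF fsig_listsD(2)[OF fsig e]]] by (simp_all add: Gens2_P P_simps)
    then show "tm_class P (GenT (FBoxG us vs e)) \<in> Arr (Source (LDom m))"
      unfolding dom source_Arr by blast
  next
    assume "e \<in> InBox S us vs"
    then have "wf_tm P (GenT (InG us vs e))" "tdom P (GenT (InG us vs e)) \<in> endos ZA"
      using fsig_listsD(3)[OF fsig] by (simp_all add: Gens2_P P_simps apath_endos del: in_lists_conv_set)
    then show "tm_class P (GenT (InG us vs e)) \<in> Arr (Target (LDom m))"
      unfolding dom target_Arr by blast
  next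
    assume "e \<in> OutBox S us vs"
    then have "wf_tm P (GenT (OutG us vs e))" "tdom P (GenT (OutG us vs e)) \<in> endos ZA"
      using fsig_listsD(4)[OF fsig] by (simp_all add: Gens2_P P_simps boxpath_endos del: in_lists_conv_set)
    then show "tm_class P (GenT (OutG us vs e)) \<in> Arr (Target (LDom m))"
      unfolding dom target_Arr by blast
  }
qed

lemma transpose_mor:
  assumes "lax_from_syntactic S g"
  shows "is_fsig_mor (transpose S g)"
proof -
  interpret g: lax_from_syntactic S g by fact
  have l: "map g.h us \<in> lists (Obj (Target (LCod g)))" if "us \<in> lists (AObj S)" for us
    by (rule g.I.map_objs(1)[OF that])
  have l': "map g.k us \<in> lists (Obj (Source (LCod g)))" if "us \<in> lists (XObj S)" for us
    by (rule g.I.map_objs(2)[OF that])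
  show ?thesis
    apply (rule fsig_morI)
    subgoal by (simp add: transpose_def g.fsig)
    subgoal by (simp add: transpose_def underlying_sig)
    subgoal by (simp add: transpose_def g.h_def)
    subgoal by (simp add: transpose_def g.k_def)
    subgoal by (simp add: transpose_def g.pl_def)
    subgoal by (simp add: transpose_def g.fb_def)
    subgoal by (simp add: transpose_def g.ib_def)
    subgoal by (simp add: transpose_def g.ob_def)
    by (simp_all add: transpose_def underlying_sig_simps g.I.h g.I.k g.I.pl g.I.fb g.I.ib g.I.ob l l'
        del: in_lists_conv_set)
qed

lemma transpose_inj:
  assumes "lax_from_syntactic S g" "lax_from_syntactic S g'" "LCod g = LCod g'" "transpose S g = transpose S g'"
  shows "g = g'"
proof -
  interpret g: lax_from_syntactic S g by fact
  interpret g': lax_from_syntactic S g' by fact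
  show ?thesis
    using g.eq_mor g'.eq_mor assms(3,4) by (simp add: transpose_def)
qed

text \<open>The preimage is the morphism induced by \<open>f\<close>, regarded as interpretation
  data. On a single generator in the empty context the interpretation gives back the value
  prescribed by \<open>f\<close>.\<close>

lemma transpose_surj:
  assumes f: "is_fsig_mor f" "SDom f = S" "SCod f = underlying_sig T" and T: "lax_monoidal T"
  shows "\<exists>g. lax_from_syntactic S g \<and> LCod g = T \<and> transpose S g = f"
proof -
  interpret f: fsig_morphism f by unfold_locales (rule f)
  interpret I: interpretation_data S T "hobj f" "kobj f" "hPlain f" "hInBox f" "hOutBox f" "hFBox f"
    using f.dom_cod(1) f.hobj f.kobj f.hPlain f.hFBox f.hInBox f.hOutBox T
    by unfold_locales (simp_all add: f underlying_sig_simps)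
  have g: "lax_from_syntactic S I.mor"
    by unfold_locales (simp_all add: I.mor_is_lax_mor I.mor_ends)
  interpret g: lax_from_syntactic S I.mor by (rule g)
  have o: "FO (LK I.mor) (apath [u]) = hobj f u" if "u \<in> AObj S" for u
    using I.mor_K(1)[OF g.apath_endos[of "[u]"]] that I.h
    by (simp add: I.aval_def apath_def I.A.ten_obj_unit_left)
  have x: "FO (LH I.mor) (xpath [u]) = kobj f u" if "u \<in> XObj S" for u
    using I.mor_H(1)[OF g.xpath_Ws[of "[u]"]] that I.k
    by (simp add: I.xval_xpath I.X.ten_obj_unit_right)
  \<comment> \<open>In the empty context the outer tensor factors are units, which leaves only
    \<open>core\<close>.\<close>
  have a: "FM (LK I.mor) (tm_class I.P (GenT g)) = I.core g (Unit (Source T)) (Unit (Source T))"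
    if "g \<in> Gens2 I.P" "gen2_dom g \<in> I.endos ZA" for g
    using I.mor_K(2)[of "GenT g"] that homD(1)[OF I.core_hom[OF that(1) I.X.unit_obj I.X.unit_obj]]
    by (simp add: I.P_simps I.A.ten_simps)
  have pl: "FM (LK I.mor) (tm_class I.P (GenT (PlainG us vs e))) = hPlain f us vs e" if e: "e \<in> Plain S us vs" for us vs e
    using a[of "PlainG us vs e"] e fsig_listsD(1)[OF I.fsig e] by (simp add: I.Gens2_P g.apath_endos del: in_lists_conv_set)
  have ib: "FM (LK I.mor) (tm_class I.P (GenT (InG us vs e))) = hInBox f us vs e" if e: "e \<in> InBox S us vs" for us vs e
    using a[of "InG us vs e"] e fsig_listsD(3)[OF I.fsig e] by (simp add: I.Gens2_P g.apath_endos del: in_lists_conv_set)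
  have ob: "FM (LK I.mor) (tm_class I.P (GenT (OutG us vs e))) = hOutBox f us vs e" if e: "e \<in> OutBox S us vs" for us vs e
    using a[of "OutG us vs e"] e fsig_listsD(4)[OF I.fsig e] by (simp add: I.Gens2_P g.boxpath_endos del: in_lists_conv_set)
  have fb: "FM (LH I.mor) (tm_class I.P (GenT (FBoxG us vs e))) = hFBox f us vs e" if e: "e \<in> FBox S us vs" for us vs e
  proof -
    have "wf_tm I.P (GenT (FBoxG us vs e))" "tdom I.P (GenT (FBoxG us vs e)) \<in> I.Ws"
      using e g.xpath_Ws[OF conjunct1[OF fsig_listsD(2)[OF I.fsig e]]] by (simp_all add: I.Gens2_P I.P_simps)
    from I.mor_H(2)[OF this] show ?thesis by simp
  qed
  have "transpose S I.mor = f"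
    by (rule fsig_mor_eqI[OF transpose_mor[OF g] f(1)])
      (simp_all add: transpose_def f(2,3) I.mor_ends g.h_def g.k_def g.pl_def g.fb_def g.ib_def g.ob_def o x pl fb ib ob)
  then show ?thesis using g I.mor_ends by blast
qed

lemma (in fsig_morphism) syn_gens:
  "u \<in> AObj (SDom m) \<Longrightarrow> FO synK (apath [u]) = apath [hobj m u]"
  "u \<in> XObj (SDom m) \<Longrightarrow> FO synH (xpath [u]) = xpath [kobj m u]"
  "e \<in> Plain (SDom m) us vs \<Longrightarrow> FM synK (tm_class D.P (GenT (PlainG us vs e))) =
    tm_class C.P (GenT (PlainG (map (hobj m) us) (map (hobj m) vs) (hPlain m us vs e)))"
  "e \<in> FBox (SDom m) us vs \<Longrightarrow> FM synH (tm_class D.P (GenT (FBoxG us vs e))) =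
    tm_class C.P (GenT (FBoxG (map (kobj m) us) (map (kobj m) vs) (hFBox m us vs e)))"
  "e \<in> InBox (SDom m) us vs \<Longrightarrow> FM synK (tm_class D.P (GenT (InG us vs e))) =
    tm_class C.P (GenT (InG (map (hobj m) us) (map (kobj m) vs) (hInBox m us vs e)))"
  "e \<in> OutBox (SDom m) us vs \<Longrightarrow> FM synK (tm_class D.P (GenT (OutG us vs e))) =
    tm_class C.P (GenT (OutG (map (kobj m) us) (map (hobj m) vs) (hOutBox m us vs e)))"
proof -
  have "lax_from_syntactic (SDom m) (syntactic_lax_mor m)"
    by unfold_locales (simp_all add: syntactic_lax_mor syn_simps)
  then interpret s: lax_from_syntactic "SDom m" "syntactic_lax_mor m" .
  note d = s.gens_dom[unfolded syn_simps]
  show "u \<in> AObj (SDom m) \<Longrightarrow> FO synK (apath [u]) = apath [hobj m u]"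
    "u \<in> XObj (SDom m) \<Longrightarrow> FO synH (xpath [u]) = xpath [kobj m u]"
    using d(1,2) by (simp_all add: syn_functor_def syn1_map_paths)
  show "e \<in> Plain (SDom m) us vs \<Longrightarrow> FM synK (tm_class D.P (GenT (PlainG us vs e))) =
      tm_class C.P (GenT (PlainG (map (hobj m) us) (map (hobj m) vs) (hPlain m us vs e)))"
    "e \<in> FBox (SDom m) us vs \<Longrightarrow> FM synH (tm_class D.P (GenT (FBoxG us vs e))) =
      tm_class C.P (GenT (FBoxG (map (kobj m) us) (map (kobj m) vs) (hFBox m us vs e)))"
    "e \<in> InBox (SDom m) us vs \<Longrightarrow> FM synK (tm_class D.P (GenT (InG us vs e))) =
      tm_class C.P (GenT (InG (map (hobj m) us) (map (kobj m) vs) (hInBox m us vs e)))"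
    "e \<in> OutBox (SDom m) us vs \<Longrightarrow> FM synK (tm_class D.P (GenT (OutG us vs e))) =
      tm_class C.P (GenT (OutG (map (kobj m) us) (map (hobj m) vs) (hOutBox m us vs e)))"
    using d(3-6) by (simp_all add: syn_functor_def syn2_map_class D.Gens2_P)
qed

lemma syntactic_from:
  assumes "is_fsig_mor f"
  shows "lax_from_syntactic (SDom f) (syntactic_lax_mor f)"
proof -
  interpret f: fsig_morphism f by unfold_locales fact
  show ?thesis by unfold_locales (simp_all add: f.syntactic_lax_mor f.syn_simps)
qed

lemma lax_from_syntactic_comp:
  assumes "lax_from_syntactic S g" "is_lax_mor k" "LCod g = LDom k"
  shows "lax_from_syntactic S (lax_comp g k)"
proof -
  interpret g: lax_from_syntactic S g by fact
  show ?thesis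
    by unfold_locales (simp_all add: lax_comp_mor[OF g.mor assms(2,3)] lax_comp_simps g.dom)
qed

text \<open>Functoriality on signature morphisms comes from uniqueness: it is enough to compare
  values on generators, and no induction over terms takes place. The same holds for
  \<open>syntactic_lax_mor_comp\<close>.\<close>

lemma syntactic_lax_mor_id:
  assumes "is_fsig S"
  shows "syntactic_lax_mor (fsig_id S) = lax_id (syntactic_lax S)"
proof -
  interpret f: fsig_morphism "fsig_id S" by unfold_locales (rule fsig_id_mor[OF assms])
  interpret S: signature S by unfold_locales fact
  have s: "SDom (fsig_id S) = S" "SCod (fsig_id S) = S" by (simp_all add: fsig_id_def)
  note F = syntactic_from[OF f.mor, unfolded s]
  interpret F: lax_from_syntactic S "syntactic_lax_mor (fsig_id S)" by (rule F)
  have I: "lax_from_syntactic S (lax_id (syntactic_lax S))"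
  proof unfold_locales
    show "is_lax_mor (lax_id (syntactic_lax S))" by (rule lax_id_mor[OF S.syntactic_lax])
  qed (simp add: lax_id_def)
  note d = F.gens_dom[unfolded F.dom]
  have i: "hobj (fsig_id S) = restrict (\<lambda>a. a) (AObj S)" "kobj (fsig_id S) = restrict (\<lambda>x. x) (XObj S)"
    "e \<in> Plain S us vs \<Longrightarrow> hPlain (fsig_id S) us vs e = e" "e \<in> FBox S us vs \<Longrightarrow> hFBox (fsig_id S) us vs e = e"
    "e \<in> InBox S us vs \<Longrightarrow> hInBox (fsig_id S) us vs e = e" "e \<in> OutBox S us vs \<Longrightarrow> hOutBox (fsig_id S) us vs e = e"
    for us vs e
    by (simp_all add: fsig_id_def)
  show ?thesis
    by (rule lax_from_syntactic_eqI[OF F I])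
      (use d fsig_listsD[OF assms] in \<open>simp_all add: f.syn_simps[unfolded s] lax_id_def id_functor_simps
        f.syn_gens[unfolded s] map_restrict_id i del: in_lists_conv_set\<close>)
qed

lemma lax_comp_apply:
  "a \<in> Obj (Source (LDom m)) \<Longrightarrow> FO (LH (lax_comp m m')) a = FO (LH m') (FO (LH m) a)"
  "f \<in> Arr (Source (LDom m)) \<Longrightarrow> FM (LH (lax_comp m m')) f = FM (LH m') (FM (LH m) f)"
  "b \<in> Obj (Target (LDom m)) \<Longrightarrow> FO (LK (lax_comp m m')) b = FO (LK m') (FO (LK m) b)"
  "g \<in> Arr (Target (LDom m)) \<Longrightarrow> FM (LK (lax_comp m m')) g = FM (LK m') (FM (LK m) g)"
  by (simp_all add: lax_comp_def comp_functor_simps)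

lemma syntactic_lax_mor_comp:
  assumes f: "is_fsig_mor f" and f': "is_fsig_mor f'" and e: "SCod f = SDom f'"
  shows "syntactic_lax_mor (fsig_comp f f') = lax_comp (syntactic_lax_mor f) (syntactic_lax_mor f')"
proof -
  interpret f: fsig_morphism f by unfold_locales fact
  interpret f': fsig_morphism f' by unfold_locales fact
  interpret c: fsig_morphism "fsig_comp f f'" by unfold_locales (rule fsig_comp_mor[OF assms])
  interpret F: lax_from_syntactic "SDom f" "syntactic_lax_mor f" by (rule syntactic_from[OF f])
  have C: "lax_from_syntactic (SDom f) (syntactic_lax_mor (fsig_comp f f'))"
    using syntactic_from[OF c.mor] by (simp add: fsig_comp_simps)
  have C': "lax_from_syntactic (SDom f) (lax_comp (syntactic_lax_mor f) (syntactic_lax_mor f'))"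
    by (rule lax_from_syntactic_comp[OF syntactic_from[OF f] f'.syntactic_lax_mor])
      (simp add: f.syn_simps f'.syn_simps e)
  note l = fsig_listsD[OF f.dom_cod(1)]
  note d = F.gens_dom and g = f.syn_gens and g' = f'.syn_gens[folded e]
    and cg = c.syn_gens[unfolded fsig_comp_simps(1,2)]
  note simps = lax_comp_apply[of _ "syntactic_lax_mor f"] lax_comp_simps(1,2) f.syn_simps f'.syn_simps c.syn_simps fsig_comp_simps
  note s = simps[unfolded e[symmetric]]
  show ?thesis
    by (rule lax_from_syntactic_eqI[OF C C'])
      (use l d[unfolded f.syn_simps] in \<open>simp_all add: s lax_comp_apply f.syn_simps f'.syn_simps[folded e] cg g g' map_obj_comp
        f.hobj f.kobj f.hPlain f.hFBox f.hInBox f.hOutBox del: in_lists_conv_set map_map\<close>)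
qed

text \<open>Signature morphisms are compared object by object and edge by edge. A generator is
  relabelled along \<open>f\<close>, then mapped by \<open>g\<close> and by \<open>k\<close>, and
  the transpose records exactly these values.\<close>

lemma transpose_natural:
  assumes f: "is_fsig_mor f" "SCod f = S" and g: "lax_from_syntactic S g"
    and k: "is_lax_mor k" "LDom k = LCod g"
  shows "transpose (SDom f) (lax_comp (lax_comp (syntactic_lax_mor f) g) k) =
    fsig_comp (fsig_comp f (transpose S g)) (underlying_mor k)"
proof -
  interpret f: fsig_morphism f by unfold_locales (rule f)
  interpret g: lax_from_syntactic S g by (rule g)
  interpret F: lax_from_syntactic "SDom f" "syntactic_lax_mor f" by (rule syntactic_from[OF f(1)])
  let ?c = "lax_comp (syntactic_lax_mor f) g"
  have 1: "lax_from_syntactic (SDom f) ?c"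
    by (rule lax_from_syntactic_comp[OF syntactic_from[OF f(1)] g.mor]) (simp add: f.syn_simps g.dom f)
  have 2: "lax_from_syntactic (SDom f) (lax_comp ?c k)"
    by (rule lax_from_syntactic_comp[OF 1 k(1)]) (simp add: lax_comp_simps k)
  interpret c: lax_from_syntactic "SDom f" "lax_comp ?c k" by (rule 2)
  have tg: "SDom (transpose S g) = S" "SCod (transpose S g) = underlying_sig (LCod g)"
    by (simp_all add: transpose_def)
  interpret t: fsig_morphism "transpose S g" by unfold_locales (rule transpose_mor[OF g])
  have 3: "is_fsig_mor (fsig_comp f (transpose S g))"
    by (rule fsig_comp_mor[OF f(1) t.mor]) (simp add: f tg)
  have 4: "is_fsig_mor (fsig_comp (fsig_comp f (transpose S g)) (underlying_mor k))"
    by (rule fsig_comp_mor[OF 3 underlying_mor[OF k(1)]])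
      (simp add: fsig_comp_simps tg underlying_mor_simps k)
  note fm = f.hobj f.kobj f.hPlain f.hFBox f.hInBox f.hOutBox
  note fm' = fm[unfolded f(2)]
  note d = F.gens_dom[unfolded f.syn_simps] and g' = f.syn_gens[unfolded f(2)]
  have th: "hobj (transpose S g) = g.h" "kobj (transpose S g) = g.k" "hPlain (transpose S g) = g.pl"
    "hFBox (transpose S g) = g.fb" "hInBox (transpose S g) = g.ib" "hOutBox (transpose S g) = g.ob"
    by (simp_all add: transpose_def)
  note um = underlying_mor_simps(3-8)[of _ k, unfolded k(2)]
  have tt: "u \<in> AObj S \<Longrightarrow> g.h u \<in> Obj (Target (LCod g))" "v \<in> XObj S \<Longrightarrow> g.k v \<in> Obj (Source (LCod g))"
    "e \<in> Plain S us vs \<Longrightarrow> g.pl us vs e \<in> Plain (underlying_sig (LCod g)) (map g.h us) (map g.h vs)"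
    "e \<in> FBox S us vs \<Longrightarrow> g.fb us vs e \<in> FBox (underlying_sig (LCod g)) (map g.k us) (map g.k vs)"
    "e \<in> InBox S us vs \<Longrightarrow> g.ib us vs e \<in> InBox (underlying_sig (LCod g)) (map g.h us) (map g.k vs)"
    "e \<in> OutBox S us vs \<Longrightarrow> g.ob us vs e \<in> OutBox (underlying_sig (LCod g)) (map g.k us) (map g.h vs)"
    for u v us vs e
    using t.hPlain t.hFBox t.hInBox t.hOutBox by (simp_all add: g.I.h g.I.k th tg)
  have mm: "us \<in> lists (AObj (SDom f)) \<Longrightarrow> map (hobj (fsig_comp f (transpose S g))) us = map g.h (map (hobj f) us)"
    "us \<in> lists (XObj (SDom f)) \<Longrightarrow> map (kobj (fsig_comp f (transpose S g))) us = map g.k (map (kobj f) us)" for us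
    by (simp_all add: map_obj_comp th del: map_map in_lists_conv_set)
  note l = fsig_listsD[OF f.dom_cod(1)]
  have S': "SDom (transpose (SDom f) (lax_comp ?c k)) = SDom f" by (simp add: transpose_def)
  have tc: "hobj (transpose (SDom f) (lax_comp ?c k)) = c.h" "kobj (transpose (SDom f) (lax_comp ?c k)) = c.k"
    "hPlain (transpose (SDom f) (lax_comp ?c k)) = c.pl" "hFBox (transpose (SDom f) (lax_comp ?c k)) = c.fb"
    "hInBox (transpose (SDom f) (lax_comp ?c k)) = c.ib" "hOutBox (transpose (SDom f) (lax_comp ?c k)) = c.ob"
    by (simp_all add: transpose_def)
  note ap = lax_comp_apply lax_comp_simps(1) f.syn_simps
  show ?thesis
  proof (rule fsig_mor_eqI[OF transpose_mor[OF 2] 4], unfold S' tc)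
    show "SDom f = SDom (fsig_comp (fsig_comp f (transpose S g)) (underlying_mor k))"
      by (simp add: fsig_comp_simps)
    show "SCod (transpose (SDom f) (lax_comp ?c k)) = SCod (fsig_comp (fsig_comp f (transpose S g)) (underlying_mor k))"
      by (simp add: transpose_def fsig_comp_simps lax_comp_simps underlying_mor_simps)
  next
    fix u assume u: "u \<in> AObj (SDom f)"
    then have "c.h u = FO (LK k) (g.h (hobj f u))"
      using d(1)[OF u] g'(1)[OF u] fm'(1)[OF u] by (simp add: c.h_def g.h_def ap)
    then show "c.h u = hobj (fsig_comp (fsig_comp f (transpose S g)) (underlying_mor k)) u"
      using u fm'(1)[OF u] tt(1) by (simp add: fsig_comp_simps th um)
  next
    fix u assume u: "u \<in> XObj (SDom f)"
    then have "c.k u = FO (LH k) (g.k (kobj f u))"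
      using d(2)[OF u] g'(2)[OF u] fm'(2)[OF u] by (simp add: c.k_def g.k_def ap)
    then show "c.k u = kobj (fsig_comp (fsig_comp f (transpose S g)) (underlying_mor k)) u"
      using u fm'(2)[OF u] tt(2) by (simp add: fsig_comp_simps th um)
  next
    fix us vs e assume e: "e \<in> Plain (SDom f) us vs"
    then have "c.pl us vs e = FM (LK k) (g.pl (map (hobj f) us) (map (hobj f) vs) (hPlain f us vs e))"
      using d(3)[OF e] g'(3)[OF e] fm'(3)[OF e] by (simp add: c.pl_def g.pl_def ap)
    then show "c.pl us vs e = hPlain (fsig_comp (fsig_comp f (transpose S g)) (underlying_mor k)) us vs e"
      using e l(1)[OF e] tt(3)[OF fm'(3)[OF e]] by (simp add: fsig_comp_simps th um mm del: map_map in_lists_conv_set)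
  next
    fix us vs e assume e: "e \<in> FBox (SDom f) us vs"
    then have "c.fb us vs e = FM (LH k) (g.fb (map (kobj f) us) (map (kobj f) vs) (hFBox f us vs e))"
      using d(4)[OF e] g'(4)[OF e] fm'(4)[OF e] by (simp add: c.fb_def g.fb_def ap)
    then show "c.fb us vs e = hFBox (fsig_comp (fsig_comp f (transpose S g)) (underlying_mor k)) us vs e"
      using e l(2)[OF e] tt(4)[OF fm'(4)[OF e]] by (simp add: fsig_comp_simps th um mm del: map_map in_lists_conv_set)
  next
    fix us vs e assume e: "e \<in> InBox (SDom f) us vs"
    then have "c.ib us vs e = FM (LK k) (g.ib (map (hobj f) us) (map (kobj f) vs) (hInBox f us vs e))"
      using d(5)[OF e] g'(5)[OF e] fm'(5)[OF e] by (simp add: c.ib_def g.ib_def ap)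
    then show "c.ib us vs e = hInBox (fsig_comp (fsig_comp f (transpose S g)) (underlying_mor k)) us vs e"
      using e l(3)[OF e] tt(5)[OF fm'(5)[OF e]] by (simp add: fsig_comp_simps th um mm del: map_map in_lists_conv_set)
  next
    fix us vs e assume e: "e \<in> OutBox (SDom f) us vs"
    then have "c.ob us vs e = FM (LK k) (g.ob (map (kobj f) us) (map (hobj f) vs) (hOutBox f us vs e))"
      using d(6)[OF e] g'(6)[OF e] fm'(6)[OF e] by (simp add: c.ob_def g.ob_def ap)
    then show "c.ob us vs e = hOutBox (fsig_comp (fsig_comp f (transpose S g)) (underlying_mor k)) us vs e"
      using e l(4)[OF e] tt(6)[OF fm'(6)[OF e]] by (simp add: fsig_comp_simps th um mm del: map_map in_lists_conv_set)
  qed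
qed

section \<open>The copy inside the universe and its universal property\<close>

context coding
begin

text \<open>A class is coded through its chosen representative, which determines the class among the
  classes of well-formed terms.\<close>

definition code_class :: "'u syn2 \<Rightarrow> 'u" where
  "code_class m = code_tm (rep m)"

definition free_lax :: "'u fsig \<Rightarrow> 'u ulax" where
  "free_lax S = transport_lax code_path code_class code_path code_class (syntactic_lax S)"

definition enc :: "'u fsig \<Rightarrow> ('u syn1, 'u syn2, 'u syn1, 'u syn2, 'u, 'u, 'u, 'u) lax_mor" where
  "enc S = transported_lax.to_U (syntactic_lax S) code_path code_class code_path code_class"

definition dec :: "'u fsig \<Rightarrow> ('u, 'u, 'u, 'u, 'u syn1, 'u syn2, 'u syn1, 'u syn2) lax_mor" where
  "dec S = transported_lax.from_U (syntactic_lax S) code_path code_class code_path code_class"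

lemma transported_syntactic:
  assumes "is_fsig S"
  shows "transported_lax (syntactic_lax S) code_path code_class code_path code_class"
proof -
  interpret S: signature S by unfold_locales fact
  have i: "inj_on code_class M" if "\<And>m. m \<in> M \<Longrightarrow> \<exists>t. wf_tm S.P t \<and> m = tm_class S.P t" for M
  proof (rule inj_onI)
    fix m n assume "m \<in> M" "n \<in> M" "code_class m = code_class n"
    then have "rep m = rep n" and "\<exists>p q. S.cell m p q" "\<exists>p q. S.cell n p q"
      using that unfolding S.cell_def code_class_def by auto
    then show "m = n" using S.rep_cell(4) by metis
  qed
  have "inj_on code_class (Arr (Source (syntactic_lax S)))" "inj_on code_class (Arr (Target (syntactic_lax S)))"
    by (rule i; unfold S.source_Arr S.target_Arr; blast)+
  moreover have "inj_on code_path M" for M by (rule inj_onI) simp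
  ultimately show ?thesis
    using S.syntactic_lax
    by (intro_locales; simp add: lax_functor_def transported_axioms_def lax_monoidal_def Let_def monoidal_category_def)
qed

lemma enc_dec:
  assumes "is_fsig S"
  shows "is_lax_mor (enc S)" "LDom (enc S) = syntactic_lax S" "LCod (enc S) = free_lax S"
    "is_lax_mor (dec S)" "LDom (dec S) = free_lax S" "LCod (dec S) = syntactic_lax S"
    "lax_comp (enc S) (dec S) = lax_id (syntactic_lax S)" "lax_comp (dec S) (enc S) = lax_id (free_lax S)"
    "is_lax_iso (dec S)" "lax_monoidal (free_lax S)"
proof -
  interpret t: transported_lax "syntactic_lax S" code_path code_class code_path code_class
    by (rule transported_syntactic[OF assms])
  show "is_lax_mor (enc S)" "LDom (enc S) = syntactic_lax S" "LCod (enc S) = free_lax S"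
    "is_lax_mor (dec S)" "LDom (dec S) = free_lax S" "LCod (dec S) = syntactic_lax S"
    "lax_comp (enc S) (dec S) = lax_id (syntactic_lax S)" "lax_comp (dec S) (enc S) = lax_id (free_lax S)"
    "is_lax_iso (dec S)" "lax_monoidal (free_lax S)"
    unfolding enc_def dec_def free_lax_def
    by (rule t.to_U t.from_U t.to_from_U t.from_to_U t.from_U_iso t.U_lax | simp add: t.to_U_def t.from_U_def)+
qed

definition free_mor :: "'u fsig_mor \<Rightarrow> 'u ulax_mor" where
  "free_mor m = lax_comp (dec (SDom m)) (lax_comp (syntactic_lax_mor m) (enc (SCod m)))"

definition free :: "('u fsig, 'u fsig_mor, 'u ulax, 'u ulax_mor) fct" where
  "free = \<lparr>FO = free_lax, FM = free_mor\<rparr>"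

text \<open>The last two equations are the naturality of the coding isomorphisms \<open>enc\<close>
  and \<open>dec\<close>, obtained by cancelling them against each other.\<close>

lemma free_mor:
  assumes "is_fsig_mor m"
  shows "is_lax_mor (free_mor m)" "LDom (free_mor m) = free_lax (SDom m)" "LCod (free_mor m) = free_lax (SCod m)"
    "lax_comp (enc (SDom m)) (free_mor m) = lax_comp (syntactic_lax_mor m) (enc (SCod m))"
    "lax_comp (free_mor m) (dec (SCod m)) = lax_comp (dec (SDom m)) (syntactic_lax_mor m)"
proof -
  interpret m: fsig_morphism m by unfold_locales fact
  note d = enc_dec[OF m.dom_cod(1)] and c = enc_dec[OF m.dom_cod(2)]
  note s = m.syntactic_lax_mor m.syn_simps(1,2)
  have 1: "is_lax_mor (lax_comp (syntactic_lax_mor m) (enc (SCod m)))"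
    using s c by (simp add: lax_comp_mor)
  show "is_lax_mor (free_mor m)"
    unfolding free_mor_def using d s by (intro lax_comp_mor 1) (simp_all add: lax_comp_simps)
  show "LDom (free_mor m) = free_lax (SDom m)" "LCod (free_mor m) = free_lax (SCod m)"
    using d c by (simp_all add: free_mor_def lax_comp_simps)
  have "lax_comp (lax_comp (enc (SDom m)) (dec (SDom m))) (lax_comp (syntactic_lax_mor m) (enc (SCod m))) =
      lax_comp (enc (SDom m)) (free_mor m)"
    unfolding free_mor_def by (rule lax_comp_assoc[OF d(1)]) (simp add: d)
  then show "lax_comp (enc (SDom m)) (free_mor m) = lax_comp (syntactic_lax_mor m) (enc (SCod m))"
    using lax_id_comp[OF 1] by (simp add: d(7) lax_comp_simps s)
  have "lax_comp (free_mor m) (dec (SCod m)) =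
      lax_comp (dec (SDom m)) (lax_comp (lax_comp (syntactic_lax_mor m) (enc (SCod m))) (dec (SCod m)))"
    unfolding free_mor_def by (rule lax_comp_assoc[OF d(4)]) (simp add: d s lax_comp_simps)
  moreover have "lax_comp (lax_comp (syntactic_lax_mor m) (enc (SCod m))) (dec (SCod m)) =
      lax_comp (syntactic_lax_mor m) (lax_comp (enc (SCod m)) (dec (SCod m)))"
    by (rule lax_comp_assoc[OF s(1)]) (simp add: s c)
  ultimately show "lax_comp (free_mor m) (dec (SCod m)) = lax_comp (dec (SDom m)) (syntactic_lax_mor m)"
    using lax_comp_id[OF s(1)] by (simp add: c(7) s)
qed

lemma free_functor: "is_functor Fbox Lax free"
proof -
  interpret L: category "Lax :: ('u ulax, 'u ulax_mor) cat" by (rule Lax_category)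
  interpret B: category "Fbox :: ('u fsig, 'u fsig_mor) cat" by (rule Fbox_category)
  show ?thesis
  proof unfold_locales
    fix S :: "'u fsig" assume "S \<in> Obj Fbox"
    then have S: "is_fsig S" by (simp add: Fbox_simps)
    interpret S: signature S by unfold_locales fact
    note e = enc_dec[OF S]
    show "FO free S \<in> Obj Lax" by (simp add: free_def Lax_simps e)
    have "SDom (fsig_id S) = S" "SCod (fsig_id S) = S" by (simp_all add: fsig_id_def)
    then have "free_mor (fsig_id S) = lax_comp (dec S) (lax_comp (lax_id (syntactic_lax S)) (enc S))"
      by (simp add: free_mor_def syntactic_lax_mor_id[OF S])
    also have "\<dots> = lax_id (free_lax S)"
      using e by (simp add: lax_id_comp)
    finally show "FM free (Idn Fbox S) = Idn Lax (FO free S)"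
      by (simp add: free_def Lax_simps Fbox_simps)
  next
    fix m :: "'u fsig_mor" and S S' assume "m \<in> hom Fbox S S'"
    then show "FM free m \<in> hom Lax (FO free S) (FO free S')"
      by (auto simp: free_def Lax_simps Fbox_simps hom_def free_mor)
  next
    fix m m' :: "'u fsig_mor" and S S' S'' assume "m \<in> hom Fbox S S'" "m' \<in> hom Fbox S' S''"
    then have m: "is_fsig_mor m" "SDom m = S" "SCod m = S'" and m': "is_fsig_mor m'" "SDom m' = S'" "SCod m' = S''"
      by (auto simp: Fbox_simps hom_def)
    interpret m: fsig_morphism m by unfold_locales (rule m)
    interpret m': fsig_morphism m' by unfold_locales (rule m')
    note e = enc_dec[OF m.dom_cod(1)] and e' = enc_dec[OF m'.dom_cod(1)] and e'' = enc_dec[OF m'.dom_cod(2)]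
    note s = m.syntactic_lax_mor m.syn_simps(1,2) and s' = m'.syntactic_lax_mor m'.syn_simps(1,2)
    have c: "SCod m = SDom m'" by (simp add: m m')
    have "lax_comp (free_mor m) (free_mor m') =
        lax_comp (dec (SDom m)) (lax_comp (lax_comp (syntactic_lax_mor m) (enc (SCod m))) (free_mor m'))"
      unfolding free_mor_def[of m] by (rule lax_comp_assoc[OF e(4)]) (simp add: e s lax_comp_simps)
    also have "lax_comp (lax_comp (syntactic_lax_mor m) (enc (SCod m))) (free_mor m') =
        lax_comp (syntactic_lax_mor m) (lax_comp (enc (SDom m')) (free_mor m'))"
      unfolding c by (rule lax_comp_assoc[OF s(1)]) (simp add: e' s c)
    also have "\<dots> = lax_comp (lax_comp (syntactic_lax_mor m) (syntactic_lax_mor m')) (enc (SCod m'))"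
      unfolding free_mor(4)[OF m'(1)] by (rule lax_comp_assoc[OF s(1), symmetric]) (simp add: s s' c)
    also have "lax_comp (dec (SDom m)) \<dots> = free_mor (fsig_comp m m')"
      by (simp add: free_mor_def fsig_comp_simps syntactic_lax_mor_comp[OF m(1) m'(1) c])
    finally show "FM free (m ;;\<^bsub>Fbox\<^esub> m') = FM free m ;;\<^bsub>Lax\<^esub> FM free m'"
      by (simp add: free_def Lax_simps Fbox_simps)
  qed
qed

definition adjunct :: "'u fsig \<Rightarrow> 'u ulax \<Rightarrow> 'u ulax_mor \<Rightarrow> 'u fsig_mor" where
  "adjunct S T g = transpose S (lax_comp (enc S) g)"

lemma lax_from_syntactic_iff:
  "is_fsig S \<Longrightarrow> lax_from_syntactic S g \<longleftrightarrow> is_lax_mor g \<and> LDom g = syntactic_lax S"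
  by (auto simp: lax_from_syntactic_def lax_from_syntactic_axioms_def signature_def lax_morphism_def)

lemma enc_from:
  assumes "is_fsig S" "is_lax_mor g" "LDom g = free_lax S"
  shows "lax_from_syntactic S (lax_comp (enc S) g)"
  using assms by (simp add: lax_from_syntactic_iff lax_comp_mor enc_dec lax_comp_simps)

text \<open>Precomposition with the isomorphism \<open>enc\<close>, whose inverse is precomposition
  with \<open>dec\<close>, followed by the bijection \<open>transpose\<close> for the syntactic lax
  functor.\<close>

lemma adjunct_bij:
  assumes S: "is_fsig S" and T: "lax_monoidal T"
  shows "bij_betw (adjunct S T) (hom Lax (free_lax S) T) (hom Fbox S (underlying_sig T))"
proof (rule bij_betwI')
  note e = enc_dec[OF S]
  have ed: "lax_comp (dec S) (lax_comp (enc S) g) = g" if "is_lax_mor g" "LDom g = free_lax S" for g :: "'u ulax_mor"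
    using that lax_comp_assoc[OF e(4), of "enc S" g] e by (simp add: lax_id_comp)
  fix g g' assume "g \<in> hom Lax (free_lax S) T" "g' \<in> hom Lax (free_lax S) T"
  then have g: "is_lax_mor g" "LDom g = free_lax S" "LCod g = T"
    and g': "is_lax_mor g'" "LDom g' = free_lax S" "LCod g' = T"
    by (auto simp: hom_def Lax_simps)
  show "adjunct S T g = adjunct S T g' \<longleftrightarrow> g = g'"
  proof
    assume "adjunct S T g = adjunct S T g'"
    then have "lax_comp (enc S) g = lax_comp (enc S) g'"
      using transpose_inj[OF enc_from[OF S g(1,2)] enc_from[OF S g'(1,2)]] g g'
      by (simp add: adjunct_def lax_comp_simps)
    then show "g = g'" using ed[OF g(1,2)] ed[OF g'(1,2)] by metis
  qed simp
next
  fix g assume "g \<in> hom Lax (free_lax S) T"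
  then have g: "is_lax_mor g" "LDom g = free_lax S" "LCod g = T"
    by (auto simp: hom_def Lax_simps)
  show "adjunct S T g \<in> hom Fbox S (underlying_sig T)"
    using transpose_mor[OF enc_from[OF S g(1,2)]] g
    by (simp add: hom_def Fbox_simps adjunct_def) (simp add: transpose_def lax_comp_simps)
next
  note e = enc_dec[OF S]
  fix f assume "f \<in> hom Fbox S (underlying_sig T)"
  then have "is_fsig_mor f" "SDom f = S" "SCod f = underlying_sig T"
    by (auto simp: hom_def Fbox_simps)
  from transpose_surj[OF this T] obtain g
    where "lax_from_syntactic S g" and g': "LCod g = T" "transpose S g = f" by blast
  then have g: "is_lax_mor g" "LDom g = syntactic_lax S" "LCod g = T" "transpose S g = f"
    by (simp_all add: lax_from_syntactic_iff[OF S])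
  have "lax_comp (enc S) (lax_comp (dec S) g) = g"
    using g lax_comp_assoc[OF e(1), of "dec S" g] e by (simp add: lax_id_comp)
  then have "f = adjunct S T (lax_comp (dec S) g)" using g by (simp add: adjunct_def)
  moreover have "lax_comp (dec S) g \<in> hom Lax (free_lax S) T"
    using g e by (simp add: hom_def Lax_simps lax_comp_mor lax_comp_simps)
  ultimately show "\<exists>g \<in> hom Lax (free_lax S) T. f = adjunct S T g" by blast
qed

lemma free_adjunction: "adjunction Fbox Lax free underlying adjunct"
proof -
  interpret L: is_functor "Fbox :: ('u fsig, 'u fsig_mor) cat" "Lax :: ('u ulax, 'u ulax_mor) cat" free
    by (rule free_functor)
  interpret R: is_functor "Lax :: ('u ulax, 'u ulax_mor) cat" "Fbox :: ('u fsig, 'u fsig_mor) cat" underlying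
    by (rule underlying_functor)
  show ?thesis
  proof unfold_locales
    fix S :: "'u fsig" and T :: "'u ulax" assume "S \<in> Obj Fbox" "T \<in> Obj Lax"
    then show "bij_betw (adjunct S T) (hom Lax (FO free S) T) (hom Fbox S (FO underlying T))"
      using adjunct_bij by (simp add: free_def underlying_def Fbox_simps Lax_simps)
  next
    fix f :: "'u fsig_mor" and g k :: "'u ulax_mor" and S' S T T'
    assume "f \<in> hom Fbox S' S" "g \<in> hom Lax (FO free S) T" "k \<in> hom Lax T T'"
    then have f: "is_fsig_mor f" "SDom f = S'" "SCod f = S" and g: "is_lax_mor g" "LDom g = free_lax S" "LCod g = T"
      and k: "is_lax_mor k" "LDom k = T" "LCod k = T'"
      by (auto simp: hom_def Fbox_simps Lax_simps free_def)
    interpret f: fsig_morphism f by unfold_locales (rule f)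
    note e' = enc_dec[OF f.dom_cod(1), unfolded f] and e = enc_dec[OF f.dom_cod(2), unfolded f]
    note s = f.syntactic_lax_mor f.syn_simps(1,2)[unfolded f]
    note fm = free_mor[OF f(1), unfolded f]
    \<comment> \<open>Rebracketing brings \<open>enc S'\<close> next to \<open>free_mor f\<close>,
      where naturality of the coding replaces the latter by relabelling; then
      \<open>transpose_natural\<close> applies.\<close>
    have "lax_comp (enc S') (lax_comp (lax_comp (free_mor f) g) k) =
        lax_comp (lax_comp (lax_comp (enc S') (free_mor f)) g) k"
    proof -
      have "lax_comp (lax_comp (enc S') (lax_comp (free_mor f) g)) k =
          lax_comp (enc S') (lax_comp (lax_comp (free_mor f) g) k)"
        by (rule lax_comp_assoc[OF e'(1)]) (simp add: lax_comp_simps e' fm)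
      moreover have "lax_comp (lax_comp (enc S') (free_mor f)) g = lax_comp (enc S') (lax_comp (free_mor f) g)"
        by (rule lax_comp_assoc[OF e'(1)]) (simp add: e' fm)
      ultimately show ?thesis by (simp only:)
    qed
    also have "\<dots> = lax_comp (lax_comp (syntactic_lax_mor f) (lax_comp (enc S) g)) k"
      unfolding fm(4) using lax_comp_assoc[OF s(1), of "enc S" g] by (simp add: s e)
    finally have "adjunct S' T' (lax_comp (lax_comp (free_mor f) g) k) =
        transpose S' (lax_comp (lax_comp (syntactic_lax_mor f) (lax_comp (enc S) g)) k)"
      by (simp add: adjunct_def)
    also have "\<dots> = fsig_comp (fsig_comp f (adjunct S T g)) (underlying_mor k)"
      using transpose_natural[OF f(1,3) enc_from[OF _ g(1,2)] k(1)] f.dom_cod f g k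
      by (simp add: adjunct_def lax_comp_simps)
    finally show "adjunct S' T' (FM free f ;;\<^bsub>Lax\<^esub> g ;;\<^bsub>Lax\<^esub> k) =
        f ;;\<^bsub>Fbox\<^esub> adjunct S T g ;;\<^bsub>Fbox\<^esub> FM underlying k"
      by (simp add: Lax_simps Fbox_simps free_def underlying_def)
  qed
qed

lemma free_naturally_iso: "naturally_iso_syntactic free"
proof -
  have "is_lax_iso (dec S) \<and> LDom (dec S) = FO free S \<and> LCod (dec S) = syntactic_lax S"
    if "S \<in> Obj Fbox" for S
    using that enc_dec[of S] by (simp add: Fbox_simps free_def)
  moreover have "lax_comp (FM free m) (dec (Cod Fbox m)) = lax_comp (dec (Dom Fbox m)) (syntactic_lax_mor m)"
    if "m \<in> Arr Fbox" for m
    using that free_mor(5)[of m] by (simp add: Fbox_simps free_def)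
  ultimately show ?thesis unfolding naturally_iso_syntactic_def by blast
qed

end

theorem theorem3p4:
  assumes "infinite (UNIV :: 'u set)"
  shows "\<exists>(L :: ('u fsig, 'u fsig_mor, 'u ulax, 'u ulax_mor) fct)
          (R :: ('u ulax, 'u ulax_mor, 'u fsig, 'u fsig_mor) fct) \<phi>.
        adjunction Fbox Lax L R \<phi> \<and> naturally_iso_syntactic L"
proof -
  obtain pair :: "'u \<times> 'u \<Rightarrow> 'u" and tag where "coding pair tag"
    using coding_exists[OF assms] by blast
  then interpret coding pair tag .
  show ?thesis using free_adjunction free_naturally_iso by blast
qed

end
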